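(* Let $n\geq 4$ be an integer. Then \[\mathrm{TREE}^{\mathrm{reg}}_{\mathrm{pd}}(n)=\{(p,r)\in \mathbb{Z}^2 : 1\leq r < n/2, \ \lceil n/2 \rceil \leq p \leq n-r \}.\]
   Context: Graphs are finite and simple. Let $\Bbbk$ be a field and $S=\Bbbk[x_1,\dots,x_n]$. For a graph $G$ with vertex set $\{x_1,\dots,x_n\}$, the edge ideal is $I(G)=(x_ix_j : \{x_i,x_j\}\in E(G))\subseteq S$. For a finitely generated graded $S$-module $M$ with graded Betti numbers $b_{i,j}(M)$, $\mathrm{pd}(M)=\max\{i: b_{i,j}(M)\neq 0 \text{ for some } j\}$ is the projective dimension and $\mathrm{reg}(M)=\max\{j-i: b_{i,j}(M)\neq 0\}$ is the Castelnuovo-Mumford regularity. $\mathrm{TREE}(n)$ denotes the set of all trees (connected graphs without cycles) on the vertices $\{x_1,\dots,x_n\}$, and \[\mathrm{TREE}_{\mathrm{pd}}^{\mathrm{reg}}(n)=\{(\mathrm{pd}(S/I(G)),\mathrm{reg}(S/I(G))): G\in \mathrm{TREE}(n)\}.\] *)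

theory Defs
  imports Complex_Main "HOL-Library.Poly_Mapping" "HOL-Algebra.QuotRing" "HOL-Algebra.Module"
begin

section \<open>The polynomial ring\<close>

text \<open>
  A monomial in the variables $x_0, x_1, \dots$ is a finitely supported exponent function, and a
  polynomial is a finitely supported function from monomials to coefficients. The ring operations
  on this type are those of \<^theory>\<open>HOL-Library.Poly_Mapping\<close>; \<open>poly_ring n\<close> is its subring
  $S = \Bbbk[x_1,\dots,x_n]$.
\<close>

type_synonym 'k mpoly = "(nat \<Rightarrow>\<^sub>0 nat) \<Rightarrow>\<^sub>0 'k"

definition poly_ring :: "nat \<Rightarrow> 'k::field mpoly ring" where
  "poly_ring n =
    \<lparr>carrier = {f. \<forall>m \<in> Poly_Mapping.keys f. Poly_Mapping.keys m \<subseteq> {1..n}},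
     mult = (*), one = 1, zero = 0, add = (+)\<rparr>"

definition Var :: "nat \<Rightarrow> 'k::field mpoly" where
  "Var i = Poly_Mapping.single (Poly_Mapping.single i 1) 1"

definition mono_deg :: "(nat \<Rightarrow>\<^sub>0 nat) \<Rightarrow> nat" where
  "mono_deg m = (\<Sum>i \<in> Poly_Mapping.keys m. Poly_Mapping.lookup m i)"

text \<open>The homogeneous component $S_j$; it is zero for negative $j$.\<close>

definition homog :: "nat \<Rightarrow> int \<Rightarrow> 'k::field mpoly set" where
  "homog n j = {f \<in> carrier (poly_ring n). \<forall>m \<in> Poly_Mapping.keys f. int (mono_deg m) = j}"

definition max_ideal :: "nat \<Rightarrow> 'k::field mpoly set" where
  "max_ideal n = Idl\<^bsub>poly_ring n\<^esub> (Var ` {1..n})"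


section \<open>Graded modules and minimal graded free resolutions\<close>

record ('a, 'b) graded_module = "('a, 'b) module" +
  component :: "int \<Rightarrow> 'b set"

text \<open>Homomorphisms of graded modules, of degree zero.\<close>

definition graded_hom ::
  "nat \<Rightarrow> ('k::field mpoly, 'a) graded_module \<Rightarrow> ('k mpoly, 'b) graded_module \<Rightarrow> ('a \<Rightarrow> 'b) set" where
  "graded_hom n M N = {f \<in> hom (add_monoid M) (add_monoid N).
     (\<forall>s \<in> carrier (poly_ring n). \<forall>x \<in> carrier M. f (s \<odot>\<^bsub>M\<^esub> x) = s \<odot>\<^bsub>N\<^esub> f x) \<and>
     (\<forall>j. f ` component M j \<subseteq> component N j)}"

text \<open>
  The graded free module $\bigoplus_c S(-d_c)$ with one basis element in degree $d_c$ for each entry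
  $d_c$ of the list. Its elements are coordinate vectors, set to zero beyond the length of the list.
  The fields \<open>mult\<close> and \<open>one\<close> that module records inherit from ring records carry no
  information.
\<close>

definition free_module :: "nat \<Rightarrow> int list \<Rightarrow> ('k::field mpoly, nat \<Rightarrow> 'k mpoly) graded_module" where
  "free_module n ds =
    (let F = {v. (\<forall>c. v c \<in> carrier (poly_ring n)) \<and> (\<forall>c \<ge> length ds. v c = 0)} in
     \<lparr>carrier = F, mult = undefined, one = undefined,
      zero = (\<lambda>c. 0), add = (\<lambda>v w c. v c + w c),
      smult = (\<lambda>s v c. s * v c),
      component = (\<lambda>j. {v \<in> F. \<forall>c < length ds. v c \<in> homog n (j - ds ! c)})\<rparr>)"

text \<open>
  A graded free resolution
  $\cdots \to F_2 \xrightarrow{\delta_1} F_1 \xrightarrow{\delta_0} F_0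
  \xrightarrow{\varepsilon} M \to 0$ by free modules of finite rank, where \<open>ds i\<close> lists the degrees
  of the basis of $F_i$. It may have any length; $F_i = 0$ if \<open>ds i\<close> is empty.
\<close>

definition graded_free_resolution ::
  "nat \<Rightarrow> ('k::field mpoly, 'a) graded_module \<Rightarrow> (nat \<Rightarrow> int list) \<Rightarrow>
   (nat \<Rightarrow> (nat \<Rightarrow> 'k mpoly) \<Rightarrow> (nat \<Rightarrow> 'k mpoly)) \<Rightarrow> ((nat \<Rightarrow> 'k mpoly) \<Rightarrow> 'a) \<Rightarrow> bool" where
  "graded_free_resolution n M ds \<delta> \<epsilon> \<longleftrightarrow>
    (let F = (\<lambda>i. free_module n (ds i)) in
     \<epsilon> \<in> graded_hom n (F 0) M \<and>
     (\<forall>i. \<delta> i \<in> graded_hom n (F (Suc i)) (F i)) \<and>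
     \<epsilon> ` carrier (F 0) = carrier M \<and>
     \<delta> 0 ` carrier (F 1) = a_kernel (F 0) M \<epsilon> \<and>
     (\<forall>i. \<delta> (Suc i) ` carrier (F (Suc (Suc i))) = a_kernel (F (Suc i)) (F i) (\<delta> i)))"

text \<open>Minimality: $\delta_i(F_{i+1}) \subseteq \mathfrak{m} F_i$ for
  $\mathfrak{m} = (x_1,\dots,x_n)$.\<close>

definition minimal_graded_free_resolution ::
  "nat \<Rightarrow> ('k::field mpoly, 'a) graded_module \<Rightarrow> (nat \<Rightarrow> int list) \<Rightarrow>
   (nat \<Rightarrow> (nat \<Rightarrow> 'k mpoly) \<Rightarrow> (nat \<Rightarrow> 'k mpoly)) \<Rightarrow> ((nat \<Rightarrow> 'k mpoly) \<Rightarrow> 'a) \<Rightarrow> bool" where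
  "minimal_graded_free_resolution n M ds \<delta> \<epsilon> \<longleftrightarrow>
    graded_free_resolution n M ds \<delta> \<epsilon> \<and>
    (\<forall>i. \<forall>v \<in> carrier (free_module n (ds (Suc i))). \<forall>c. \<delta> i v c \<in> max_ideal n)"

text \<open>
  $b_{i,j}(M)$ is the number of copies of $S(-j)$ in the $i$-th module of a minimal graded free
  resolution of $M$. For finitely generated graded $M$ such a resolution exists and this number does
  not depend on the resolution, so the description below is proper.
\<close>

definition betti :: "nat \<Rightarrow> ('k::field mpoly, 'a) graded_module \<Rightarrow> nat \<Rightarrow> int \<Rightarrow> nat" where
  "betti n M i j =
    (THE b. \<exists>ds \<delta> \<epsilon>. minimal_graded_free_resolution n M ds \<delta> \<epsilon> \<and> b = count_list (ds i) j)"

definition proj_dim :: "nat \<Rightarrow> ('k::field mpoly, 'a) graded_module \<Rightarrow> int" where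
  "proj_dim n M = Max {int i | i. \<exists>j. betti n M i j \<noteq> 0}"

definition regularity :: "nat \<Rightarrow> ('k::field mpoly, 'a) graded_module \<Rightarrow> int" where
  "regularity n M = Max {j - int i | i j. betti n M i j \<noteq> 0}"

text \<open>$S/I$ as a graded $S$-module, for a homogeneous ideal $I$.\<close>

definition quotient_module ::
  "nat \<Rightarrow> 'k::field mpoly set \<Rightarrow> ('k mpoly, 'k mpoly set) graded_module" where
  "quotient_module n I =
    (let S = poly_ring n; Q = S Quot I in
     \<lparr>carrier = carrier Q, mult = mult Q, one = one Q, zero = zero Q, add = add Q,
      smult = (\<lambda>s X. (I +>\<^bsub>S\<^esub> s) \<otimes>\<^bsub>Q\<^esub> X),
      component = (\<lambda>j. (\<lambda>f. I +>\<^bsub>S\<^esub> f) ` homog n j)\<rparr>)"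


section \<open>Trees and edge ideals\<close>

text \<open>
  A finite simple graph on the vertices $x_1,\dots,x_n$ is given by its set of edges, which are
  two-element subsets of $\{1,\dots,n\}$; the number $i$ stands for the vertex $x_i$.
\<close>

definition simple_graph :: "nat \<Rightarrow> nat set set \<Rightarrow> bool" where
  "simple_graph n E \<longleftrightarrow> (\<forall>e \<in> E. e \<subseteq> {1..n} \<and> card e = 2)"

definition graph_connected :: "nat \<Rightarrow> nat set set \<Rightarrow> bool" where
  "graph_connected n E \<longleftrightarrow> (\<forall>u \<in> {1..n}. \<forall>v \<in> {1..n}. (u, v) \<in> {(a, b). {a, b} \<in> E}\<^sup>*)"

definition is_cycle :: "nat set set \<Rightarrow> nat list \<Rightarrow> bool" where
  "is_cycle E xs \<longleftrightarrow> 3 \<le> length xs \<and> distinct xs \<and>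
    (\<forall>k. Suc k < length xs \<longrightarrow> {xs ! k, xs ! Suc k} \<in> E) \<and> {last xs, hd xs} \<in> E"

definition TREE :: "nat \<Rightarrow> nat set set set" where
  "TREE n = {E. simple_graph n E \<and> graph_connected n E \<and> (\<nexists>xs. is_cycle E xs)}"

definition edge_ideal :: "nat \<Rightarrow> nat set set \<Rightarrow> 'k::field mpoly set" where
  "edge_ideal n E = Idl\<^bsub>poly_ring n\<^esub> {Var i * Var j | i j. {i, j} \<in> E}"

definition TREE_pd_reg :: "'k::field itself \<Rightarrow> nat \<Rightarrow> (int \<times> int) set" where
  "TREE_pd_reg K n =
    {(proj_dim n (quotient_module n (edge_ideal n E :: 'k mpoly set)),
      regularity n (quotient_module n (edge_ideal n E :: 'k mpoly set))) | E. E \<in> TREE n}"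

end

theory Submission
  imports Defs "HOL-Library.Function_Algebras"
begin

text \<open>
  For a forest, the projective dimension of \<open>S/I(G)\<close> is \<open>n\<close> minus the least size of a maximal
  independent set, and the regularity is the induced matching number. Both follow by induction on
  the edges. Let \<open>u\<close> be a leaf with neighbour \<open>v\<close>. Since \<open>u\<close> is regular on \<open>S/I(G - uv)\<close>, the ideal
  \<open>I(G - uv) : uv\<close> equals \<open>I(G - uv) : v\<close>, which is \<open>I(G - N[v])\<close> plus the variables in \<open>N(v) - u\<close>.
  Multiplication by \<open>uv\<close> lifts to \<open>u\<close> times a map of resolutions lifting multiplication by \<open>v\<close>, so
  the mapping cone is minimal and the Betti numbers of \<open>G\<close> are obtained from those of \<open>G - uv\<close> and
  \<open>G - N[v]\<close> without cancellation.

  For a tree, a 2-colouring gives two maximal independent sets covering the vertices, hence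
  \<open>n \<le> 2 pd\<close>. Every maximal independent set is at least as large as every induced matching, hence
  \<open>pd + reg \<le> n\<close>. A perfect induced matching would contradict connectedness, hence \<open>2 reg < n\<close>.
\<close>

section \<open>Polynomials and monomial ideals\<close>

text \<open>The obstacle is that \<open>betti\<close> is a definite description: nothing can be
  computed until a minimal resolution is exhibited and all others are shown to have the same ranks.
  Uniqueness is obtained for monomial ideals, by comparing resolutions through chain maps and
  reducing modulo the maximal ideal. Existence is needed only for forests, where the iterated cones
  supply it.

  Every ideal that occurs is spanned by monomials and is stored as a set of exponents, so that colon
  ideals and regularity of a variable become statements about exponents.

  Absence of cancellation gives pd(G) = max(pd(G - uv), pd(G - N[v]) + |N(v)|) and reg(G) =
  max(reg(G - uv), reg(G - N[v]) + 1): the |N(v)| - 1 extra variables and the cone each add 1 to pd,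
  and the degree of v adds 1 to reg. Both graph invariants obey the same recursions.

  Conversely, (p, r) is realized by a tree of depth two in which n - p - r counts the leaves
  attached to the root.\<close>

abbreviation coef :: "('a \<Rightarrow>\<^sub>0 'b::zero) \<Rightarrow> 'a \<Rightarrow> 'b" where "coef \<equiv> Poly_Mapping.lookup"
abbreviation supp :: "('a \<Rightarrow>\<^sub>0 'b::zero) \<Rightarrow> 'a set" where "supp \<equiv> Poly_Mapping.keys"
abbreviation polys :: "nat \<Rightarrow> 'k::field mpoly set" where "polys n \<equiv> carrier (poly_ring n)"

lemma polys_iff: "f \<in> polys n \<longleftrightarrow> (\<forall>m \<in> supp f. supp m \<subseteq> {1..n})"
  by (simp add: poly_ring_def)

lemma supp_add_nat: "supp (a + b :: nat \<Rightarrow>\<^sub>0 nat) = supp a \<union> supp b"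
  by (auto simp: in_keys_iff lookup_add)

lemma supp_eq_empty: "supp m = {} \<longleftrightarrow> m = 0"
  by (metis all_not_in_conv in_keys_iff keys_zero lookup_zero poly_mapping_eqI)

lemma polys_zero [simp]: "0 \<in> polys n" and polys_one [simp]: "1 \<in> polys n"
  by (auto simp: polys_iff)

lemma polys_add [intro]: "f \<in> polys n \<Longrightarrow> g \<in> polys n \<Longrightarrow> f + g \<in> polys n"
  using keys_add[of f g] by (auto simp: polys_iff)

lemma supp_uminus [simp]: "supp (- f :: 'k::field mpoly) = supp f"
  by (auto simp: in_keys_iff)

lemma polys_uminus [intro]: "f \<in> polys n \<Longrightarrow> - f \<in> polys n"
  by (auto simp: polys_iff)

lemma polys_diff [intro]: "f \<in> polys n \<Longrightarrow> g \<in> polys n \<Longrightarrow> f - g \<in> polys n"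
  using polys_add[of f n "- g"] by auto

lemma polys_mult [intro]: "f \<in> polys n \<Longrightarrow> g \<in> polys n \<Longrightarrow> f * g \<in> polys n"
  using keys_mult[of f g] by (fastforce simp: polys_iff supp_add_nat)

lemma polys_sum [intro]: "(\<And>i. i \<in> A \<Longrightarrow> f i \<in> polys n) \<Longrightarrow> (\<Sum>i\<in>A. f i) \<in> polys n"
  by (induction A rule: infinite_finite_induct) auto

lemma supp_Var [simp]: "supp (Var i :: 'k::field mpoly) = {Poly_Mapping.single i 1}"
  by (simp add: Var_def)

lemma polys_Var [simp]: "i \<in> {1..n} \<Longrightarrow> Var i \<in> polys n"
  by (auto simp: polys_iff)

lemma poly_ring_simps [simp]:
  "mult (poly_ring n) = (*)" "one (poly_ring n) = 1" "zero (poly_ring n) = 0" "add (poly_ring n) = (+)"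
  by (simp_all add: poly_ring_def)

lemma cring_poly_ring: "cring (poly_ring n :: 'k::field mpoly ring)"
proof (rule cringI)
  show "abelian_group (poly_ring n :: 'k mpoly ring)"
  proof (rule abelian_groupI, goal_cases)
    case (6 x)
    then show ?case by (intro bexI[of _ "- x"]) auto
  qed (auto simp: ac_simps)
  show "comm_monoid (poly_ring n :: 'k mpoly ring)"
    by (rule comm_monoidI) (auto simp: ac_simps)
qed (auto simp: algebra_simps)

lemma poly_eq_sum_single: "(f :: 'a \<Rightarrow>\<^sub>0 'b::comm_monoid_add) = (\<Sum>m\<in>supp f. Poly_Mapping.single m (coef f m))"
proof (rule poly_mapping_eqI)
  fix k
  have "coef (\<Sum>m\<in>supp f. Poly_Mapping.single m (coef f m)) k
      = (\<Sum>m\<in>supp f. (if m = k then coef f m else 0))"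
    by (simp add: lookup_sum lookup_single when_def)
  then show "coef f k = coef (\<Sum>m\<in>supp f. Poly_Mapping.single m (coef f m)) k"
    by (auto simp: in_keys_iff)
qed

lemma mono_deg_superset: "finite A \<Longrightarrow> supp m \<subseteq> A \<Longrightarrow> mono_deg m = (\<Sum>i\<in>A. coef m i)"
  unfolding mono_deg_def by (rule sum.mono_neutral_left) (auto simp: in_keys_iff)

lemma mono_deg_add: "mono_deg (a + b) = mono_deg a + mono_deg b"
  using mono_deg_superset[of "supp a \<union> supp b" a] mono_deg_superset[of "supp a \<union> supp b" b]
    mono_deg_superset[of "supp a \<union> supp b" "a + b"]
  by (simp add: supp_add_nat lookup_add sum.distrib)

lemma mono_deg_single [simp]: "mono_deg (Poly_Mapping.single i a) = a"
  by (cases "a = 0") (auto simp: mono_deg_def)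

lemma mono_deg_zero [simp]: "mono_deg 0 = 0"
  by (simp add: mono_deg_def)

lemma homog_polys: "f \<in> homog n j \<Longrightarrow> f \<in> polys n"
  by (simp add: homog_def)

lemma homog_zero [simp]: "0 \<in> homog n j"
  by (simp add: homog_def)

lemma homog_add: "f \<in> homog n j \<Longrightarrow> g \<in> homog n j \<Longrightarrow> f + g \<in> homog n j"
  using keys_add[of f g] by (auto simp: homog_def)

lemma homog_uminus: "f \<in> homog n j \<Longrightarrow> - f \<in> homog n j"
  by (auto simp: homog_def)

lemma homog_mult: "f \<in> homog n a \<Longrightarrow> g \<in> homog n b \<Longrightarrow> f * g \<in> homog n (a + b)"
  using keys_mult[of f g] by (fastforce simp: homog_def mono_deg_add)

lemma homog_Var: "i \<in> {1..n} \<Longrightarrow> Var i \<in> homog n 1"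
  using polys_Var[of i n] by (simp add: homog_def)

lemma homog_one: "1 \<in> homog n 0"
  by (simp add: homog_def)

text \<open>Exponents are natural numbers, so a product of monomials is constant only if both
  factors are. The constant coefficient is thus the passage to the residue field, which turns
  matrices of chain maps into matrices over the field.\<close>

lemma coef_mult_zero:
  fixes f g :: "'k::field mpoly"
  shows "coef (f * g) 0 = coef f 0 * coef g 0"
proof -
  let ?s = "\<lambda>f. Poly_Mapping.single 0 (coef f 0) :: 'k mpoly"
  have nz: "0 \<notin> supp ((f - ?s f) * h)" if "f \<in> UNIV" for f h :: "'k mpoly"
  proof
    assume "0 \<in> supp ((f - ?s f) * h)"
    then obtain a b where ab: "a \<in> supp (f - ?s f)" "0 = a + b"
      using keys_mult[of "f - ?s f" h] by auto
    then have "supp a = {}" using supp_add_nat[of a b] by (metis Un_empty keys_zero)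
    then have "a = 0" by (metis all_not_in_conv in_keys_iff lookup_zero poly_mapping_eqI)
    with ab show False by (simp add: in_keys_iff lookup_minus)
  qed
  have "f * g = (f - ?s f) * g + (g - ?s g) * ?s f + ?s f * ?s g"
    by (simp add: algebra_simps)
  then have "coef (f * g) 0 = coef (?s f * ?s g) 0"
    using nz[of f g] nz[of g "?s f"] by (simp add: lookup_add in_keys_iff)
  then show ?thesis by (simp add: mult_single)
qed

lemma coef_zero_homog: "f \<in> homog n j \<Longrightarrow> j \<noteq> 0 \<Longrightarrow> coef f 0 = 0"
  by (force simp: homog_def in_keys_iff)

text \<open>The degree is an integer because subtracting basis degrees can make it negative; the
  component is then 0.\<close>

definition hpart :: "int \<Rightarrow> 'k::field mpoly \<Rightarrow> 'k mpoly" where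
  "hpart d f = Poly_Mapping.mapp (\<lambda>m c. c when int (mono_deg m) = d) f"

lemma coef_hpart: "coef (hpart d f) m = (coef f m when int (mono_deg m) = d)"
  by (auto simp: hpart_def lookup_mapp when_def in_keys_iff)

lemma hpart_add: "hpart d (f + g) = hpart d f + hpart d g"
  by (rule poly_mapping_eqI) (simp add: coef_hpart lookup_add when_def)

lemma hpart_diff: "hpart d (f - g) = hpart d f - hpart d g"
  by (rule poly_mapping_eqI) (simp add: coef_hpart lookup_minus when_def)

lemma hpart_zero [simp]: "hpart d 0 = 0"
  by (rule poly_mapping_eqI) (simp add: coef_hpart)

lemma hpart_sum: "hpart d (\<Sum>i\<in>A. f i) = (\<Sum>i\<in>A. hpart d (f i))"
  by (induction A rule: infinite_finite_induct) (auto simp: hpart_add)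

lemma supp_hpart: "supp (hpart d f) = {m \<in> supp f. int (mono_deg m) = d}"
  by (auto simp: in_keys_iff coef_hpart)

lemma hpart_homog: "f \<in> polys n \<Longrightarrow> hpart d f \<in> homog n d"
  by (auto simp: homog_def polys_iff supp_hpart)

lemma hpart_id: "f \<in> homog n d \<Longrightarrow> hpart d f = f"
  by (rule poly_mapping_eqI) (auto simp: coef_hpart homog_def in_keys_iff when_def)

lemma hpart_mult_homog:
  assumes "f \<in> polys n" "g \<in> homog n b"
  shows "hpart d (f * g) = hpart (d - b) f * g"
proof -
  let ?h = "hpart (d - b) f"
  \<comment> \<open>Every term of \<open>f - ?h\<close> has degree different from
    \<open>d - b\<close>, so it cannot reach degree \<open>d\<close> after multiplication by
    \<open>g\<close>.\<close>
  have "hpart d ((f - ?h) * g) = 0"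
  proof (rule poly_mapping_eqI, rule ccontr)
    fix m
    assume "coef (hpart d ((f - ?h) * g)) m \<noteq> coef 0 m"
    then have m: "m \<in> supp ((f - ?h) * g)" "int (mono_deg m) = d"
      by (auto simp: coef_hpart in_keys_iff when_def split: if_splits)
    then obtain x y where "x \<in> supp (f - ?h)" "y \<in> supp g" "m = x + y"
      using keys_mult[of "f - ?h" g] by auto
    moreover from this have "int (mono_deg x) \<noteq> d - b"
      by (auto simp: in_keys_iff lookup_minus coef_hpart)
    ultimately show False using m assms(2) by (auto simp: homog_def mono_deg_add)
  qed
  moreover have "hpart d (?h * g) = ?h * g"
    using homog_mult[OF hpart_homog[OF assms(1), of "d - b"] assms(2)] by (auto intro: hpart_id)
  ultimately show ?thesis
    by (metis (no_types, lifting) add_0 diff_add_cancel distrib_right hpart_add)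
qed

definition mon_ideal :: "nat \<Rightarrow> (nat \<Rightarrow>\<^sub>0 nat) set \<Rightarrow> 'k::field mpoly set" where
  "mon_ideal n U = {f \<in> polys n. supp f \<subseteq> U}"

text \<open>Closure concerns exponents in all variables; the restriction to S comes from
  \<open>polys n\<close> in \<open>mon_ideal\<close>.\<close>

definition upward :: "(nat \<Rightarrow>\<^sub>0 nat) set \<Rightarrow> bool" where
  "upward U \<longleftrightarrow> (\<forall>a\<in>U. \<forall>b. a + b \<in> U)"

lemma mon_ideal_polys: "f \<in> mon_ideal n U \<Longrightarrow> f \<in> polys n"
  by (simp add: mon_ideal_def)

lemma mon_ideal_zero [simp]: "0 \<in> mon_ideal n U"
  by (simp add: mon_ideal_def)

lemma mon_ideal_add: "f \<in> mon_ideal n U \<Longrightarrow> g \<in> mon_ideal n U \<Longrightarrow> f + g \<in> mon_ideal n U"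
  using keys_add[of f g] by (auto simp: mon_ideal_def)

lemma mon_ideal_uminus: "f \<in> mon_ideal n U \<Longrightarrow> - f \<in> mon_ideal n U"
  by (auto simp: mon_ideal_def)

lemma mon_ideal_mult:
  assumes "upward U" "g \<in> mon_ideal n U" "f \<in> polys n"
  shows "f * g \<in> mon_ideal n U"
proof -
  have "supp (g * f) \<subseteq> U"
    using assms keys_mult[of g f] by (fastforce simp: mon_ideal_def upward_def)
  then show ?thesis using assms by (auto simp: mon_ideal_def mult.commute)
qed

lemma mon_ideal_mult_right:
  "upward U \<Longrightarrow> g \<in> mon_ideal n U \<Longrightarrow> f \<in> polys n \<Longrightarrow> g * f \<in> mon_ideal n U"
  using mon_ideal_mult[of U g n f] by (simp add: mult.commute)

lemma mon_ideal_sum: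
  "(\<And>i. i \<in> A \<Longrightarrow> f i \<in> mon_ideal n U) \<Longrightarrow> (\<Sum>i\<in>A. f i) \<in> mon_ideal n U"
  by (induction A rule: infinite_finite_induct) (auto intro: mon_ideal_add)

lemma mon_ideal_hpart: "f \<in> mon_ideal n U \<Longrightarrow> hpart d f \<in> mon_ideal n U"
  by (auto simp: mon_ideal_def polys_iff supp_hpart)

lemma ideal_mon_ideal:
  assumes "upward U"
  shows "ideal (mon_ideal n U) (poly_ring n :: 'k::field mpoly ring)"
proof (rule idealI)
  interpret R: cring "poly_ring n :: 'k mpoly ring" by (rule cring_poly_ring)
  show "ring (poly_ring n :: 'k mpoly ring)" by (rule R.ring_axioms)
  have inv: "\<ominus>\<^bsub>poly_ring n\<^esub> a = - a" if "a \<in> polys n" for a :: "'k mpoly"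
    using R.minus_equality[of "- a" a] that polys_uminus[OF that] by simp
  have "(mon_ideal n U :: 'k mpoly set) \<noteq> {}" using mon_ideal_zero by blast
  then show "subgroup (mon_ideal n U) (add_monoid (poly_ring n :: 'k mpoly ring))"
    by (rule R.add.subgroupI[rotated])
      (simp_all add: mon_ideal_polys inv mon_ideal_add mon_ideal_uminus subset_iff)
qed (simp_all add: mon_ideal_mult[OF assms] mon_ideal_mult_right[OF assms])

text \<open>A polynomial lies in the ideal as soon as each of its terms does, and \<open>gen\<close>
  makes each term a multiple of a monomial generator.\<close>

lemma genideal_eq_mon_ideal:
  fixes G :: "'k::field mpoly set"
  assumes U: "upward U" and G: "G \<subseteq> mon_ideal n U"
    and gen: "\<And>m. m \<in> U \<Longrightarrow> supp m \<subseteq> {1..n} \<Longrightarrow>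
      \<exists>a b. Poly_Mapping.single a 1 \<in> G \<and> m = a + b"
  shows "Idl\<^bsub>poly_ring n\<^esub> G = mon_ideal n U"
proof
  interpret R: cring "poly_ring n :: 'k mpoly ring" by (rule cring_poly_ring)
  show "Idl\<^bsub>poly_ring n\<^esub> G \<subseteq> mon_ideal n U"
    using R.genideal_minimal[OF ideal_mon_ideal[OF U] G] .
  have GS: "G \<subseteq> polys n" using G by (auto simp: mon_ideal_polys)
  interpret I: ideal "Idl\<^bsub>poly_ring n\<^esub> G" "poly_ring n :: 'k mpoly ring"
    by (rule R.genideal_ideal[OF GS])
  have sumI: "(\<Sum>i\<in>A. f i) \<in> Idl\<^bsub>poly_ring n\<^esub> G"
    if "\<And>i. i \<in> A \<Longrightarrow> f i \<in> Idl\<^bsub>poly_ring n\<^esub> G" for A and f :: "(nat \<Rightarrow>\<^sub>0 nat) \<Rightarrow> 'k mpoly"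
    using that I.zero_closed I.a_closed
    by (induction A rule: infinite_finite_induct) auto
  show "mon_ideal n U \<subseteq> Idl\<^bsub>poly_ring n\<^esub> G"
  proof
    fix f :: "'k mpoly"
    assume f: "f \<in> mon_ideal n U"
    have "(\<Sum>m\<in>supp f. Poly_Mapping.single m (coef f m)) \<in> Idl\<^bsub>poly_ring n\<^esub> G"
    proof (rule sumI)
      fix m
      assume m: "m \<in> supp f"
      then have mU: "m \<in> U" "supp m \<subseteq> {1..n}" using f by (auto simp: mon_ideal_def polys_iff)
      from gen[OF this] obtain a b where ab: "Poly_Mapping.single a 1 \<in> G" "m = a + b" by blast
      have "Poly_Mapping.single b (coef f m) * Poly_Mapping.single a 1 \<in> Idl\<^bsub>poly_ring n\<^esub> G"
        using I.I_l_closed[of "Poly_Mapping.single a 1" "Poly_Mapping.single b (coef f m)"]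
          R.genideal_self[OF GS] ab mU by (auto simp: polys_iff supp_add_nat)
      then show "Poly_Mapping.single m (coef f m) \<in> Idl\<^bsub>poly_ring n\<^esub> G"
        by (simp add: mult_single ab(2) add.commute)
    qed
    then show "f \<in> Idl\<^bsub>poly_ring n\<^esub> G" using poly_eq_sum_single[of f] by simp
  qed
qed

lemma single_one_nonzero: "Poly_Mapping.single i (1::nat) \<noteq> 0"
  by (metis lookup_single_eq lookup_zero zero_neq_one)

text \<open>Every nonzero exponent contains a variable, so the variables generate the span of all
  nonconstant monomials. Minimality can therefore be tested on constant coefficients.\<close>

lemma max_ideal_iff: "f \<in> max_ideal n \<longleftrightarrow> f \<in> polys n \<and> coef f 0 = 0"
proof -
  have "max_ideal n = (mon_ideal n {m. m \<noteq> 0} :: 'k::field mpoly set)"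
    unfolding max_ideal_def
  proof (rule genideal_eq_mon_ideal)
    show "upward {m. m \<noteq> 0}"
      unfolding upward_def
      by (simp add: poly_mapping_eq_iff fun_eq_iff lookup_add) blast
    show "Var ` {1..n} \<subseteq> mon_ideal n {m. m \<noteq> 0}"
      using polys_Var by (auto simp: mon_ideal_def single_one_nonzero simp del: One_nat_def)
    fix m :: "nat \<Rightarrow>\<^sub>0 nat"
    assume m: "m \<in> {m. m \<noteq> 0}" "supp m \<subseteq> {1..n}"
    then obtain i where i: "i \<in> supp m"
      by (metis (mono_tags) supp_eq_empty all_not_in_conv mem_Collect_eq)
    have "m = Poly_Mapping.single i 1 + (m - Poly_Mapping.single i 1)"
      using i by (intro poly_mapping_eqI) (auto simp: lookup_add lookup_minus lookup_single when_def in_keys_iff)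
    then show "\<exists>a b. Poly_Mapping.single a 1 \<in> Var ` {1..n} \<and> m = a + b"
      using i m(2) unfolding Var_def by blast
  qed
  then show ?thesis by (auto simp: mon_ideal_def in_keys_iff subset_iff)
qed

section \<open>Graded maps of free modules\<close>

definition fvec :: "nat \<Rightarrow> nat \<Rightarrow> (nat \<Rightarrow> 'k::field mpoly) set" where
  "fvec n a = {v. (\<forall>c. v c \<in> polys n) \<and> (\<forall>c\<ge>a. v c = 0)}"

definition scale :: "'k::field mpoly \<Rightarrow> (nat \<Rightarrow> 'k mpoly) \<Rightarrow> nat \<Rightarrow> 'k mpoly" where
  "scale s v = (\<lambda>c. s * v c)"

definition unit_vec :: "nat \<Rightarrow> nat \<Rightarrow> 'k::field mpoly" where
  "unit_vec k = (\<lambda>c. if c = k then 1 else 0)"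

definition vcomp :: "nat \<Rightarrow> int list \<Rightarrow> int \<Rightarrow> (nat \<Rightarrow> 'k::field mpoly) set" where
  "vcomp n ds j = {v \<in> fvec n (length ds). \<forall>c < length ds. v c \<in> homog n (j - ds ! c)}"

definition lin :: "nat \<Rightarrow> nat \<Rightarrow> nat \<Rightarrow> ((nat \<Rightarrow> 'k::field mpoly) \<Rightarrow> (nat \<Rightarrow> 'k mpoly)) \<Rightarrow> bool" where
  "lin n a b f \<longleftrightarrow> (\<forall>v\<in>fvec n a. f v \<in> fvec n b) \<and>
    (\<forall>v\<in>fvec n a. \<forall>w\<in>fvec n a. f (v + w) = f v + f w) \<and>
    (\<forall>s\<in>polys n. \<forall>v\<in>fvec n a. f (scale s v) = scale s (f v))"

definition ghom :: "nat \<Rightarrow> int list \<Rightarrow> int list \<Rightarrow> ((nat \<Rightarrow> 'k::field mpoly) \<Rightarrow> (nat \<Rightarrow> 'k mpoly)) \<Rightarrow> bool" where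
  "ghom n ds ds' f \<longleftrightarrow> lin n (length ds) (length ds') f \<and> (\<forall>j. \<forall>v\<in>vcomp n ds j. f v \<in> vcomp n ds' j)"

text \<open>The homogeneous component of degree \<open>d\<close> for basis degrees
  \<open>ds\<close>. Past the end of the list \<open>ds ! c\<close> is unspecified, which is
  harmless: coordinates of vectors in \<open>fvec n (length ds)\<close> vanish there.\<close>

definition hvec :: "int list \<Rightarrow> int \<Rightarrow> (nat \<Rightarrow> 'k::field mpoly) \<Rightarrow> nat \<Rightarrow> 'k mpoly" where
  "hvec ds d v = (\<lambda>c. hpart (d - ds ! c) (v c))"

lemma fvec_zero [simp]: "0 \<in> fvec n a"
  by (simp add: fvec_def)

lemma fvec_add: "v \<in> fvec n a \<Longrightarrow> w \<in> fvec n a \<Longrightarrow> v + w \<in> fvec n a"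
  by (auto simp: fvec_def)

lemma fvec_uminus: "v \<in> fvec n a \<Longrightarrow> - v \<in> fvec n a"
  by (auto simp: fvec_def fun_Compl_def)

lemma fvec_diff: "v \<in> fvec n a \<Longrightarrow> w \<in> fvec n a \<Longrightarrow> v - w \<in> fvec n a"
  by (auto simp: fvec_def)

lemma fvec_scale: "s \<in> polys n \<Longrightarrow> v \<in> fvec n a \<Longrightarrow> scale s v \<in> fvec n a"
  by (auto simp: fvec_def scale_def)

lemma fvec_sum: "(\<And>i. i \<in> A \<Longrightarrow> f i \<in> fvec n a) \<Longrightarrow> (\<Sum>i\<in>A. f i) \<in> fvec n a"
  by (induction A rule: infinite_finite_induct) (auto intro: fvec_add)

lemma fvec_unit_vec: "k < a \<Longrightarrow> unit_vec k \<in> fvec n a"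
  by (auto simp: fvec_def unit_vec_def)

lemma fvec_polys: "v \<in> fvec n a \<Longrightarrow> v c \<in> polys n"
  by (simp add: fvec_def)

lemma sum_fun_apply: "(\<Sum>i\<in>A. f i) c = (\<Sum>i\<in>A. f i c)"
  by (induction A rule: infinite_finite_induct) auto

lemma scale_zero [simp]: "scale 0 v = 0" "scale s 0 = 0"
  by (auto simp: scale_def fun_eq_iff)

lemma scale_add: "scale s (v + w) = scale s v + scale s w"
  by (auto simp: scale_def fun_eq_iff algebra_simps)

lemma scale_uminus: "scale (- 1) v = - v"
  by (auto simp: scale_def fun_eq_iff)

lemma fvec_expand: "v \<in> fvec n a \<Longrightarrow> v = (\<Sum>k<a. scale (v k) (unit_vec k))"
  by (rule ext) (auto simp: sum_fun_apply scale_def unit_vec_def fvec_def if_distrib cong: if_cong)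

lemma linD: "lin n a b f \<Longrightarrow> v \<in> fvec n a \<Longrightarrow> f v \<in> fvec n b"
  by (simp add: lin_def)

lemma lin_add: "lin n a b f \<Longrightarrow> v \<in> fvec n a \<Longrightarrow> w \<in> fvec n a \<Longrightarrow> f (v + w) = f v + f w"
  by (simp add: lin_def)

lemma lin_scale: "lin n a b f \<Longrightarrow> s \<in> polys n \<Longrightarrow> v \<in> fvec n a \<Longrightarrow> f (scale s v) = scale s (f v)"
  by (simp add: lin_def)

lemma lin_zero: "lin n a b f \<Longrightarrow> f 0 = 0"
  using lin_scale[of n a b f 0 0] by simp

lemma lin_uminus: "lin n a b f \<Longrightarrow> v \<in> fvec n a \<Longrightarrow> f (- v) = - f v"
  using lin_scale[of n a b f "- 1" v] polys_uminus[of 1 n] by (simp add: scale_uminus)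

lemma lin_diff: "lin n a b f \<Longrightarrow> v \<in> fvec n a \<Longrightarrow> w \<in> fvec n a \<Longrightarrow> f (v - w) = f v - f w"
  using lin_add[of n a b f v "- w"] lin_uminus[of n a b f w] fvec_uminus[of w n a] by simp

lemma lin_sum:
  "lin n a b f \<Longrightarrow> (\<And>i. i \<in> A \<Longrightarrow> g i \<in> fvec n a) \<Longrightarrow> f (\<Sum>i\<in>A. g i) = (\<Sum>i\<in>A. f (g i))"
  by (induction A rule: infinite_finite_induct) (auto simp: lin_zero lin_add fvec_sum)

lemma lin_expand:
  assumes "lin n a b f" "v \<in> fvec n a"
  shows "f v = (\<Sum>k<a. scale (v k) (f (unit_vec k)))"
proof -
  have "f v = f (\<Sum>k<a. scale (v k) (unit_vec k))"
    using fvec_expand[OF assms(2)] by simp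
  also have "\<dots> = (\<Sum>k<a. scale (v k) (f (unit_vec k)))"
    using assms by (subst lin_sum[OF assms(1)])
      (auto intro!: sum.cong simp: lin_scale fvec_scale fvec_unit_vec fvec_polys)
  finally show ?thesis .
qed

lemma lin_comp: "lin n a b f \<Longrightarrow> lin n b c g \<Longrightarrow> lin n a c (\<lambda>v. g (f v))"
  by (simp add: lin_def)

lemma lin_lincomb:
  fixes x :: "nat \<Rightarrow> nat \<Rightarrow> 'k::field mpoly"
  assumes "\<And>k. k < a \<Longrightarrow> x k \<in> fvec n b"
  shows "lin n a b (\<lambda>v. \<Sum>k<a. scale (v k) (x k))"
  unfolding lin_def
proof (intro conjI ballI)
  fix v :: "nat \<Rightarrow> 'k mpoly" assume "v \<in> fvec n a"
  then show "(\<Sum>k<a. scale (v k) (x k)) \<in> fvec n b"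
    using assms by (intro fvec_sum fvec_scale) (auto simp: fvec_polys)
qed (auto simp: scale_def fun_eq_iff sum_fun_apply algebra_simps sum.distrib sum_distrib_left)

lemma ghom_lin: "ghom n ds ds' f \<Longrightarrow> lin n (length ds) (length ds') f"
  by (simp add: ghom_def)

lemma ghom_comp: "ghom n ds ds' f \<Longrightarrow> ghom n ds' ds'' g \<Longrightarrow> ghom n ds ds'' (\<lambda>v. g (f v))"
  unfolding ghom_def using lin_comp by blast

lemma vcomp_fvec: "v \<in> vcomp n ds j \<Longrightarrow> v \<in> fvec n (length ds)"
  by (simp add: vcomp_def)

lemma vcomp_add: "v \<in> vcomp n ds j \<Longrightarrow> w \<in> vcomp n ds j \<Longrightarrow> v + w \<in> vcomp n ds j"
  by (auto simp: vcomp_def fvec_add homog_add)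

lemma vcomp_zero: "0 \<in> vcomp n ds j"
  by (auto simp: vcomp_def)

lemma vcomp_uminus: "v \<in> vcomp n ds j \<Longrightarrow> - v \<in> vcomp n ds j"
  using fvec_uminus[of v n "length ds"] by (auto simp: vcomp_def fun_Compl_def homog_uminus)

lemma vcomp_sum: "(\<And>i. i \<in> A \<Longrightarrow> f i \<in> vcomp n ds j) \<Longrightarrow> (\<Sum>i\<in>A. f i) \<in> vcomp n ds j"
  by (induction A rule: infinite_finite_induct) (auto intro: vcomp_add vcomp_zero)

lemma vcomp_scale:
  "s \<in> homog n i \<Longrightarrow> v \<in> vcomp n ds j \<Longrightarrow> scale s v \<in> vcomp n ds (i + j)"
  by (auto simp: vcomp_def fvec_scale homog_polys) (auto simp: scale_def add_diff_eq[symmetric] homog_mult)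

lemma vcomp_unit_vec: "k < length ds \<Longrightarrow> unit_vec k \<in> vcomp n ds (ds ! k)"
  by (auto simp: vcomp_def fvec_unit_vec) (auto simp: unit_vec_def homog_one)

lemma vcomp_homog: "v \<in> vcomp n ds j \<Longrightarrow> v c \<in> homog n (j - ds ! c)"
  by (cases "c < length ds") (auto simp: vcomp_def fvec_def)

lemma ghom_unit_vec: "ghom n ds ds' f \<Longrightarrow> k < length ds \<Longrightarrow> f (unit_vec k) \<in> vcomp n ds' (ds ! k)"
  using vcomp_unit_vec unfolding ghom_def by blast

text \<open>A graded map out of a free module is determined by homogeneous images of the basis
  vectors; the lifts below are built this way.\<close>

lemma ghom_lincomb:
  fixes x :: "nat \<Rightarrow> nat \<Rightarrow> 'k::field mpoly"
  assumes "\<And>k. k < length ds \<Longrightarrow> x k \<in> vcomp n ds' (ds ! k)"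
  shows "ghom n ds ds' (\<lambda>v. \<Sum>k<length ds. scale (v k) (x k))"
  unfolding ghom_def
proof (intro conjI allI ballI)
  show "lin n (length ds) (length ds') (\<lambda>v. \<Sum>k<length ds. scale (v k) (x k))"
    by (rule lin_lincomb) (use assms vcomp_fvec in blast)
  fix j and v :: "nat \<Rightarrow> 'k mpoly" assume v: "v \<in> vcomp n ds j"
  have "scale (v k) (x k) \<in> vcomp n ds' j" if "k < length ds" for k
    using vcomp_scale[OF vcomp_homog[OF v, of k] assms[OF that]] by simp
  then show "(\<Sum>k<length ds. scale (v k) (x k)) \<in> vcomp n ds' j"
    by (intro vcomp_sum) auto
qed

lemma hvec_vcomp: "v \<in> fvec n (length ds) \<Longrightarrow> hvec ds d v \<in> vcomp n ds d"
  using hpart_homog homog_polys by (fastforce simp: vcomp_def fvec_def hvec_def)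

lemma hvec_id: "v \<in> vcomp n ds d \<Longrightarrow> hvec ds d v = v"
  using vcomp_homog hpart_id by (fastforce simp: hvec_def)

lemma hvec_diff: "hvec ds d (v - w) = hvec ds d v - hvec ds d w"
  by (auto simp: hvec_def hpart_diff)

text \<open>The matrix entry \<open>f (unit_vec k) c\<close> is homogeneous of degree
  \<open>ds ! k - ds' ! c\<close>, so multiplication by it moves components by exactly the
  difference of the basis degrees.\<close>

lemma ghom_hvec:
  assumes f: "ghom n ds ds' f" and v: "v \<in> fvec n (length ds)"
  shows "f (hvec ds d v) = hvec ds' d (f v)"
proof
  fix c
  have "hvec ds' d (f v) c = (\<Sum>k<length ds. hpart (d - ds' ! c) (v k * f (unit_vec k) c))"
    unfolding hvec_def lin_expand[OF ghom_lin[OF f] v] by (simp add: sum_fun_apply hpart_sum scale_def)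
  also have "\<dots> = (\<Sum>k<length ds. hpart (d - ds ! k) (v k) * f (unit_vec k) c)"
  proof (intro sum.cong refl)
    fix k assume "k \<in> {..<length ds}"
    then have "f (unit_vec k) c \<in> homog n (ds ! k - ds' ! c)"
      using ghom_unit_vec[OF f, of k] vcomp_homog by auto
    from hpart_mult_homog[OF fvec_polys[OF v] this, of "d - ds' ! c" k]
    show "hpart (d - ds' ! c) (v k * f (unit_vec k) c) = hpart (d - ds ! k) (v k) * f (unit_vec k) c"
      by simp
  qed
  also have "\<dots> = f (hvec ds d v) c"
    unfolding lin_expand[OF ghom_lin[OF f] vcomp_fvec[OF hvec_vcomp[OF v]]]
    by (simp add: sum_fun_apply scale_def hvec_def)
  finally show "f (hvec ds d v) c = hvec ds' d (f v) c" by simp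
qed

section \<open>Graded submodules and lifting of graded maps\<close>

definition gsub :: "nat \<Rightarrow> int list \<Rightarrow> (nat \<Rightarrow> 'k::field mpoly) set \<Rightarrow> bool" where
  "gsub n ds U \<longleftrightarrow> U \<subseteq> fvec n (length ds) \<and> 0 \<in> U \<and> (\<forall>v\<in>U. \<forall>w\<in>U. v + w \<in> U) \<and>
     (\<forall>s\<in>polys n. \<forall>v\<in>U. scale s v \<in> U) \<and> (\<forall>d. \<forall>v\<in>U. hvec ds d v \<in> U)"

lemma gsub_sum: "gsub n ds U \<Longrightarrow> (\<And>i. i \<in> A \<Longrightarrow> f i \<in> U) \<Longrightarrow> (\<Sum>i\<in>A. f i) \<in> U"
  by (induction A rule: infinite_finite_induct) (auto simp: gsub_def)

lemma gsub_zero: "gsub n ds {0}"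
  by (auto simp: gsub_def hvec_def fun_eq_iff)

text \<open>Working modulo a graded submodule \<open>U\<close> treats the augmentation, where \<open>U\<close> is the ideal, and
  the higher differentials, where \<open>U\<close> is zero, at the same time.\<close>

lemma ghom_lift:
  assumes f: "ghom n ds dt f" and g: "ghom n ds' dt g" and U: "gsub n dt U"
    and ex: "\<And>v. v \<in> fvec n (length ds) \<Longrightarrow> \<exists>w\<in>fvec n (length ds'). f v - g w \<in> U"
  shows "\<exists>h. ghom n ds ds' h \<and> (\<forall>v\<in>fvec n (length ds). f v - g (h v) \<in> U)"
proof -
  have "\<exists>w\<in>vcomp n ds' (ds ! k). f (unit_vec k) - g w \<in> U" if k: "k < length ds" for k
  proof -
    obtain w where w: "w \<in> fvec n (length ds')" "f (unit_vec k) - g w \<in> U"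
      using ex[OF fvec_unit_vec[OF k]] by blast
    \<comment> \<open>The preimage \<open>w\<close> need not be homogeneous. Its component of degree
      \<open>ds ! k\<close> serves as well, since \<open>f (unit_vec k)\<close> already has that
      degree and \<open>U\<close> is closed under components.\<close>
    have "hvec dt (ds ! k) (f (unit_vec k) - g w) = f (unit_vec k) - g (hvec ds' (ds ! k) w)"
      by (simp add: hvec_diff ghom_hvec[OF g w(1)] hvec_id[OF ghom_unit_vec[OF f k]])
    then show ?thesis using hvec_vcomp[OF w(1), of "ds ! k"] w(2) U
      by (metis gsub_def)
  qed
  then obtain x where x: "\<And>k. k < length ds \<Longrightarrow> x k \<in> vcomp n ds' (ds ! k)"
      "\<And>k. k < length ds \<Longrightarrow> f (unit_vec k) - g (x k) \<in> U"
    by metis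
  let ?h = "\<lambda>v. \<Sum>k<length ds. scale (v k) (x k)"
  have h: "ghom n ds ds' ?h" using x(1) by (rule ghom_lincomb)
  moreover have "f v - g (?h v) \<in> U" if v: "v \<in> fvec n (length ds)" for v
  proof -
    have "g (?h v) = (\<Sum>k<length ds. scale (v k) (g (x k)))"
      using vcomp_fvec[OF x(1)] fvec_polys[OF v]
      by (subst lin_sum[OF ghom_lin[OF g]])
        (auto intro!: fvec_scale sum.cong lin_scale[OF ghom_lin[OF g]])
    then have "f v - g (?h v) = (\<Sum>k<length ds. scale (v k) (f (unit_vec k) - g (x k)))"
      by (auto simp: lin_expand[OF ghom_lin[OF f] v] fun_eq_iff sum_fun_apply scale_def
          algebra_simps sum_subtractf)
    also have "\<dots> \<in> U"
      using x(2) U fvec_polys[OF v] by (intro gsub_sum[OF U]) (auto simp: gsub_def)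
    finally show ?thesis .
  qed
  ultimately show ?thesis by blast
qed

section \<open>Uniqueness of Betti numbers\<close>

text \<open>A resolution of \<open>S/J\<close>, with the augmentation lifted to a map \<open>\<alpha>\<close> into the free module of
  rank one; \<open>J\<close> is regarded as a set of vectors of length one.\<close>

definition lres where
  "lres n J ds \<delta> \<alpha> \<longleftrightarrow> gsub n [0] J \<and> ghom n (ds 0) [0] \<alpha> \<and> (\<forall>i. ghom n (ds (Suc i)) (ds i) (\<delta> i)) \<and>
    (\<forall>s\<in>fvec n 1. \<exists>v\<in>fvec n (length (ds 0)). s - \<alpha> v \<in> J) \<and>
    (\<forall>v\<in>fvec n (length (ds 0)). \<alpha> v \<in> J \<longleftrightarrow> v \<in> \<delta> 0 ` fvec n (length (ds 1))) \<and>
    (\<forall>i. \<forall>v\<in>fvec n (length (ds (Suc i))). \<delta> i v = 0 \<longleftrightarrow> v \<in> \<delta> (Suc i) ` fvec n (length (ds (Suc (Suc i)))))"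

definition minimal_diff where
  "minimal_diff n ds \<delta> \<longleftrightarrow> (\<forall>i. \<forall>v\<in>fvec n (length (ds (Suc i))). \<forall>c. coef (\<delta> i v c) 0 = 0)"

lemma lresD:
  assumes "lres n J ds \<delta> \<alpha>"
  shows "gsub n [0] J" "ghom n (ds 0) [0] \<alpha>" "ghom n (ds (Suc i)) (ds i) (\<delta> i)"
    "s \<in> fvec n 1 \<Longrightarrow> \<exists>v\<in>fvec n (length (ds 0)). s - \<alpha> v \<in> J"
    "v \<in> fvec n (length (ds 0)) \<Longrightarrow> \<alpha> v \<in> J \<longleftrightarrow> v \<in> \<delta> 0 ` fvec n (length (ds 1))"
    "w \<in> fvec n (length (ds (Suc i))) \<Longrightarrow>
      \<delta> i w = 0 \<longleftrightarrow> w \<in> \<delta> (Suc i) ` fvec n (length (ds (Suc (Suc i))))"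
  using assms unfolding lres_def by blast+

lemma lift_square:
  assumes "ghom n d1 d0 f" "ghom n d2 d0 g"
    and "\<And>v. v \<in> fvec n (length d1) \<Longrightarrow> f v \<in> g ` fvec n (length d2)"
  shows "\<exists>h. ghom n d1 d2 h \<and> (\<forall>v\<in>fvec n (length d1). g (h v) = f v)"
proof -
  have "\<exists>h. ghom n d1 d2 h \<and> (\<forall>v\<in>fvec n (length d1). f v - g (h v) \<in> {0})"
    using assms by (intro ghom_lift gsub_zero) fastforce+
  then show ?thesis by auto
qed

lemma gsub_diff_swap: "gsub n ds U \<Longrightarrow> v - w \<in> U \<Longrightarrow> w - v \<in> U"
  using polys_uminus[of 1 n] by (metis gsub_def minus_diff_eq polys_one scale_uminus)

lemma gsub_trans: "gsub n ds U \<Longrightarrow> v - w \<in> U \<Longrightarrow> w - x \<in> U \<Longrightarrow> v - x \<in> U"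
proof -
  assume "gsub n ds U" "v - w \<in> U" "w - x \<in> U"
  then have "(v - w) + (w - x) \<in> U" unfolding gsub_def by blast
  then show ?thesis by simp
qed

text \<open>Lifting proceeds step by step from a complex to an exact sequence. The start
  \<open>f0\<close> is prescribed because the mapping cone needs its lift to begin with
  multiplication by a given monomial.\<close>

lemma extend_chain_map:
  assumes \<delta>: "\<And>i. ghom n (ds (Suc i)) (ds i) (\<delta> i)" and \<delta>': "\<And>i. ghom n (ds' (Suc i)) (ds' i) (\<delta>' i)"
    and cplx: "\<And>i v. v \<in> fvec n (length (ds (Suc (Suc i)))) \<Longrightarrow> \<delta> i (\<delta> (Suc i) v) = 0"
    and exact: "\<And>i w. w \<in> fvec n (length (ds' (Suc i))) \<Longrightarrow> \<delta>' i w = 0 \<Longrightarrow>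
      w \<in> \<delta>' (Suc i) ` fvec n (length (ds' (Suc (Suc i))))"
    and f0: "ghom n (ds 0) (ds' 0) f0"
      "\<And>v. v \<in> fvec n (length (ds 1)) \<Longrightarrow> f0 (\<delta> 0 v) \<in> \<delta>' 0 ` fvec n (length (ds' 1))"
  shows "\<exists>\<phi>. \<phi> 0 = f0 \<and> (\<forall>i. ghom n (ds i) (ds' i) (\<phi> i)) \<and>
    (\<forall>i. \<forall>v\<in>fvec n (length (ds (Suc i))). \<delta>' i (\<phi> (Suc i) v) = \<phi> i (\<delta> i v))"
proof -
  let ?V = "\<lambda>i. fvec n (length (ds i))" and ?V' = "\<lambda>i. fvec n (length (ds' i))"
  \<comment> \<open>Besides gradedness, the invariant records that \<open>f\<close> after the
    differential lands in the image of \<open>\<delta>' i\<close>, which is what the next lift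
    requires. The last clause pins the start.\<close>
  define P where "P i f \<longleftrightarrow> ghom n (ds i) (ds' i) f \<and> (\<forall>v\<in>?V (Suc i). f (\<delta> i v) \<in> \<delta>' i ` ?V' (Suc i)) \<and>
     (i = 0 \<longrightarrow> f = f0)" for i f
  define Q where "Q i f g \<longleftrightarrow> (\<forall>v\<in>?V (Suc i). \<delta>' i (g v) = f (\<delta> i v))"
    for i f and g :: "(nat \<Rightarrow> 'a mpoly) \<Rightarrow> nat \<Rightarrow> 'a mpoly"
  have \<delta>V: "\<delta> i v \<in> ?V i" if "v \<in> ?V (Suc i)" for i v
    using linD[OF ghom_lin[OF \<delta>] that] .
  have "\<exists>\<phi>. \<forall>i. P i (\<phi> i) \<and> Q i (\<phi> i) (\<phi> (Suc i))"
  proof (rule dependent_nat_choice)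
    show "\<exists>f. P 0 f" using f0 by (auto simp: P_def)
  next
    fix f i assume f: "P i f"
    have "ghom n (ds (Suc i)) (ds' i) (\<lambda>v. f (\<delta> i v))"
      using ghom_comp[OF \<delta>] f unfolding P_def by blast
    from lift_square[OF this \<delta>']
    obtain g where g: "ghom n (ds (Suc i)) (ds' (Suc i)) g" "\<forall>v\<in>?V (Suc i). \<delta>' i (g v) = f (\<delta> i v)"
      using f by (auto simp: P_def)
    have "g (\<delta> (Suc i) v) \<in> \<delta>' (Suc i) ` ?V' (Suc (Suc i))" if v: "v \<in> ?V (Suc (Suc i))" for v
    proof -
      have d: "\<delta> (Suc i) v \<in> ?V (Suc i)" using \<delta>V v by simp
      have "f 0 = 0" using f lin_zero[OF ghom_lin] by (auto simp: P_def)
      then have "\<delta>' i (g (\<delta> (Suc i) v)) = 0" using g(2) d cplx[OF v] by simp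
      then show ?thesis using exact linD[OF ghom_lin[OF g(1)] d] by blast
    qed
    then show "\<exists>g. P (Suc i) g \<and> Q i f g" using g by (auto simp: P_def Q_def)
  qed
  then obtain \<phi> where "\<And>i. P i (\<phi> i)" "\<And>i. Q i (\<phi> i) (\<phi> (Suc i))" by blast
  then show ?thesis unfolding P_def Q_def by (intro exI[of _ \<phi>]) simp
qed

lemma lres_complex:
  assumes R: "lres n J ds \<delta> \<alpha>" and v: "v \<in> fvec n (length (ds (Suc (Suc i))))"
  shows "\<delta> i (\<delta> (Suc i) v) = 0"
  using lresD(6)[OF R linD[OF ghom_lin[OF lresD(3)[OF R]] v]] v by blast

text \<open>Lifts the identity of S/J. Both augmentations take values in S itself, so the lift is
  compatible with them only modulo \<open>J\<close>.\<close>

lemma comparison_map: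
  assumes R: "lres n J ds \<delta> \<alpha>" and R': "lres n J ds' \<delta>' \<alpha>'"
  shows "\<exists>\<phi>. (\<forall>i. ghom n (ds i) (ds' i) (\<phi> i)) \<and>
    (\<forall>v\<in>fvec n (length (ds 0)). \<alpha> v - \<alpha>' (\<phi> 0 v) \<in> J) \<and>
    (\<forall>i. \<forall>v\<in>fvec n (length (ds (Suc i))). \<delta>' i (\<phi> (Suc i) v) = \<phi> i (\<delta> i v))"
proof -
  let ?V = "\<lambda>i. fvec n (length (ds i))" and ?V' = "\<lambda>i. fvec n (length (ds' i))"
  note U = lresD(1)[OF R]
  have "\<exists>w\<in>?V' 0. \<alpha> v - \<alpha>' w \<in> J" if "v \<in> ?V 0" for v
    using linD[OF ghom_lin[OF lresD(2)[OF R]] that] by (intro lresD(4)[OF R']) simp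
  from ghom_lift[OF lresD(2)[OF R] lresD(2)[OF R'] U this]
  obtain f where f: "ghom n (ds 0) (ds' 0) f" "\<forall>v\<in>?V 0. \<alpha> v - \<alpha>' (f v) \<in> J" by blast
  have "f (\<delta> 0 v) \<in> \<delta>' 0 ` ?V' 1" if v: "v \<in> ?V 1" for v
  proof -
    have d: "\<delta> 0 v \<in> ?V 0" using linD[OF ghom_lin[OF lresD(3)[OF R, of 0]]] v by simp
    then have "\<alpha> (\<delta> 0 v) \<in> J" using lresD(5)[OF R] v by blast
    then have "\<alpha> (\<delta> 0 v) - 0 \<in> J" by simp
    from gsub_trans[OF U gsub_diff_swap[OF U f(2)[rule_format, OF d]] this]
    have "\<alpha>' (f (\<delta> 0 v)) \<in> J" by simp
    then show ?thesis using lresD(5)[OF R'] linD[OF ghom_lin[OF f(1)] d] by blast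
  qed
  from extend_chain_map[OF lresD(3)[OF R] lresD(3)[OF R'] lres_complex[OF R] _ f(1) this]
  show ?thesis using lresD(6)[OF R'] f(2) by blast
qed

lemma lin_coef_zero:
  assumes "lin n a b f" "v \<in> fvec n a" "\<And>c. coef (v c) 0 = 0"
  shows "coef (f v c) 0 = 0"
  unfolding lin_expand[OF assms(1,2)]
  by (simp add: sum_fun_apply scale_def lookup_sum coef_mult_zero assms(3))

lemma ghom_sub: "ghom n ds ds' f \<Longrightarrow> ghom n ds ds' g \<Longrightarrow> ghom n ds ds' (\<lambda>v. f v - g v)"
  using vcomp_add[of "f _" n ds' _ "- g _"] vcomp_uminus[of "g _" n ds']
  by (auto simp: ghom_def lin_def fvec_diff) (auto simp: scale_def fun_eq_iff algebra_simps)

text \<open>A chain endomorphism lifting zero is null-homotopic, \<open>f = \<delta> h + h \<delta>\<close>, and both summands have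
  entries in the maximal ideal.\<close>

lemma null_chain_map_minimal:
  assumes R: "lres n J ds \<delta> \<alpha>" and M: "minimal_diff n ds \<delta>"
    and f: "\<And>i. ghom n (ds i) (ds i) (f i)"
    and f0: "\<And>v. v \<in> fvec n (length (ds 0)) \<Longrightarrow> \<alpha> (f 0 v) \<in> J"
    and fS: "\<And>i v. v \<in> fvec n (length (ds (Suc i))) \<Longrightarrow> \<delta> i (f (Suc i) v) = f i (\<delta> i v)"
    and v: "v \<in> fvec n (length (ds i))"
  shows "coef (f i v c) 0 = 0"
proof -
  let ?V = "\<lambda>i. fvec n (length (ds i))"
  have \<delta>V: "\<delta> i v \<in> ?V i" if "v \<in> ?V (Suc i)" for i v
    using linD[OF ghom_lin[OF lresD(3)[OF R]] that] .
  have fV: "f i v \<in> ?V i" if "v \<in> ?V i" for i v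
    using linD[OF ghom_lin[OF f] that] .
  have \<delta>m: "coef (\<delta> i v c) 0 = 0" if "v \<in> ?V (Suc i)" for i v c
    using M that unfolding minimal_diff_def by blast
  \<comment> \<open>\<open>h\<close> is the homotopy in step \<open>i\<close>. The last clause says
    that f (Suc i) - h \<delta> takes values in cycles, so exactness provides the next homotopy; the
    middle clause is the claim itself.\<close>
  have "\<exists>h. ghom n (ds i) (ds (Suc i)) h \<and>
    (\<forall>v\<in>?V i. \<forall>c. coef (f i v c) 0 = 0) \<and>
    (\<forall>v\<in>?V (Suc i). \<delta> i (f (Suc i) v - h (\<delta> i v)) = 0)" for i
  proof (induction i)
    case 0
    have "f 0 v \<in> \<delta> 0 ` ?V 1" if "v \<in> ?V 0" for v
      using lresD(5)[OF R fV[OF that]] f0[OF that] by blast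
    from lift_square[OF f lresD(3)[OF R, of 0], OF this[unfolded One_nat_def]]
    obtain h where h: "ghom n (ds 0) (ds (Suc 0)) h" "\<And>v. v \<in> ?V 0 \<Longrightarrow> \<delta> 0 (h v) = f 0 v"
      by auto
    have hV: "h v \<in> ?V (Suc 0)" if "v \<in> ?V 0" for v using linD[OF ghom_lin[OF h(1)] that] .
    have "\<delta> 0 (f (Suc 0) v - h (\<delta> 0 v)) = 0" if "v \<in> ?V (Suc 0)" for v
      using that by (subst lin_diff[OF ghom_lin[OF lresD(3)[OF R]]]) (auto simp: hV fV \<delta>V fS h(2))
    moreover have "coef (f 0 v c) 0 = 0" if "v \<in> ?V 0" for v c
      using \<delta>m[OF hV[OF that]] h(2)[OF that] by metis
    ultimately show ?case using h(1) by blast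
  next
    case (Suc i)
    then obtain h where h: "ghom n (ds i) (ds (Suc i)) h"
      "\<And>v. v \<in> ?V (Suc i) \<Longrightarrow> \<delta> i (f (Suc i) v - h (\<delta> i v)) = 0" by blast
    have hV: "h v \<in> ?V (Suc i)" if "v \<in> ?V i" for v using linD[OF ghom_lin[OF h(1)] that] .
    have "ghom n (ds (Suc i)) (ds (Suc i)) (\<lambda>v. f (Suc i) v - h (\<delta> i v))"
      using ghom_comp[OF lresD(3)[OF R] h(1)] by (intro ghom_sub f)
    moreover have "f (Suc i) v - h (\<delta> i v) \<in> \<delta> (Suc i) ` ?V (Suc (Suc i))" if "v \<in> ?V (Suc i)" for v
      using lresD(6)[OF R, of "f (Suc i) v - h (\<delta> i v)" i] h(2)[OF that]
      by (simp add: fvec_diff fV hV \<delta>V that)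
    ultimately obtain k where k: "ghom n (ds (Suc i)) (ds (Suc (Suc i))) k"
       "\<And>v. v \<in> ?V (Suc i) \<Longrightarrow> \<delta> (Suc i) (k v) = f (Suc i) v - h (\<delta> i v)"
      using lift_square[OF _ lresD(3)[OF R]] by blast
    have kV: "k v \<in> ?V (Suc (Suc i))" if "v \<in> ?V (Suc i)" for v using linD[OF ghom_lin[OF k(1)] that] .
    have "coef (f (Suc i) v c) 0 = 0" if v: "v \<in> ?V (Suc i)" for v c
    proof -
      have "f (Suc i) v = \<delta> (Suc i) (k v) + h (\<delta> i v)" using k(2)[OF v] by simp
      then show ?thesis
        using \<delta>m[OF kV[OF v], of c] lin_coef_zero[OF ghom_lin[OF h(1)] \<delta>V[OF v] \<delta>m[OF v], of c]
        by (simp add: lookup_add)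
    qed
    moreover have "\<delta> (Suc i) (f (Suc (Suc i)) v - k (\<delta> (Suc i) v)) = 0" if v: "v \<in> ?V (Suc (Suc i))" for v
    proof -
      have "\<delta> i (\<delta> (Suc i) v) = 0" using lresD(6)[OF R \<delta>V[OF v]] v by blast
      then show ?thesis
        using v by (subst lin_diff[OF ghom_lin[OF lresD(3)[OF R]]])
          (auto simp: kV fV \<delta>V fS k(2) lin_zero[OF ghom_lin[OF h(1)]])
    qed
    ultimately show ?case using k(1) by blast
  qed
  then show ?thesis using v by blast
qed

section \<open>Linear algebra over the field\<close>

lemma homogeneous_system_solution:
  fixes A :: "'i \<Rightarrow> 'j \<Rightarrow> 'k::field"
  assumes "finite I" "finite J" "card I < card J"
  shows "\<exists>x. (\<exists>j\<in>J. x j \<noteq> 0) \<and> (\<forall>i\<in>I. (\<Sum>j\<in>J. A i j * x j) = 0)"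
  using assms
proof (induction I arbitrary: J A rule: finite_induct)
  case empty
  then obtain j where "j \<in> J" by fastforce
  then show ?case by (intro exI[of _ "\<lambda>_. 1"]) auto
next
  case (insert a I)
  show ?case
  proof (cases "\<forall>j\<in>J. A a j = 0")
    case True
    have "card I < card J" using insert by simp
    from insert.IH[OF insert.prems(1) this, of A] obtain x where
      "\<exists>j\<in>J. x j \<noteq> 0" "\<forall>i\<in>I. (\<Sum>j\<in>J. A i j * x j) = 0" by blast
    then show ?thesis using True by (intro exI[of _ x]) auto
  next
    case False
    then obtain p where p: "p \<in> J" "A a p \<noteq> 0" by blast
    let ?J = "J - {p}"
    have "card I < card ?J" using insert p by simp
    \<comment> \<open>Gaussian elimination: equation \<open>a\<close> is solved for the unknown
      \<open>p\<close>; substitution leaves one equation and one unknown fewer.\<close>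
    from insert.IH[OF _ this, of "\<lambda>i j. A i j - A i p * A a j / A a p"] insert.prems
    obtain x where x: "\<exists>j\<in>?J. x j \<noteq> 0"
      "\<And>i. i \<in> I \<Longrightarrow> (\<Sum>j\<in>?J. (A i j - A i p * A a j / A a p) * x j) = 0" by auto
    define y where "y = x(p := - (\<Sum>j\<in>?J. A a j * x j) / A a p)"
    have split: "(\<Sum>j\<in>J. A i j * y j) = A i p * y p + (\<Sum>j\<in>?J. A i j * x j)" for i
    proof -
      have "(\<Sum>j\<in>?J. A i j * y j) = (\<Sum>j\<in>?J. A i j * x j)"
        by (rule sum.cong) (auto simp: y_def)
      then show ?thesis using p insert.prems by (simp add: sum.remove[of J p])
    qed
    have "(\<Sum>j\<in>J. A i j * y j) = 0" if "i \<in> insert a I" for i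
    proof (cases "i = a")
      case True
      then show ?thesis using split[of a] p by (simp add: y_def)
    next
      case False
      have "(\<Sum>j\<in>?J. A i j * x j) = A i p / A a p * (\<Sum>j\<in>?J. A a j * x j)"
        using x(2)[of i] that False
        by (simp add: left_diff_distrib sum_subtractf sum_distrib_left mult.assoc)
      then show ?thesis using split[of i] by (simp add: y_def)
    qed
    moreover have "\<exists>j\<in>J. y j \<noteq> 0" using x(1) by (auto simp: y_def)
    ultimately show ?thesis by blast
  qed
qed

text \<open>With fewer rows than columns, \<open>A\<close> would kill a nonzero vector, which the
  identity B A cannot.\<close>

lemma card_le_of_left_inverse:
  fixes A :: "'i \<Rightarrow> 'j \<Rightarrow> 'k::field"
  assumes "finite I" "finite J"
    and inv: "\<And>j k. j \<in> J \<Longrightarrow> k \<in> J \<Longrightarrow> (\<Sum>i\<in>I. B j i * A i k) = (if j = k then 1 else 0)"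
  shows "card J \<le> card I"
proof (rule ccontr)
  assume "\<not> card J \<le> card I"
  then obtain x where x: "\<exists>j\<in>J. x j \<noteq> 0" "\<And>i. i \<in> I \<Longrightarrow> (\<Sum>j\<in>J. A i j * x j) = 0"
    using homogeneous_system_solution[OF assms(1,2), of A] by auto
  then obtain j where j: "j \<in> J" "x j \<noteq> 0" by blast
  have "0 = (\<Sum>i\<in>I. B j i * (\<Sum>k\<in>J. A i k * x k))" using x(2) by simp
  also have "\<dots> = (\<Sum>i\<in>I. \<Sum>k\<in>J. B j i * A i k * x k)" by (simp add: sum_distrib_left mult.assoc)
  also have "\<dots> = (\<Sum>k\<in>J. (\<Sum>i\<in>I. B j i * A i k) * x k)"
    by (subst sum.swap) (simp add: sum_distrib_right)
  also have "\<dots> = (\<Sum>k\<in>J. if k = j then x k else 0)"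
    using inv[OF j(1)] by (intro sum.cong) auto
  finally show False using j assms(2) by simp
qed

lemma count_list_conv_card: "count_list xs y = card {c. c < length xs \<and> xs ! c = y}"
  by (simp add: count_list_eq_length_filter length_filter_conv_card conj_commute)
    (metis (no_types, lifting))

text \<open>The composite of the comparison maps there and back is homotopic to the identity, hence
  equal to it modulo the maximal ideal. Degree preservation makes the reduced matrices block
  diagonal, and the block of degree \<open>j\<close> has a left inverse. For two minimal resolutions
  this applies in both directions.\<close>

lemma betti_le:
  assumes R: "lres n J ds \<delta> \<alpha>" and M: "minimal_diff n ds \<delta>" and R': "lres n J ds' \<delta>' \<alpha>'"
  shows "count_list (ds i) j \<le> count_list (ds' i) j"
proof -
  let ?V = "\<lambda>i. fvec n (length (ds i))" and ?V' = "\<lambda>i. fvec n (length (ds' i))"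
  note U = lresD(1)[OF R]
  obtain \<phi> where \<phi>: "\<And>i. ghom n (ds i) (ds' i) (\<phi> i)"
    "\<And>v. v \<in> ?V 0 \<Longrightarrow> \<alpha> v - \<alpha>' (\<phi> 0 v) \<in> J"
    "\<And>i v. v \<in> ?V (Suc i) \<Longrightarrow> \<delta>' i (\<phi> (Suc i) v) = \<phi> i (\<delta> i v)"
    using comparison_map[OF R R'] by blast
  obtain \<psi> where \<psi>: "\<And>i. ghom n (ds' i) (ds i) (\<psi> i)"
    "\<And>v. v \<in> ?V' 0 \<Longrightarrow> \<alpha>' v - \<alpha> (\<psi> 0 v) \<in> J"
    "\<And>i v. v \<in> ?V' (Suc i) \<Longrightarrow> \<delta> i (\<psi> (Suc i) v) = \<psi> i (\<delta>' i v)"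
    using comparison_map[OF R' R] by blast
  have V: "\<phi> i v \<in> ?V' i" "\<psi> i (\<phi> i v) \<in> ?V i" if "v \<in> ?V i" for i v
    using linD[OF ghom_lin[OF \<phi>(1)] that] linD[OF ghom_lin[OF \<psi>(1)]] by auto
  have id: "ghom n (ds i) (ds i) (\<lambda>v. v)" for i by (auto simp: ghom_def lin_def)
  have \<delta>V: "\<delta> i v \<in> ?V i" if "v \<in> ?V (Suc i)" for i v
    using linD[OF ghom_lin[OF lresD(3)[OF R]] that] .
  have m: "coef ((v - \<psi> i (\<phi> i v)) c) 0 = 0" if "v \<in> ?V i" for v c i
  proof (rule null_chain_map_minimal[OF R M _ _ _ that, of "\<lambda>i v. v - \<psi> i (\<phi> i v)"])
    show "ghom n (ds i) (ds i) (\<lambda>v. v - \<psi> i (\<phi> i v))" for i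
      using ghom_comp[OF \<phi>(1) \<psi>(1)] by (intro ghom_sub id)
    show "\<alpha> (v - \<psi> 0 (\<phi> 0 v)) \<in> J" if "v \<in> ?V 0" for v
      using gsub_trans[OF U \<phi>(2)[OF that] \<psi>(2)[OF V(1)[OF that]]]
      by (simp add: lin_diff[OF ghom_lin[OF lresD(2)[OF R]]] that V)
    show "\<delta> i (v - \<psi> (Suc i) (\<phi> (Suc i) v)) = \<delta> i v - \<psi> i (\<phi> i (\<delta> i v))" if "v \<in> ?V (Suc i)" for i v
      by (simp add: lin_diff[OF ghom_lin[OF lresD(3)[OF R]]] that V \<phi>(3) \<psi>(3))
  qed
  define A where "A c' c = coef (\<phi> i (unit_vec c) c') 0" for c' c
  define B where "B c c' = coef (\<psi> i (unit_vec c') c) 0" for c c'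
  let ?I = "{c. c < length (ds i) \<and> ds i ! c = j}" and ?I' = "{c. c < length (ds' i) \<and> ds' i ! c = j}"
  have "card ?I \<le> card ?I'"
  proof (rule card_le_of_left_inverse[of _ _ B A])
    fix c k assume c: "c \<in> ?I" and k: "k \<in> ?I"
    have uk: "unit_vec k \<in> ?V i" using k fvec_unit_vec by auto
    have "coef (unit_vec k c :: 'a mpoly) 0 = coef (\<psi> i (\<phi> i (unit_vec k)) c) 0"
      using m[OF uk, of c] by (simp add: lookup_minus)
    also have "\<dots> = (\<Sum>c'<length (ds' i). B c c' * A c' k)"
      unfolding lin_expand[OF ghom_lin[OF \<psi>(1)] V(1)[OF uk]] A_def B_def
      by (simp add: sum_fun_apply scale_def lookup_sum coef_mult_zero mult.commute)
    also have "\<dots> = (\<Sum>c'\<in>?I'. B c c' * A c' k)"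
    \<comment> \<open>An entry between basis elements of different degrees is homogeneous of nonzero
      degree, so its constant coefficient is 0.\<close>
    proof (rule sum.mono_neutral_right)
      show "\<forall>c'\<in>{..<length (ds' i)} - ?I'. B c c' * A c' k = 0"
      proof
        fix c' assume "c' \<in> {..<length (ds' i)} - ?I'"
        then have "ds i ! k - ds' i ! c' \<noteq> 0" using k by auto
        moreover have "\<phi> i (unit_vec k) c' \<in> homog n (ds i ! k - ds' i ! c')"
          using vcomp_homog[OF ghom_unit_vec[OF \<phi>(1), of k]] k by auto
        ultimately have "A c' k = 0" unfolding A_def by (rule coef_zero_homog[rotated])
        then show "B c c' * A c' k = 0" by simp
      qed
    qed auto
    finally show "(\<Sum>c'\<in>?I'. B c c' * A c' k) = (if c = k then 1 else 0)"
      by (simp add: unit_vec_def split: if_splits)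
  qed auto
  then show ?thesis by (simp add: count_list_conv_card)
qed

section \<open>Betti numbers of monomial quotients\<close>

lemma vcomp_free: "component (free_module n ds) j = vcomp n ds j"
  by (simp add: free_module_def vcomp_def fvec_def Let_def)

lemma free_module_simps:
  "carrier (free_module n ds) = fvec n (length ds)"
  "zero (free_module n ds) = (0 :: nat \<Rightarrow> 'k::field mpoly)"
  "add (free_module n ds) = ((+) :: (nat \<Rightarrow> 'k mpoly) \<Rightarrow> _)"
  "smult (free_module n ds) = (scale :: 'k mpoly \<Rightarrow> _)"
  by (auto simp: free_module_def fvec_def Let_def fun_eq_iff scale_def)

lemma graded_hom_free:
  "f \<in> graded_hom n (free_module n ds) (free_module n ds') \<longleftrightarrow> ghom n ds ds' f"
  unfolding graded_hom_def ghom_def lin_def hom_def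
  by (auto simp: free_module_simps vcomp_free image_subset_iff Pi_iff)

definition ivec :: "nat \<Rightarrow> (nat \<Rightarrow>\<^sub>0 nat) set \<Rightarrow> (nat \<Rightarrow> 'k::field mpoly) set" where
  "ivec n U = {v \<in> fvec n 1. v 0 \<in> mon_ideal n U}"

lemma hvec_apply_zero: "hvec [0] d v 0 = hpart d (v 0)"
  by (simp add: hvec_def)

lemma gsub_ivec:
  assumes "upward U" shows "gsub n [0] (ivec n U)"
proof -
  have "hvec [0] d v \<in> fvec n 1" if "v \<in> fvec n 1" for d and v :: "nat \<Rightarrow> 'a mpoly"
    using vcomp_fvec[OF hvec_vcomp[of v n "[0]" d]] that by simp
  then show ?thesis
    using mon_ideal_mult[OF assms] fvec_scale[of _ n _ 1]
    by (auto simp: gsub_def ivec_def fvec_add fvec_scale mon_ideal_add scale_def hvec_apply_zero mon_ideal_hpart)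
qed

locale monomial_quotient =
  fixes n :: nat and U :: "(nat \<Rightarrow>\<^sub>0 nat) set" and K :: "'k::field itself"
  assumes U: "upward U"
begin

abbreviation Q :: "('k mpoly, 'k mpoly set) graded_module" where
  "Q \<equiv> quotient_module n (mon_ideal n U)"

definition cls :: "'k mpoly \<Rightarrow> 'k mpoly set" where
  "cls f = mon_ideal n U +>\<^bsub>poly_ring n\<^esub> f"

sublocale R: cring "poly_ring n :: 'k mpoly ring" by (rule cring_poly_ring)
sublocale I: ideal "mon_ideal n U" "poly_ring n :: 'k mpoly ring" by (rule ideal_mon_ideal[OF U])

lemma cls_eq_iff:
  assumes "f \<in> polys n" "g \<in> polys n"
  shows "cls f = cls g \<longleftrightarrow> f - g \<in> mon_ideal n U"
proof -
  have "\<ominus>\<^bsub>poly_ring n\<^esub> g = - g"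
    using R.minus_equality[of "- g" g] assms by auto
  then show ?thesis
    using R.quotient_eq_iff_same_a_r_cos[OF I.ideal_axioms assms]
    by (simp add: cls_def a_minus_def)
qed

lemma quotient_simps:
  "carrier Q = cls ` polys n" "zero Q = cls 0"
  "f \<in> polys n \<Longrightarrow> g \<in> polys n \<Longrightarrow> add Q (cls f) (cls g) = cls (f + g)"
  "f \<in> polys n \<Longrightarrow> g \<in> polys n \<Longrightarrow> smult Q f (cls g) = cls (f * g)"
  "component Q j = cls ` homog n j"
proof -
  show "carrier Q = cls ` polys n"
    by (auto simp: quotient_module_def Let_def FactRing_def A_RCOSETS_def RCOSETS_def a_r_coset_def cls_def)
  have "cls 0 = mon_ideal n U"
    by (simp add: cls_def a_r_coset_def r_coset_def)
  then show "zero Q = cls 0"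
    by (simp add: quotient_module_def Let_def FactRing_def)
  show "component Q j = cls ` homog n j"
    by (simp add: quotient_module_def Let_def cls_def[abs_def])
  assume "f \<in> polys n" "g \<in> polys n"
  then show "add Q (cls f) (cls g) = cls (f + g)" "smult Q f (cls g) = cls (f * g)"
    using I.a_rcos_sum[of f g] I.rcoset_mult_add[of f g]
    by (simp_all add: quotient_module_def Let_def FactRing_def cls_def)
qed

text \<open>An arbitrary resolution may start with any \<open>ds 0\<close> and augments into cosets.
  Homogeneous representatives for the images of the basis vectors lift the augmentation to a graded
  map into S.\<close>

lemma resolution_lift:
  assumes "graded_free_resolution n Q ds \<delta> \<epsilon>"
  shows "\<exists>\<alpha>. lres n (ivec n U) ds \<delta> \<alpha>"
proof -
  let ?V = "\<lambda>i. fvec n (length (ds i)) :: (nat \<Rightarrow> 'k mpoly) set"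
  have R: "\<epsilon> \<in> graded_hom n (free_module n (ds 0)) Q" "\<And>i. ghom n (ds (Suc i)) (ds i) (\<delta> i)"
    "\<epsilon> ` ?V 0 = cls ` polys n" "\<delta> 0 ` ?V 1 = {v \<in> ?V 0. \<epsilon> v = cls 0}"
    "\<And>i. \<delta> (Suc i) ` ?V (Suc (Suc i)) = {v \<in> ?V (Suc i). \<delta> i v = 0}"
    using assms unfolding graded_free_resolution_def Let_def
    by (simp_all add: graded_hom_free free_module_simps quotient_simps a_kernel_def')
  have \<epsilon>V: "\<epsilon> v \<in> cls ` polys n" if "v \<in> ?V 0" for v
    using R(3) that by blast
  have \<epsilon>add: "\<epsilon> (v + w) = \<epsilon> v \<oplus>\<^bsub>Q\<^esub> \<epsilon> w" if "v \<in> ?V 0" "w \<in> ?V 0" for v w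
    using R(1) that by (simp add: graded_hom_def hom_def free_module_simps)
  have \<epsilon>scale: "\<epsilon> (scale s v) = s \<odot>\<^bsub>Q\<^esub> \<epsilon> v" if "s \<in> polys n" "v \<in> ?V 0" for s v
    using R(1) that by (simp add: graded_hom_def free_module_simps)
  have \<epsilon>comp: "\<epsilon> v \<in> cls ` homog n j" if "v \<in> vcomp n (ds 0) j" for v j
    using R(1) that unfolding graded_hom_def vcomp_free quotient_simps by blast
  have "\<exists>a\<in>homog n (ds 0 ! k). \<epsilon> (unit_vec k) = cls a" if "k < length (ds 0)" for k
    using \<epsilon>comp[OF vcomp_unit_vec[OF that]] by blast
  then obtain a where a: "\<And>k. k < length (ds 0) \<Longrightarrow> a k \<in> homog n (ds 0 ! k)"
    "\<And>k. k < length (ds 0) \<Longrightarrow> \<epsilon> (unit_vec k) = cls (a k)" by metis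
  define \<alpha> where "\<alpha> = (\<lambda>v. \<Sum>k<length (ds 0). scale (v k) (scale (a k) (unit_vec 0)))"
  have g\<alpha>: "ghom n (ds 0) [0] \<alpha>" unfolding \<alpha>_def
  proof (rule ghom_lincomb)
    fix k assume "k < length (ds 0)"
    from vcomp_scale[OF a(1)[OF this] vcomp_unit_vec[of 0 "[0]"]]
    show "scale (a k) (unit_vec 0) \<in> vcomp n [0] (ds 0 ! k)" by simp
  qed
  have \<alpha>V: "\<alpha> v \<in> fvec n 1" if "v \<in> ?V 0" for v using linD[OF ghom_lin[OF g\<alpha>] that] by simp
  have \<epsilon>0: "\<epsilon> 0 = cls 0"
  proof -
    obtain f where f: "f \<in> polys n" "\<epsilon> 0 = cls f" using \<epsilon>V[OF fvec_zero] by blast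
    have "\<epsilon> 0 = 0 \<odot>\<^bsub>Q\<^esub> \<epsilon> 0" using \<epsilon>scale[of 0 0] by simp
    also have "\<dots> = cls 0" using f by (simp add: quotient_simps)
    finally show ?thesis .
  qed
  have \<epsilon>: "\<epsilon> v = cls (\<alpha> v 0)" if v: "v \<in> ?V 0" for v
  proof -
    have pk: "v k * a k \<in> polys n" if "k < length (ds 0)" for k
      using fvec_polys[OF v, of k] homog_polys[OF a(1)[OF that]] by (rule polys_mult)
    \<comment> \<open>Additivity of \<epsilon> refers to the addition of cosets in \<open>Q\<close>,
      so the sum is built up one term at a time.\<close>
    have "\<epsilon> (\<Sum>k<l. scale (v k) (unit_vec k)) = cls (\<Sum>k<l. v k * a k)" if "l \<le> length (ds 0)" for l
      using that
    proof (induction l)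
      case (Suc l)
      have "\<epsilon> (scale (v l) (unit_vec l)) = cls (v l * a l)"
        using Suc.prems fvec_polys[OF v] homog_polys[OF a(1)]
        by (subst \<epsilon>scale) (auto simp: fvec_unit_vec a(2) quotient_simps)
      moreover have "(\<Sum>k<l. scale (v k) (unit_vec k)) \<in> ?V 0" "scale (v l) (unit_vec l) \<in> ?V 0"
        using Suc.prems fvec_polys[OF v] by (auto intro!: fvec_sum fvec_scale fvec_unit_vec)
      moreover have "(\<Sum>k<l. v k * a k) \<in> polys n" using pk Suc.prems by auto
      ultimately show ?case
        using Suc pk[of l] unfolding sum.lessThan_Suc by (subst \<epsilon>add) (simp_all add: quotient_simps)
    qed (simp add: \<epsilon>0)
    from this[of "length (ds 0)"] show ?thesis
      using fvec_expand[OF v] by (simp add: \<alpha>_def sum_fun_apply scale_def unit_vec_def)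
  qed
  have "lres n (ivec n U) ds \<delta> \<alpha>" unfolding lres_def
  proof (intro conjI allI ballI)
    fix s :: "nat \<Rightarrow> 'k mpoly" assume s: "s \<in> fvec n 1"
    then obtain v where v: "v \<in> ?V 0" "\<epsilon> v = cls (s 0)" using R(3) fvec_polys[OF s, of 0]
      by (metis (no_types, lifting) imageE image_eqI)
    then have "s 0 - \<alpha> v 0 \<in> mon_ideal n U"
      using \<epsilon>[OF v(1)] cls_eq_iff[OF fvec_polys[OF s] fvec_polys[OF \<alpha>V[OF v(1)]], of 0 0] by simp
    then show "\<exists>v\<in>?V 0. s - \<alpha> v \<in> ivec n U"
      using v(1) s \<alpha>V by (intro bexI[of _ v]) (auto simp: ivec_def fvec_diff)
  next
    fix v assume v: "v \<in> ?V 0"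
    have "\<alpha> v \<in> ivec n U \<longleftrightarrow> \<epsilon> v = cls 0"
      using cls_eq_iff[OF fvec_polys[OF \<alpha>V[OF v]], of 0 0] \<alpha>V[OF v] by (simp add: \<epsilon>[OF v] ivec_def)
    then show "\<alpha> v \<in> ivec n U \<longleftrightarrow> v \<in> \<delta> 0 ` ?V 1" using R(4) v by blast
  next
    fix i v assume "v \<in> ?V (Suc i)"
    then show "\<delta> i v = 0 \<longleftrightarrow> v \<in> \<delta> (Suc i) ` ?V (Suc (Suc i))" using R(5)[of i] by blast
  qed (simp_all add: gsub_ivec[OF U] R(2) g\<alpha>)
  then show ?thesis by blast
qed

lemma resolution_of_lres:
  assumes R: "lres n (ivec n U) ds \<delta> (\<lambda>v. v)" and ds0: "ds 0 = [0]"
  shows "graded_free_resolution n Q ds \<delta> (\<lambda>v. cls (v 0))"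
proof -
  have "(\<lambda>v. cls (v 0)) \<in> graded_hom n (free_module n (ds 0)) Q"
    unfolding graded_hom_def hom_def
    using fvec_polys[of _ n] vcomp_homog[of _ n "[0]" _ 0, simplified]
    by (auto simp: free_module_simps vcomp_free quotient_simps scale_def ds0 intro!: imageI)
  moreover have "(\<lambda>v. cls (v 0)) ` fvec n 1 = cls ` polys n"
  proof
    show "cls ` polys n \<subseteq> (\<lambda>v. cls (v 0)) ` fvec n 1"
    proof
      fix X assume "X \<in> cls ` polys n"
      then obtain f where f: "f \<in> polys n" "X = cls f" by blast
      have "scale f (unit_vec 0) \<in> fvec n 1" using f by (auto intro: fvec_scale fvec_unit_vec)
      moreover have "scale f (unit_vec 0) 0 = f" by (simp add: scale_def unit_vec_def)
      ultimately show "X \<in> (\<lambda>v. cls (v 0)) ` fvec n 1" using f by (metis (mono_tags, lifting) imageI)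
    qed
  qed (auto simp: fvec_polys)
  moreover have "\<delta> 0 ` fvec n (length (ds 1)) = {v \<in> fvec n 1. cls (v 0) = cls 0}"
  proof -
    have "v \<in> fvec n 1" if "v \<in> \<delta> 0 ` fvec n (length (ds 1))" for v
      using that linD[OF ghom_lin[OF lresD(3)[OF R, of 0]]] ds0 by auto
    moreover have "v \<in> \<delta> 0 ` fvec n (length (ds 1)) \<longleftrightarrow> cls (v 0) = cls 0" if v: "v \<in> fvec n 1" for v
      using lresD(5)[OF R, of v] v ds0 cls_eq_iff[OF fvec_polys[OF v], of 0 0]
      by (simp add: ivec_def)
    ultimately show ?thesis by blast
  qed
  moreover have "\<delta> (Suc i) ` fvec n (length (ds (Suc (Suc i)))) =
    {v \<in> fvec n (length (ds (Suc i))). \<delta> i v = 0}" for i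
    using lresD(6)[OF R] linD[OF ghom_lin[OF lresD(3)[OF R, of "Suc i"]]] by blast
  ultimately show ?thesis
    unfolding graded_free_resolution_def Let_def
    by (simp add: graded_hom_free free_module_simps quotient_simps a_kernel_def' lresD(3)[OF R] ds0)
qed

lemma minimal_diff_iff:
  assumes "\<And>i. ghom n (ds (Suc i)) (ds i) (\<delta> i)"
  shows "minimal_diff n ds \<delta> \<longleftrightarrow>
    (\<forall>i. \<forall>v\<in>carrier (free_module n (ds (Suc i))). \<forall>c. \<delta> i v c \<in> (max_ideal n :: 'k mpoly set))"
  using fvec_polys[OF linD[OF ghom_lin[OF assms]]]
  by (auto simp: minimal_diff_def free_module_simps max_ideal_iff)

end

text \<open>Normalized minimal resolution: the first module is S and the augmentation is the
  quotient map, whose lift to S is the identity.\<close>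

definition mres where
  "mres n U ds \<delta> \<longleftrightarrow> lres n (ivec n U) ds \<delta> (\<lambda>v. v) \<and> ds 0 = [0] \<and> minimal_diff n ds \<delta>"

text \<open>Discharges the definite description in \<open>betti\<close>: \<open>mres\<close>
  supplies a witness, and \<open>betti_le\<close> in both directions shows that any other witness
  gives the same count.\<close>

lemma betti_eq_count_list:
  fixes \<delta> :: "nat \<Rightarrow> (nat \<Rightarrow> 'k::field mpoly) \<Rightarrow> nat \<Rightarrow> 'k mpoly"
  assumes U: "upward U" and R: "mres n U ds \<delta>"
  shows "betti n (quotient_module n (mon_ideal n U :: 'k mpoly set)) i j = count_list (ds i) j"
  unfolding betti_def
proof (rule the_equality)
  interpret monomial_quotient n U "TYPE('k)" by unfold_locales (rule U)
  have R: "lres n (ivec n U) ds \<delta> (\<lambda>v. v)" "ds 0 = [0]" "minimal_diff n ds \<delta>"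
    using R by (auto simp: mres_def)
  have "minimal_graded_free_resolution n Q ds \<delta> (\<lambda>v. cls (v 0))"
    unfolding minimal_graded_free_resolution_def
    using resolution_of_lres[OF R(1,2)] minimal_diff_iff[of ds \<delta>, OF lresD(3)[OF R(1)]] R(3) by blast
  then show "\<exists>ds' \<delta>' \<epsilon>. minimal_graded_free_resolution n Q ds' \<delta>' \<epsilon> \<and>
     count_list (ds i) j = count_list (ds' i) j" by blast
  fix b assume "\<exists>ds' \<delta>' \<epsilon>. minimal_graded_free_resolution n Q ds' \<delta>' \<epsilon> \<and> b = count_list (ds' i) j"
  then obtain ds' \<delta>' \<epsilon> where R': "minimal_graded_free_resolution n Q ds' \<delta>' \<epsilon>" "b = count_list (ds' i) j"
    by blast
  then obtain \<alpha> where \<alpha>: "lres n (ivec n U) ds' \<delta>' \<alpha>"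
    unfolding minimal_graded_free_resolution_def using resolution_lift by blast
  have "minimal_diff n ds' \<delta>'"
    using R'(1) minimal_diff_iff[of ds' \<delta>', OF lresD(3)[OF \<alpha>]]
    unfolding minimal_graded_free_resolution_def by blast
  then show "b = count_list (ds i) j"
    using betti_le[OF R(1,3) \<alpha>, of i j] betti_le[OF \<alpha> _ R(1), of i j] R'(2) by linarith
qed

section \<open>Mapping cones\<close>

abbreviation mon :: "(nat \<Rightarrow>\<^sub>0 nat) \<Rightarrow> 'k::field mpoly" where "mon m \<equiv> Poly_Mapping.single m 1"

lemma mult_mon_eq_sum: "mon m * f = (\<Sum>k\<in>supp f. Poly_Mapping.single (m + k) (coef f k))"
proof -
  have "mon m * f = mon m * (\<Sum>k\<in>supp f. Poly_Mapping.single k (coef f k))"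
    using poly_eq_sum_single[of f] by simp
  then show ?thesis by (simp add: sum_distrib_left mult_single)
qed

lemma coef_mult_mon: "coef (mon m * f) (m + k) = coef f k"
proof -
  have "coef (mon m * f) (m + k) = (\<Sum>l\<in>supp f. if l = k then coef f l else 0)"
    by (auto simp: mult_mon_eq_sum lookup_sum lookup_single when_def intro!: sum.cong)
  then show ?thesis by (auto simp: in_keys_iff)
qed

lemma supp_mult_mon: "supp (mon m * f :: 'k::field mpoly) = (+) m ` supp f"
proof
  show "supp (mon m * f) \<subseteq> (+) m ` supp f"
    using keys_mult[of "mon m" f] by auto
  show "(+) m ` supp f \<subseteq> supp (mon m * f)"
    by (auto simp: in_keys_iff coef_mult_mon)
qed

lemma divisible_mon_imp_mult:
  fixes f :: "'k::field mpoly"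
  assumes "f \<in> polys n" "\<And>k. k \<in> supp f \<Longrightarrow> \<exists>b. k = m + b"
  shows "\<exists>h\<in>polys n. f = mon m * h"
proof -
  obtain b where b: "\<And>k. k \<in> supp f \<Longrightarrow> k = m + b k" using assms(2) by metis
  let ?h = "\<Sum>k\<in>supp f. Poly_Mapping.single (b k) (coef f k)"
  have "Poly_Mapping.single (b k) (coef f k) \<in> polys n" if k: "k \<in> supp f" for k
  proof -
    have "supp (b k) \<subseteq> supp k" using b[OF k] supp_add_nat[of m "b k"] by auto
    then show ?thesis using assms(1) k by (auto simp: polys_iff)
  qed
  then have "?h \<in> polys n" by auto
  moreover have "mon m * ?h = (\<Sum>k\<in>supp f. Poly_Mapping.single k (coef f k))"
    unfolding sum_distrib_left by (rule sum.cong) (auto simp: mult_single b[symmetric])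
  ultimately show ?thesis using poly_eq_sum_single[of f] by metis
qed

text \<open>The twist F(-e) of a graded free module.\<close>

definition shift :: "int \<Rightarrow> int list \<Rightarrow> int list" where
  "shift e ds = map (\<lambda>d. d + e) ds"

lemma length_shift [simp]: "length (shift e ds) = length ds"
  by (simp add: shift_def)

lemma vcomp_shift: "vcomp n (shift e ds) j = vcomp n ds (j - e)"
  by (auto simp: vcomp_def shift_def algebra_simps)

lemma ghom_shift: "ghom n ds ds' f \<Longrightarrow> ghom n (shift e ds) (shift e ds') f"
  by (simp add: ghom_def vcomp_shift)

lemma ghom_scale:
  assumes f: "ghom n ds ds' f" and s: "s \<in> homog n e"
  shows "ghom n (shift e ds) ds' (\<lambda>v. scale s (f v))"
proof -
  have "scale s (f v) \<in> vcomp n ds' j" if "v \<in> vcomp n (shift e ds) j" for v j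
    using vcomp_scale[OF s, of "f v" ds' "j - e"] f that by (simp add: ghom_def vcomp_shift)
  moreover have "lin n (length ds) (length ds') (\<lambda>v. scale s (f v))"
    using f fvec_scale[OF homog_polys[OF s]]
    by (auto simp: ghom_def lin_def scale_add) (auto simp: scale_def fun_eq_iff algebra_simps)
  ultimately show ?thesis by (simp add: ghom_def)
qed

lemma ghom_add: "ghom n ds ds' f \<Longrightarrow> ghom n ds ds' g \<Longrightarrow> ghom n ds ds' (\<lambda>v. f v + g v)"
  unfolding ghom_def lin_def
  by (auto simp: fvec_add vcomp_add scale_add algebra_simps)

lemma ghom_id: "ghom n ds ds (\<lambda>v. v)"
  by (auto simp: ghom_def lin_def)

lemma ghom_uminus: "ghom n ds ds' f \<Longrightarrow> ghom n ds ds' (\<lambda>v. - f v)"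
  unfolding ghom_def lin_def
  by (auto simp: fvec_uminus vcomp_uminus) (auto simp: scale_def fun_eq_iff)

lemma scale_uminus_right: "scale s (- v) = - scale s v"
  by (simp add: scale_def fun_eq_iff)

section \<open>Direct sums of free modules as block vectors\<close>

definition left :: "nat \<Rightarrow> (nat \<Rightarrow> 'a::zero) \<Rightarrow> nat \<Rightarrow> 'a" where
  "left a v = (\<lambda>c. if c < a then v c else 0)"

definition right :: "nat \<Rightarrow> (nat \<Rightarrow> 'a) \<Rightarrow> nat \<Rightarrow> 'a" where
  "right a v = (\<lambda>c. v (c + a))"

definition inright :: "nat \<Rightarrow> (nat \<Rightarrow> 'a::zero) \<Rightarrow> nat \<Rightarrow> 'a" where
  "inright a v = (\<lambda>c. if c < a then 0 else v (c - a))"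

lemma ghom_left: "ghom n (d1 @ d2) d1 (left (length d1))"
  by (auto simp: ghom_def lin_def fvec_def vcomp_def left_def scale_def fun_eq_iff nth_append)

lemma ghom_right: "ghom n (d1 @ d2) d2 (right (length d1))"
proof -
  have "v (c + length d1) \<in> homog n (j - d2 ! c)"
    if "\<forall>c<length d1 + length d2. v c \<in> homog n (j - (d1 @ d2) ! c)" "c < length d2"
    for v :: "nat \<Rightarrow> 'a mpoly" and j c
    using that(1)[rule_format, of "c + length d1"] that(2) by (simp add: nth_append)
  then show ?thesis
    by (auto simp: ghom_def lin_def fvec_def vcomp_def right_def scale_def fun_eq_iff)
qed

text \<open>Vectors vanish beyond their rank, so the inclusion of the first summand is the identity
  function.\<close>

lemma ghom_inleft: "ghom n d1 (d1 @ d2) (\<lambda>v. v)"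
  using vcomp_homog[of _ n d1]
  by (auto simp: ghom_def lin_def fvec_def vcomp_def nth_append)

lemma ghom_inright: "ghom n d2 (d1 @ d2) (inright (length d1))"
  by (auto simp: ghom_def lin_def fvec_def vcomp_def inright_def scale_def fun_eq_iff nth_append)

lemma left_right_join:
  assumes "x \<in> fvec n a" shows "left a (x + inright a y) = x" "right a (x + inright a y) = y"
  using assms by (auto simp: left_def right_def inright_def fvec_def fun_eq_iff)

lemma join_left_right: fixes v :: "nat \<Rightarrow> 'k::field mpoly" shows "left a v + inright a (right a v) = v"
  by (auto simp: left_def right_def inright_def fun_eq_iff)

lemma join_eq_zero_iff:
  assumes "x \<in> fvec n a" shows "x + inright a y = 0 \<longleftrightarrow> x = 0 \<and> y = 0"
proof
  assume "x + inright a y = 0"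
  then have "x = left a 0" "y = right a 0" using left_right_join[OF assms, of y] by auto
  then show "x = 0 \<and> y = 0" by (simp add: left_def right_def fun_eq_iff)
qed (auto simp: inright_def fun_eq_iff)

fun cone_degs :: "int \<Rightarrow> (nat \<Rightarrow> int list) \<Rightarrow> (nat \<Rightarrow> int list) \<Rightarrow> nat \<Rightarrow> int list" where
  "cone_degs e ds ds' 0 = [0]"
| "cone_degs e ds ds' (Suc i) = ds (Suc i) @ shift e (ds' i)"

text \<open>\<open>a i\<close> is the rank of \<open>ds (Suc i)\<close>, the offset of the second
  block in cone module \<open>i + 1\<close>. The sign on \<delta>' makes consecutive differentials
  compose to zero. The first differential has no lower block because the second complex ends at
  \<open>ds' 0\<close>, which sits in cone module 1.\<close>

fun cone_diff where
  "cone_diff x a \<delta> \<delta>' \<psi> 0 v = \<delta> 0 (left (a 0) v) + scale x (\<psi> 0 (right (a 0) v))"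
| "cone_diff x a \<delta> \<delta>' \<psi> (Suc i) v =
     (\<delta> (Suc i) (left (a (Suc i)) v) + scale x (\<psi> (Suc i) (right (a (Suc i)) v))) +
     inright (a i) (- \<delta>' i (right (a (Suc i)) v))"

text \<open>The mapping cone of \<open>x \<psi>\<close>, where \<open>\<psi>\<close> lifts multiplication by \<open>mon m\<close> from \<open>S/(J : mon m)\<close> to
  \<open>S/J\<close> and \<open>x\<close> is a variable that is regular on \<open>S/J\<close>. The factor \<open>x\<close> makes the cone minimal.\<close>

lemma mapping_cone:
  fixes \<delta> \<delta>' :: "nat \<Rightarrow> (nat \<Rightarrow> 'k::field mpoly) \<Rightarrow> nat \<Rightarrow> 'k mpoly"
  assumes U: "upward U" and U': "upward U'"
    and R: "mres n U ds \<delta>" and R': "mres n U' ds' \<delta>'"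
    and u: "u \<in> {1..n}" and m: "supp m \<subseteq> {1..n}"
    and reg: "\<And>k. Poly_Mapping.single u 1 + k \<in> U \<Longrightarrow> k \<in> U"
    and colon: "\<And>k. k \<in> U' \<longleftrightarrow> m + k \<in> U"
  shows "\<exists>\<Delta> :: nat \<Rightarrow> (nat \<Rightarrow> 'k mpoly) \<Rightarrow> nat \<Rightarrow> 'k mpoly.
    mres n (U \<union> {k. \<exists>b. k = Poly_Mapping.single u 1 + m + b})
      (cone_degs (int (mono_deg m) + 1) ds ds') \<Delta>"
proof -
  define e where "e = int (mono_deg m)"
  define x :: "'k mpoly" where "x = Var u"
  let ?W = "U \<union> {k. \<exists>b. k = Poly_Mapping.single u 1 + m + b}"
  let ?V = "\<lambda>i. fvec n (length (ds i)) :: (nat \<Rightarrow> 'k mpoly) set"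
  let ?V' = "\<lambda>i. fvec n (length (ds' i)) :: (nat \<Rightarrow> 'k mpoly) set"
  let ?C = "cone_degs (e + 1) ds ds'"
  let ?VC = "\<lambda>i. fvec n (length (?C i)) :: (nat \<Rightarrow> 'k mpoly) set"
  have L: "lres n (ivec n U) ds \<delta> (\<lambda>v. v)" and ds0: "ds 0 = [0]" and M: "minimal_diff n ds \<delta>"
    using R by (auto simp: mres_def)
  have L': "lres n (ivec n U') ds' \<delta>' (\<lambda>v. v)" and ds0': "ds' 0 = [0]" and M': "minimal_diff n ds' \<delta>'"
    using R' by (auto simp: mres_def)
  have mon_h: "mon m \<in> homog n e" using m by (simp add: homog_def polys_iff e_def)
  have x_h: "x \<in> homog n 1" unfolding x_def by (rule homog_Var[OF u])
  note mon_p = homog_polys[OF mon_h] and x_p = homog_polys[OF x_h]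
  have x_mon: "x = mon (Poly_Mapping.single u 1)" by (simp add: x_def Var_def)
  have W: "upward ?W"
    using U unfolding upward_def by (auto simp: add.assoc)

  have colon_mem: "mon m * f \<in> mon_ideal n U \<longleftrightarrow> f \<in> mon_ideal n U'"
    if "f \<in> polys n" for f :: "'k mpoly"
    using that mon_p by (auto simp: mon_ideal_def supp_mult_mon colon)
  have reg_mem: "x * f \<in> mon_ideal n U \<Longrightarrow> f \<in> mon_ideal n U" if "f \<in> polys n" for f :: "'k mpoly"
    using that reg by (auto simp: mon_ideal_def supp_mult_mon x_mon)

  \<comment> \<open>Start of the lift \<psi>: multiplication by \<open>mon m\<close> carries the
    ideal of \<open>U'\<close> into that of \<open>U\<close>, because \<open>U'\<close> is the
    colon.\<close>
  have comp0: "scale (mon m) (\<delta>' 0 v) \<in> \<delta> 0 ` ?V 1" if v: "v \<in> ?V' 1" for v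
  proof -
    have d: "\<delta>' 0 v \<in> fvec n 1" using linD[OF ghom_lin[OF lresD(3)[OF L', of 0]], of v] v ds0' by simp
    then have "\<delta>' 0 v \<in> ivec n U'" using lresD(5)[OF L', of "\<delta>' 0 v"] v ds0' by auto
    then have "scale (mon m) (\<delta>' 0 v) \<in> ivec n U"
      using d fvec_scale[OF mon_p d] colon_mem[OF fvec_polys[OF d]] by (simp add: ivec_def scale_def)
    then show ?thesis
      using lresD(5)[OF L, of "scale (mon m) (\<delta>' 0 v)"] ds0 fvec_scale[OF mon_p d] by simp
  qed
  have "\<exists>\<psi>. \<psi> 0 = scale (mon m) \<and> (\<forall>i. ghom n (shift e (ds' i)) (ds i) (\<psi> i)) \<and>
    (\<forall>i. \<forall>v\<in>fvec n (length (shift e (ds' (Suc i)))). \<delta> i (\<psi> (Suc i) v) = \<psi> i (\<delta>' i v))"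
  proof (rule extend_chain_map)
    show "ghom n (shift e (ds' 0)) (ds 0) (scale (mon m))"
      using ghom_scale[OF ghom_id mon_h, of "[0]"] by (simp add: ds0 ds0')
    show "ghom n (shift e (ds' (Suc i))) (shift e (ds' i)) (\<delta>' i)" for i
      by (rule ghom_shift[OF lresD(3)[OF L']])
    show "w \<in> \<delta> (Suc i) ` ?V (Suc (Suc i))" if "w \<in> ?V (Suc i)" "\<delta> i w = 0" for i w
      using lresD(6)[OF L that(1)] that(2) by blast
  qed (use comp0 lresD(3)[OF L] lres_complex[OF L'] in \<open>simp_all add: zero_fun_def\<close>)
  then obtain \<psi> where \<psi>0: "\<psi> 0 = scale (mon m)" and \<psi>: "\<And>i. ghom n (shift e (ds' i)) (ds i) (\<psi> i)"
    and \<psi>S: "\<And>i v. v \<in> ?V' (Suc i) \<Longrightarrow> \<delta> i (\<psi> (Suc i) v) = \<psi> i (\<delta>' i v)" by auto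

  define a where "a = (\<lambda>i. length (ds (Suc i)))"
  define \<Delta> where "\<Delta> = cone_diff x a \<delta> \<delta>' \<psi>"
  have \<delta>V: "\<delta> i v \<in> ?V i" if "v \<in> ?V (Suc i)" for i v
    using linD[OF ghom_lin[OF lresD(3)[OF L]] that] .
  have \<delta>V': "\<delta>' i v \<in> ?V' i" if "v \<in> ?V' (Suc i)" for i v
    using linD[OF ghom_lin[OF lresD(3)[OF L']] that] .
  have \<psi>V: "\<psi> i v \<in> ?V i" if "v \<in> ?V' i" for i v
    using linD[OF ghom_lin[OF \<psi>]] that by simp
  have leftV: "left (a i) v \<in> ?V (Suc i)" and rightV: "right (a i) v \<in> ?V' i" if "v \<in> ?VC (Suc i)" for i v
    using that linD[OF ghom_lin[OF ghom_left]] linD[OF ghom_lin[OF ghom_right]] by (auto simp: a_def)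
  have joinV: "v + inright (a i) w \<in> ?VC (Suc i)" if "v \<in> ?V (Suc i)" "w \<in> ?V' i" for v w i
  proof -
    have "v \<in> ?VC (Suc i)"
      using linD[OF ghom_lin[OF ghom_inleft[of n "ds (Suc i)" "shift (e + 1) (ds' i)"]] that(1)] by simp
    moreover have "inright (a i) w \<in> ?VC (Suc i)"
      using linD[OF ghom_lin[OF ghom_inright[of n "shift (e + 1) (ds' i)" "ds (Suc i)"]], of w] that(2)
      by (simp add: a_def)
    ultimately show ?thesis by (rule fvec_add)
  qed
  \<comment> \<open>The twist by \<open>e\<close> makes \<psi> preserve degrees; the factor
    \<open>x\<close> accounts for the remaining 1.\<close>
  have sh: "shift (e + 1) (ds' i) = shift 1 (shift e (ds' i))" for i
    by (simp add: shift_def comp_def algebra_simps)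
  have x\<psi>: "ghom n (ds (Suc i) @ shift (e + 1) (ds' i)) (ds i) (\<lambda>v. scale x (\<psi> i (right (a i) v)))" for i
    unfolding sh a_def by (rule ghom_comp[OF ghom_right ghom_scale[OF \<psi> x_h]])
  have upper: "ghom n (ds (Suc i) @ shift (e + 1) (ds' i)) (ds i)
     (\<lambda>v. \<delta> i (left (a i) v) + scale x (\<psi> i (right (a i) v)))" for i
    using ghom_add[OF ghom_comp[OF ghom_left lresD(3)[OF L, of i]] x\<psi>] by (simp add: a_def)
  have \<Delta>: "ghom n (?C (Suc i)) (?C i) (\<Delta> i)" for i
  proof (cases i)
    case 0
    have "\<Delta> 0 = (\<lambda>v. \<delta> 0 (left (a 0) v) + scale x (\<psi> 0 (right (a 0) v)))"
      by (rule ext) (simp add: \<Delta>_def)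
    then show ?thesis using upper[of 0] 0 ds0 by simp
  next
    case (Suc k)
    have "ghom n (?C (Suc i)) (shift (e + 1) (ds' k)) (\<lambda>v. - \<delta>' k (right (a (Suc k)) v))"
      unfolding Suc cone_degs.simps a_def
      by (intro ghom_uminus ghom_comp[OF ghom_right ghom_shift[OF lresD(3)[OF L']]])
    from ghom_comp[OF this ghom_inright[of n _ "ds (Suc k)"]]
      ghom_comp[OF upper[of "Suc k"] ghom_inleft[of n _ "shift (e + 1) (ds' k)"]]
    have "ghom n (?C (Suc i)) (?C i) (\<lambda>v. (\<delta> (Suc k) (left (a (Suc k)) v) +
        scale x (\<psi> (Suc k) (right (a (Suc k)) v))) + inright (a k) (- \<delta>' k (right (a (Suc k)) v)))"
      unfolding Suc cone_degs.simps a_def by (rule ghom_add[rotated])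
    moreover have "\<Delta> (Suc k) = (\<lambda>v. (\<delta> (Suc k) (left (a (Suc k)) v) + scale x (\<psi> (Suc k) (right (a (Suc k)) v))) +
        inright (a k) (- \<delta>' k (right (a (Suc k)) v)))"
      by (rule ext) (simp add: \<Delta>_def)
    ultimately show ?thesis using Suc by (simp add: a_def)
  qed

  have upper_lift: "\<exists>w\<in>?VC (Suc (Suc i)). \<Delta> (Suc i) w = v"
    if v: "v \<in> ?VC (Suc i)" and z: "z \<in> ?V' (Suc i)" "right (a i) v = \<delta>' i z"
      and eq: "\<delta> i (left (a i) v) + scale x (\<psi> i (right (a i) v)) = 0" for i v z
  proof -
    \<comment> \<open>When the lower block is \<open>\<delta>' i z\<close>, adding
      \<open>scale x (\<psi> (Suc i) z)\<close> turns the upper block into a cycle of \<delta>. The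
      preimage contains \<open>- z\<close> because of the sign in the cone.\<close>
    let ?y = "left (a i) v + scale x (\<psi> (Suc i) z)"
    have xs: "scale x (\<psi> (Suc i) z) \<in> ?V (Suc i)" by (intro fvec_scale x_p \<psi>V z)
    then have yV: "?y \<in> ?V (Suc i)" by (intro fvec_add leftV v)
    have "\<delta> i ?y = \<delta> i (left (a i) v) + scale x (\<delta> i (\<psi> (Suc i) z))"
      using lin_add[OF ghom_lin[OF lresD(3)[OF L]] leftV[OF v] xs]
        lin_scale[OF ghom_lin[OF lresD(3)[OF L]] x_p \<psi>V[OF z(1)]] by simp
    then have "\<delta> i ?y = 0" using eq \<psi>S[OF z(1)] z(2) by simp
    then obtain w where w: "w \<in> ?V (Suc (Suc i))" "?y = \<delta> (Suc i) w" using lresD(6)[OF L yV] by blast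
    have "\<psi> (Suc i) (- z) = - \<psi> (Suc i) z" "\<delta>' i (- z) = - \<delta>' i z"
      using lin_uminus[OF ghom_lin[OF \<psi>]] lin_uminus[OF ghom_lin[OF lresD(3)[OF L']]] z(1) by auto
    then have "\<Delta> (Suc i) (w + inright (a (Suc i)) (- z)) =
      (\<delta> (Suc i) w - scale x (\<psi> (Suc i) z)) + inright (a i) (\<delta>' i z)"
      using left_right_join[of w n "a (Suc i)" "- z"] w(1)
      by (simp add: \<Delta>_def a_def scale_uminus_right)
    also have "\<dots> = left (a i) v + inright (a i) (right (a i) v)" using w(2)[symmetric] z(2) by simp
    also have "\<dots> = v" by (rule join_left_right)
    finally show ?thesis using joinV[OF w(1) fvec_uminus[OF z(1)]] by blast
  qed
  have upper_zero: "\<delta> i (left (a i) (\<Delta> (Suc i) w)) + scale x (\<psi> i (right (a i) (\<Delta> (Suc i) w))) = 0"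
    and right_\<Delta>: "right (a i) (\<Delta> (Suc i) w) = - \<delta>' i (right (a (Suc i)) w)"
    if w: "w \<in> ?VC (Suc (Suc i))" for i w
  proof -
    let ?l = "left (a (Suc i)) w" and ?r = "right (a (Suc i)) w"
    have l: "?l \<in> ?V (Suc (Suc i))" and r: "?r \<in> ?V' (Suc i)" using leftV[OF w] rightV[OF w] by auto
    have s: "scale x (\<psi> (Suc i) ?r) \<in> ?V (Suc i)" by (intro fvec_scale x_p \<psi>V r)
    have "\<delta> (Suc i) ?l + scale x (\<psi> (Suc i) ?r) \<in> fvec n (a i)"
      using fvec_add[OF \<delta>V[OF l] s] by (simp add: a_def)
    note lr = left_right_join[OF this, of "- \<delta>' i ?r"]
    show right: "right (a i) (\<Delta> (Suc i) w) = - \<delta>' i ?r" using lr by (simp add: \<Delta>_def)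
    have "\<delta> i (left (a i) (\<Delta> (Suc i) w)) = scale x (\<delta> i (\<psi> (Suc i) ?r))"
      using lr lin_add[OF ghom_lin[OF lresD(3)[OF L]] \<delta>V[OF l] s]
        lin_scale[OF ghom_lin[OF lresD(3)[OF L]] x_p \<psi>V[OF r]] lres_complex[OF L l]
      by (simp add: \<Delta>_def)
    moreover have "\<psi> i (- \<delta>' i ?r) = - \<psi> i (\<delta>' i ?r)"
      using lin_uminus[OF ghom_lin[OF \<psi>]] \<delta>V'[OF r] by simp
    ultimately show "\<delta> i (left (a i) (\<Delta> (Suc i) w)) + scale x (\<psi> i (right (a i) (\<Delta> (Suc i) w))) = 0"
      using right \<psi>S[OF r] by (simp add: scale_uminus_right)
  qed
  have exact: "\<Delta> i v = 0 \<longleftrightarrow> v \<in> \<Delta> (Suc i) ` ?VC (Suc (Suc i))" if v: "v \<in> ?VC (Suc i)" for i v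
  proof -
    let ?up = "\<delta> i (left (a i) v) + scale x (\<psi> i (right (a i) v))"
    have upV: "?up \<in> ?V i" by (intro fvec_add fvec_scale x_p \<psi>V \<delta>V rightV leftV v)
    have iff: "\<Delta> i v = 0 \<longleftrightarrow> ?up = 0 \<and> (\<forall>k. i = Suc k \<longrightarrow> \<delta>' k (right (a i) v) = 0)"
    proof (cases i)
      case (Suc k)
      then show ?thesis using join_eq_zero_iff[of ?up n "a k"] upV by (simp add: \<Delta>_def a_def)
    qed (simp add: \<Delta>_def)
    show ?thesis
    proof
      assume "\<Delta> i v = 0"
      then have up: "?up = 0" and k: "\<And>k. i = Suc k \<Longrightarrow> \<delta>' k (right (a i) v) = 0" using iff by auto
      have "right (a i) v \<in> \<delta>' i ` ?V' (Suc i)"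
      proof (cases i)
        case 0
        \<comment> \<open>At the bottom the upper equation puts x m r, with r the right block, into
          the ideal of \<open>U\<close>. Regularity cancels \<open>x\<close>, and the colon
          condition places r in the ideal of \<open>U'\<close>, which is the image of
          \<open>\<delta>' 0\<close>.\<close>
        have r: "right (a 0) v \<in> fvec n 1" using rightV[of v 0] v 0 ds0' by simp
        have l: "left (a 0) v \<in> ?V 1" using leftV[of v 0] v 0 by simp
        have "\<delta> 0 (left (a 0) v) \<in> ivec n U"
          using lresD(5)[OF L, of "\<delta> 0 (left (a 0) v)"] \<delta>V[of "left (a 0) v" 0] l by auto
        then have "- \<delta> 0 (left (a 0) v) 0 \<in> mon_ideal n U"
          by (auto simp: ivec_def intro: mon_ideal_uminus)
        moreover have "\<delta> 0 (left (a 0) v) 0 + x * (mon m * right (a 0) v 0) = 0"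
          using fun_cong[OF up, of 0] 0 by (simp add: \<psi>0 scale_def)
        ultimately have "x * (mon m * right (a 0) v 0) \<in> mon_ideal n U"
          by (simp add: eq_neg_iff_add_eq_0[symmetric] add.commute)
        then have "right (a 0) v 0 \<in> mon_ideal n U'"
          using reg_mem[of "mon m * right (a 0) v 0"] colon_mem[of "right (a 0) v 0"]
            fvec_polys[OF r] polys_mult[OF mon_p] by blast
        then show ?thesis using lresD(5)[OF L', of "right (a 0) v"] r 0 ds0' by (simp add: ivec_def)
      next
        case (Suc k)
        then show ?thesis using lresD(6)[OF L', of "right (a i) v" k] k rightV[OF v] by simp
      qed
      then show "v \<in> \<Delta> (Suc i) ` ?VC (Suc (Suc i))" using upper_lift[OF v _ _ up] by blast
    next
      assume "v \<in> \<Delta> (Suc i) ` ?VC (Suc (Suc i))"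
      then obtain w where w: "w \<in> ?VC (Suc (Suc i))" "v = \<Delta> (Suc i) w" by blast
      have "\<delta>' k (right (a i) v) = 0" if "i = Suc k" for k
      proof -
        have r: "right (a (Suc i)) w \<in> ?V' (Suc i)" using rightV[OF w(1)] .
        show ?thesis
          using lres_complex[OF L', of "right (a (Suc i)) w" k] r
            lin_uminus[OF ghom_lin[OF lresD(3)[OF L', of k]] \<delta>V'[of "right (a (Suc i)) w" i, unfolded that]]
            right_\<Delta>[OF w(1)]
          by (simp add: w(2) that)
      qed
      then show "\<Delta> i v = 0" unfolding iff using upper_zero[OF w(1)] w(2) by blast
    qed
  qed
  have image: "v \<in> ivec n ?W \<longleftrightarrow> v \<in> \<Delta> 0 ` ?VC 1" if v: "v \<in> fvec n 1" for v
  proof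
    assume vW: "v \<in> ivec n ?W"
    \<comment> \<open>The terms are sorted: those with exponent in \<open>U\<close> form
      \<open>?f1\<close>; all others are divisible by x m, so \<open>?f2\<close> is a multiple of
      it.\<close>
    let ?f1 = "\<Sum>k\<in>supp (v 0) \<inter> U. Poly_Mapping.single k (coef (v 0) k)"
    let ?f2 = "\<Sum>k\<in>supp (v 0) - U. Poly_Mapping.single k (coef (v 0) k)"
    have v0: "v 0 \<in> polys n" "supp (v 0) \<subseteq> ?W" using vW by (auto simp: ivec_def mon_ideal_def)
    have sp: "Poly_Mapping.single k (coef (v 0) k) \<in> polys n" if "k \<in> supp (v 0)" for k
      using v0(1) that by (simp add: polys_iff)
    have f2p: "?f2 \<in> polys n" using sp by auto
    have split: "v 0 = ?f1 + ?f2"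
      using poly_eq_sum_single[of "v 0"] sum.Int_Diff[of "supp (v 0)" _ U] by (metis (no_types, lifting) finite_keys)
    have f1: "?f1 \<in> mon_ideal n U"
      using sp by (intro mon_ideal_sum) (auto simp: mon_ideal_def)
    have "\<exists>b. k = Poly_Mapping.single u 1 + m + b" if "k \<in> supp ?f2" for k
    proof -
      have "k \<in> supp (v 0) - U"
        using that keys_sum[of "\<lambda>k. Poly_Mapping.single k (coef (v 0) k)" "supp (v 0) - U"]
        by (auto split: if_splits)
      then show ?thesis using v0(2) by auto
    qed
    from divisible_mon_imp_mult[OF f2p this]
    obtain h where h: "h \<in> polys n" "?f2 = mon (Poly_Mapping.single u 1 + m) * h" by blast
    define v1 v2 where "v1 = scale ?f1 (unit_vec 0)" and "v2 = scale h (unit_vec 0)"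
    have v12: "v1 \<in> fvec n 1" "v2 \<in> fvec n 1"
      unfolding v1_def v2_def using h(1) mon_ideal_polys[OF f1] by (auto intro: fvec_scale fvec_unit_vec)
    have "v1 \<in> ivec n U" using v12(1) f1 by (simp add: ivec_def v1_def scale_def unit_vec_def)
    then obtain w where w: "w \<in> ?V 1" "v1 = \<delta> 0 w" using lresD(5)[OF L, of v1] v12 ds0 by auto
    have "mon (Poly_Mapping.single u 1 + m) = x * mon m" by (simp add: x_mon mult_single)
    then have "v = v1 + scale x (scale (mon m) v2)"
      using v split h(2) by (auto simp: fun_eq_iff v1_def v2_def scale_def unit_vec_def fvec_def mult.assoc)
    also have "\<dots> = \<Delta> 0 (w + inright (a 0) v2)"
      using left_right_join[of w n "a 0" v2] w by (simp add: \<Delta>_def a_def \<psi>0)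
    finally show "v \<in> \<Delta> 0 ` ?VC 1" using joinV[of w 0 v2] w v12 ds0' by auto
  next
    assume "v \<in> \<Delta> 0 ` ?VC 1"
    then obtain w where w: "w \<in> ?VC (Suc 0)" "v = \<Delta> 0 w" by auto
    have "\<delta> 0 (left (a 0) w) \<in> ivec n U"
      using lresD(5)[OF L, of "\<delta> 0 (left (a 0) w)"] \<delta>V[OF leftV[OF w(1)]] leftV[OF w(1)] by auto
    then have "\<delta> 0 (left (a 0) w) 0 \<in> mon_ideal n ?W" by (auto simp: ivec_def mon_ideal_def)
    moreover have "x * (mon m * right (a 0) w 0) \<in> polys n"
      by (intro polys_mult x_p mon_p fvec_polys[OF rightV[OF w(1)]])
    then have "x * (mon m * right (a 0) w 0) \<in> mon_ideal n ?W"
      by (auto simp: mon_ideal_def supp_mult_mon x_mon image_image add.assoc)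
    ultimately have "v 0 \<in> mon_ideal n ?W"
      using w(2) by (auto simp: \<Delta>_def \<psi>0 scale_def intro: mon_ideal_add)
    then show "v \<in> ivec n ?W" using v by (simp add: ivec_def)
  qed
  \<comment> \<open>Minimality: the blocks \<delta> and \<delta>' are minimal already, and the
    factor \<open>x\<close> removes the units that \<psi> may contain.\<close>
  have "coef (x * f) 0 = 0" for f
    using coef_zero_homog[OF x_h] by (simp add: coef_mult_zero)
  moreover have "coef (\<delta> i (left (a i) v) c) 0 = 0" if "v \<in> ?VC (Suc i)" for v i c
    using M leftV[OF that] unfolding minimal_diff_def by blast
  moreover have "coef (\<delta>' i (right (a (Suc i)) v) c) 0 = 0" if "v \<in> ?VC (Suc (Suc i))" for v i c
    using M' rightV[OF that] unfolding minimal_diff_def by blast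
  ultimately have "coef (\<Delta> i v c) 0 = 0" if "v \<in> ?VC (Suc i)" for i v c
    using that by (cases i) (simp_all add: \<Delta>_def lookup_add scale_def inright_def)
  then have "minimal_diff n ?C \<Delta>" by (simp only: minimal_diff_def) blast
  moreover have "lres n (ivec n ?W) ?C \<Delta> (\<lambda>v. v)"
    unfolding lres_def
  proof (intro conjI allI ballI)
    show "gsub n [0] (ivec n ?W)" by (rule gsub_ivec[OF W])
    show "ghom n (?C 0) [0] (\<lambda>v. v)" by (simp add: ghom_id)
    show "\<exists>v\<in>?VC 0. s - v \<in> ivec n ?W" if "s \<in> fvec n 1" for s
      using that by (intro bexI[of _ s]) (auto simp: ivec_def)
    show "v \<in> ivec n ?W \<longleftrightarrow> v \<in> \<Delta> 0 ` ?VC 1" if "v \<in> ?VC 0" for v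
      using image that by simp
  qed (fact \<Delta> exact)+
  ultimately have "mres n ?W ?C \<Delta>" by (simp add: mres_def)
  then show ?thesis unfolding e_def by blast
qed

lemma mres_empty: "\<exists>\<delta> :: nat \<Rightarrow> (nat \<Rightarrow> 'k::field mpoly) \<Rightarrow> nat \<Rightarrow> 'k mpoly.
  mres n {} (\<lambda>i. if i = 0 then [0] else []) \<delta>"
proof
  define ds :: "nat \<Rightarrow> int list" where "ds = (\<lambda>i. if i = 0 then [0] else [])"
  have ds: "ds 0 = [0]" "\<And>i. ds (Suc i) = []" by (auto simp: ds_def)
  have z: "fvec n 0 = {0 :: nat \<Rightarrow> 'k mpoly}" by (auto simp: fvec_def)
  have "ivec n {} = {0 :: nat \<Rightarrow> 'k mpoly}"
    by (auto simp: ivec_def mon_ideal_def fvec_def fun_eq_iff supp_eq_empty Suc_le_eq) (metis gr0I)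
  moreover have "gsub n [0] (ivec n {} :: (nat \<Rightarrow> 'k mpoly) set)"
    by (rule gsub_ivec) (simp add: upward_def)
  moreover have "ghom n (ds (Suc i)) (ds i) (\<lambda>v :: nat \<Rightarrow> 'k mpoly. 0)" for i
    by (simp add: ghom_def lin_def vcomp_zero)
  moreover have "\<exists>v\<in>fvec n 1. s - v = 0" if "s \<in> fvec n 1" for s :: "nat \<Rightarrow> 'k mpoly"
    using that by auto
  ultimately have "lres n (ivec n {}) ds (\<lambda>i v. 0) (\<lambda>v :: nat \<Rightarrow> 'k mpoly. v)"
    unfolding lres_def by (simp add: ds z ghom_id)
  then show "mres n {} (\<lambda>i. if i = 0 then [0] else []) (\<lambda>i v. 0 :: nat \<Rightarrow> 'k mpoly)"
    by (simp add: mres_def minimal_diff_def flip: ds_def) (simp add: ds_def)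
qed

section \<open>Squarefree monomial ideals\<close>

text \<open>Hyperedges encode squarefree generators: an edge of the graph stands for a product of two
  variables, a singleton for a variable.\<close>

definition up :: "nat set set \<Rightarrow> (nat \<Rightarrow>\<^sub>0 nat) set" where
  "up H = {m. \<exists>h\<in>H. h \<subseteq> supp m}"

lemma upward_up: "upward (up H)"
  by (auto simp: upward_def up_def supp_add_nat)

lemma in_supp_iff_add: "u \<in> supp (k :: nat \<Rightarrow>\<^sub>0 nat) \<longleftrightarrow> (\<exists>b. k = Poly_Mapping.single u 1 + b)"
proof
  assume "u \<in> supp k"
  then have "k = Poly_Mapping.single u 1 + (k - Poly_Mapping.single u 1)"
    by (intro poly_mapping_eqI) (auto simp: lookup_add lookup_minus lookup_single when_def in_keys_iff)
  then show "\<exists>b. k = Poly_Mapping.single u 1 + b" by blast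
qed (auto simp: supp_add_nat)

lemma pair_subset_supp_iff_add:
  assumes "u \<noteq> v"
  shows "{u, v} \<subseteq> supp (k :: nat \<Rightarrow>\<^sub>0 nat) \<longleftrightarrow>
    (\<exists>b. k = Poly_Mapping.single u 1 + Poly_Mapping.single v 1 + b)"
proof
  assume "{u, v} \<subseteq> supp k"
  then obtain b where b: "k = Poly_Mapping.single u 1 + b" using in_supp_iff_add[of u k] by blast
  then have "v \<in> supp b" using \<open>{u, v} \<subseteq> supp k\<close> assms by (auto simp: supp_add_nat split: if_splits)
  then obtain c where "b = Poly_Mapping.single v 1 + c" using in_supp_iff_add[of v b] by blast
  then show "\<exists>b. k = Poly_Mapping.single u 1 + Poly_Mapping.single v 1 + b"
    using b by (auto simp: add.assoc)
qed (auto simp: supp_add_nat)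

text \<open>\<open>p\<close> and \<open>r\<close> are the projective dimension and the regularity, read off a minimal resolution.\<close>

definition resolves :: "'k::field itself \<Rightarrow> nat \<Rightarrow> nat set set \<Rightarrow> nat \<Rightarrow> int \<Rightarrow> bool" where
  "resolves K n H p r \<longleftrightarrow>
    (\<exists>ds (\<delta> :: nat \<Rightarrow> (nat \<Rightarrow> 'k mpoly) \<Rightarrow> nat \<Rightarrow> 'k mpoly). mres n (up H) ds \<delta> \<and>
      (\<forall>i. ds i \<noteq> [] \<longrightarrow> i \<le> p) \<and> ds p \<noteq> [] \<and>
      (\<forall>i. \<forall>d\<in>set (ds i). d - int i \<le> r) \<and> (\<exists>i. \<exists>d\<in>set (ds i). d - int i = r))"

lemma resolves_empty: "resolves (K :: 'k::field itself) n {} 0 0"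
proof -
  obtain \<delta> :: "nat \<Rightarrow> (nat \<Rightarrow> 'k mpoly) \<Rightarrow> nat \<Rightarrow> 'k mpoly" where
    "mres n {} (\<lambda>i. if i = 0 then [0] else []) \<delta>" using mres_empty by blast
  moreover have "up {} = {}" by (simp add: up_def)
  ultimately show ?thesis unfolding resolves_def
    by (intro exI[of _ "\<lambda>i. if i = 0 then [0] else []"] exI[of _ \<delta>]) (auto intro!: exI[of _ 0])
qed

text \<open>The cone is minimal, so its basis degrees are those of both resolutions together. Degree
  d in step i of the second reappears as d + deg m + 1 in step i + 1: its share of the regularity
  grows by deg m, that of the projective dimension by 1.\<close>

lemma resolves_cone:
  assumes R: "resolves (K :: 'k::field itself) n H p r" and R': "resolves K n H' p' r'"
    and u: "u \<in> {1..n}" and m: "supp m \<subseteq> {1..n}"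
    and reg: "\<And>h. h \<in> H \<Longrightarrow> u \<notin> h"
    and colon: "\<And>k. k \<in> up H' \<longleftrightarrow> m + k \<in> up H"
    and H'': "up H'' = up H \<union> {k. \<exists>b. k = Poly_Mapping.single u 1 + m + b}"
  shows "resolves K n H'' (max p (p' + 1)) (max r (r' + int (mono_deg m)))"
proof -
  obtain ds and \<delta> :: "nat \<Rightarrow> (nat \<Rightarrow> 'k mpoly) \<Rightarrow> nat \<Rightarrow> 'k mpoly" where
    D: "mres n (up H) ds \<delta>" "\<And>i. ds i \<noteq> [] \<Longrightarrow> i \<le> p" "ds p \<noteq> []"
      "\<And>i d. d \<in> set (ds i) \<Longrightarrow> d - int i \<le> r" "\<exists>i. \<exists>d\<in>set (ds i). d - int i = r"
    using R unfolding resolves_def by blast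
  obtain ds' and \<delta>' :: "nat \<Rightarrow> (nat \<Rightarrow> 'k mpoly) \<Rightarrow> nat \<Rightarrow> 'k mpoly" where
    D': "mres n (up H') ds' \<delta>'" "\<And>i. ds' i \<noteq> [] \<Longrightarrow> i \<le> p'" "ds' p' \<noteq> []"
      "\<And>i d. d \<in> set (ds' i) \<Longrightarrow> d - int i \<le> r'" "\<exists>i. \<exists>d\<in>set (ds' i). d - int i = r'"
    using R' unfolding resolves_def by blast
  let ?e = "int (mono_deg m)"
  let ?C = "cone_degs (?e + 1) ds ds'"
  have "k \<in> up H" if "Poly_Mapping.single u 1 + k \<in> up H" for k
    using that reg by (auto simp: up_def supp_add_nat)
  from mapping_cone[OF upward_up upward_up D(1) D'(1) u m this colon]
  obtain \<Delta> :: "nat \<Rightarrow> (nat \<Rightarrow> 'k mpoly) \<Rightarrow> nat \<Rightarrow> 'k mpoly" where "mres n (up H'') ?C \<Delta>"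
    unfolding H'' by blast
  moreover have C: "?C i = ds i @ (case i of 0 \<Rightarrow> [] | Suc j \<Rightarrow> shift (?e + 1) (ds' j))" for i
    using D(1) by (cases i) (auto simp: mres_def)
  have "i \<le> max p (p' + 1)" if "?C i \<noteq> []" for i
    using that D(2)[of i] D'(2) unfolding C by (cases i) (fastforce simp: shift_def)+
  moreover have "?C (max p (p' + 1)) \<noteq> []"
  proof (cases "p \<ge> p' + 1")
    case True
    then show ?thesis using D(3) by (simp add: C max_def)
  next
    case False
    then show ?thesis using D'(3) by (simp add: max_def shift_def)
  qed
  moreover have "d - int i \<le> max r (r' + ?e)" if "d \<in> set (?C i)" for i d
    using that D(4)[of d i] D'(4) unfolding C
    by (cases i) (fastforce simp: shift_def)+
  moreover have "\<exists>i. \<exists>d\<in>set (?C i). d - int i = max r (r' + ?e)"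
  proof (cases "r \<ge> r' + ?e")
    case True
    then show ?thesis using D(5) unfolding C by (auto simp: max_def)
  next
    case False
    from D'(5) obtain i d where "d \<in> set (ds' i)" "d - int i = r'" by blast
    then have "d + (?e + 1) \<in> set (?C (Suc i))" "d + (?e + 1) - int (Suc i) = max r (r' + ?e)"
      using False by (auto simp: shift_def)
    then show ?thesis by blast
  qed
  ultimately show ?thesis unfolding resolves_def by blast
qed

text \<open>A variable outside all generators is regular on the quotient; this is the cone with
  \<open>m = 0\<close> and both resolutions equal, where the colon condition is trivial.\<close>

lemma resolves_insert_singleton:
  assumes R: "resolves K n H p r" and r: "r \<ge> 0" and u: "u \<in> {1..n}" and reg: "\<And>h. h \<in> H \<Longrightarrow> u \<notin> h"
  shows "resolves K n (insert {u} H) (p + 1) r"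
proof -
  have "up (insert {u} H) = up H \<union> {k. \<exists>b. k = Poly_Mapping.single u 1 + 0 + b}"
    using in_supp_iff_add[of u] by (auto simp: up_def)
  from resolves_cone[OF R R u _ reg _ this] show ?thesis by simp
qed

lemma resolves_insert_edge:
  assumes R: "resolves K n H p r" and R': "resolves K n H' p' r'"
    and uv: "u \<in> {1..n}" "v \<in> {1..n}" "u \<noteq> v" and reg: "\<And>h. h \<in> H \<Longrightarrow> u \<notin> h"
    and colon: "\<And>k. k \<in> up H' \<longleftrightarrow> Poly_Mapping.single v 1 + k \<in> up H"
  shows "resolves K n (insert {u, v} H) (max p (p' + 1)) (max r (r' + 1))"
proof -
  have "up (insert {u, v} H) = up H \<union> {k. \<exists>b. k = Poly_Mapping.single u 1 + Poly_Mapping.single v 1 + b}"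
    using pair_subset_supp_iff_add[OF uv(3)] by (auto simp: up_def)
  from resolves_cone[OF R R' uv(1) _ reg colon this] uv show ?thesis by simp
qed

lemma resolves_union_singletons:
  assumes "finite W" "resolves K n H p r" "r \<ge> 0" "W \<subseteq> {1..n}" "\<And>h. h \<in> H \<Longrightarrow> h \<inter> W = {}"
  shows "resolves K n (H \<union> (\<lambda>w. {w}) ` W) (p + card W) r"
  using assms
proof (induction W rule: finite_induct)
  case (insert w W)
  then have "resolves K n (H \<union> (\<lambda>w. {w}) ` W) (p + card W) r" by auto
  from resolves_insert_singleton[OF this insert.prems(2), of w] show ?case
    using insert by auto
qed simp

lemma proj_dim_regularity_of_resolves:
  assumes "resolves (K :: 'k::field itself) n H p r"
  shows "proj_dim n (quotient_module n (mon_ideal n (up H) :: 'k mpoly set)) = int p"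
    "regularity n (quotient_module n (mon_ideal n (up H) :: 'k mpoly set)) = r"
proof -
  obtain ds and \<delta> :: "nat \<Rightarrow> (nat \<Rightarrow> 'k mpoly) \<Rightarrow> nat \<Rightarrow> 'k mpoly" where
    D: "mres n (up H) ds \<delta>" "\<And>i. ds i \<noteq> [] \<Longrightarrow> i \<le> p" "ds p \<noteq> []"
      "\<And>i d. d \<in> set (ds i) \<Longrightarrow> d - int i \<le> r" "\<exists>i. \<exists>d\<in>set (ds i). d - int i = r"
    using assms unfolding resolves_def by blast
  let ?Q = "quotient_module n (mon_ideal n (up H) :: 'k mpoly set)"
  have b: "betti n ?Q i j \<noteq> 0 \<longleftrightarrow> j \<in> set (ds i)" for i j
    using betti_eq_count_list[OF upward_up D(1)] count_list_0_iff by metis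
  have "{int i |i. \<exists>j. betti n ?Q i j \<noteq> 0} = int ` {i. ds i \<noteq> []}"
    unfolding b by (auto simp: ex_in_conv)
  moreover have "finite {i. ds i \<noteq> []}" using D(2) by (auto intro!: bounded_nat_set_is_finite[of _ "Suc p"] simp: less_Suc_eq_le)
  ultimately show "proj_dim n ?Q = int p"
    unfolding proj_dim_def using D(2,3) by (auto intro!: Max_eqI)
  have "{j - int i |i j. j \<in> set (ds i)} \<subseteq> (\<Union>i\<le>p. (\<lambda>j. j - int i) ` set (ds i))"
  proof clarify
    fix i j assume "j \<in> set (ds i)"
    then have "i \<le> p" using D(2)[of i] by (cases "ds i") auto
    then show "j - int i \<in> (\<Union>i\<le>p. (\<lambda>j. j - int i) ` set (ds i))" using \<open>j \<in> set (ds i)\<close> by blast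
  qed
  then have "finite {j - int i |i j. j \<in> set (ds i)}" by (rule finite_subset) auto
  then show "regularity n ?Q = r"
    unfolding regularity_def b using D(4,5) by (intro Max_eqI) auto
qed

text \<open>Divisibility by a product of two distinct variables is a condition on the support of an
  exponent; simplicity of the graph excludes squares.\<close>

lemma edge_ideal_eq_mon_ideal:
  assumes "simple_graph n E"
  shows "edge_ideal n E = (mon_ideal n (up E) :: 'k::field mpoly set)"
  unfolding edge_ideal_def
proof (rule genideal_eq_mon_ideal[OF upward_up])
  have E: "i \<noteq> j \<and> i \<in> {1..n} \<and> j \<in> {1..n}" if "{i, j} \<in> E" for i j
  proof -
    have "{i, j} \<subseteq> {1..n}" "card {i, j} = 2" using assms that unfolding simple_graph_def by blast+
    then show ?thesis by (cases "i = j") auto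
  qed
  have V: "Var i * Var j = (mon (Poly_Mapping.single i 1 + Poly_Mapping.single j 1) :: 'k mpoly)" for i j
    by (simp add: Var_def mult_single)
  show "{Var i * Var j |i j. {i, j} \<in> E} \<subseteq> (mon_ideal n (up E) :: 'k mpoly set)"
  proof clarify
    fix i j assume ij: "{i, j} \<in> E"
    then have "supp (Poly_Mapping.single i (1::nat) + Poly_Mapping.single j 1) = {i, j}"
      by (auto simp: supp_add_nat)
    then show "(Var i * Var j :: 'k mpoly) \<in> mon_ideal n (up E)"
      using E[OF ij] ij unfolding V by (auto simp: mon_ideal_def polys_iff up_def)
  qed
  fix m :: "nat \<Rightarrow>\<^sub>0 nat" assume "m \<in> up E" "supp m \<subseteq> {1..n}"
  then obtain e where e: "e \<in> E" "e \<subseteq> supp m" by (auto simp: up_def)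
  then obtain i j where ij: "e = {i, j}" "i \<noteq> j"
    using assms by (auto simp: simple_graph_def card_2_iff)
  then obtain b where "m = Poly_Mapping.single i 1 + Poly_Mapping.single j 1 + b"
    using pair_subset_supp_iff_add[OF ij(2)] e(2) by blast
  moreover have "mon (Poly_Mapping.single i 1 + Poly_Mapping.single j 1) \<in>
      {Var i * Var j :: 'k mpoly |i j. {i, j} \<in> E}"
    unfolding mem_Collect_eq using e(1) ij(1) V by metis
  ultimately show "\<exists>a b. mon a \<in> {Var i * Var j :: 'k mpoly |i j. {i, j} \<in> E} \<and> m = a + b" by blast
qed

section \<open>Independent sets and induced matchings of forests\<close>

definition nbrs :: "nat set set \<Rightarrow> nat \<Rightarrow> nat set" where
  "nbrs E v = {w. {v, w} \<in> E}"

definition graph_on :: "nat set \<Rightarrow> nat set set \<Rightarrow> bool" where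
  "graph_on V E \<longleftrightarrow> (\<forall>e\<in>E. e \<subseteq> V \<and> card e = 2)"

definition acyclic_graph :: "nat set set \<Rightarrow> bool" where
  "acyclic_graph E \<longleftrightarrow> (\<nexists>xs. is_cycle E xs)"

text \<open>\<open>V\<close> is a separate argument because deleting edges creates isolated
  vertices, and these are forced into every such set.\<close>

definition max_indep :: "nat set \<Rightarrow> nat set set \<Rightarrow> nat set \<Rightarrow> bool" where
  "max_indep V E A \<longleftrightarrow> A \<subseteq> V \<and> (\<forall>e\<in>E. \<not> e \<subseteq> A) \<and> (\<forall>w\<in>V - A. \<exists>a\<in>A. {w, a} \<in> E)"

text \<open>One clause covers both requirements: g = e gives disjointness of distinct edges, and any
  other g is excluded as a connecting edge.\<close>

definition induced_matching :: "nat set set \<Rightarrow> nat set set \<Rightarrow> bool" where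
  "induced_matching E M \<longleftrightarrow> M \<subseteq> E \<and>
    (\<forall>e\<in>M. \<forall>f\<in>M. \<forall>g\<in>E. g \<inter> e \<noteq> {} \<longrightarrow> g \<inter> f \<noteq> {} \<longrightarrow> e = f)"

lemma max_indepD:
  assumes "max_indep V E A"
  shows "A \<subseteq> V" "a \<in> A \<Longrightarrow> b \<in> A \<Longrightarrow> {a, b} \<notin> E" "w \<in> V \<Longrightarrow> w \<notin> A \<Longrightarrow> \<exists>a\<in>A. {w, a} \<in> E"
  using assms by (auto simp: max_indep_def)

lemma induced_matchingD:
  assumes "induced_matching E M"
  shows "M \<subseteq> E" "e \<in> M \<Longrightarrow> f \<in> M \<Longrightarrow> g \<in> E \<Longrightarrow> g \<inter> e \<noteq> {} \<Longrightarrow> g \<inter> f \<noteq> {} \<Longrightarrow> e = f"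
  using assms unfolding induced_matching_def by blast+

lemma induced_matchingI:
  assumes "M \<subseteq> E"
    "\<And>e f g. e \<in> M \<Longrightarrow> f \<in> M \<Longrightarrow> g \<in> E \<Longrightarrow> g \<inter> e \<noteq> {} \<Longrightarrow> g \<inter> f \<noteq> {} \<Longrightarrow> e = f"
  shows "induced_matching E M"
  using assms unfolding induced_matching_def by blast

lemma graph_onD: "graph_on V E \<Longrightarrow> {u, v} \<in> E \<Longrightarrow> u \<in> V \<and> v \<in> V \<and> u \<noteq> v"
  unfolding graph_on_def by (force simp: card_2_iff doubleton_eq_iff)

lemma graph_on_edgeE:
  assumes "graph_on V E" "e \<in> E"
  obtains u v where "e = {u, v}" "u \<noteq> v" "u \<in> V" "v \<in> V"
  using assms unfolding graph_on_def by (auto simp: card_2_iff)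

lemma graph_on_finite: "finite V \<Longrightarrow> graph_on V E \<Longrightarrow> finite E"
  using finite_subset[of E "Pow V"] by (auto simp: graph_on_def)

lemma graph_on_subset: "graph_on V E \<Longrightarrow> E' \<subseteq> E \<Longrightarrow> graph_on V E'"
  by (auto simp: graph_on_def)

lemma acyclic_graph_subset: "acyclic_graph E \<Longrightarrow> E' \<subseteq> E \<Longrightarrow> acyclic_graph E'"
  unfolding acyclic_graph_def is_cycle_def by (metis subsetD)

text \<open>The first vertex of a longest path has no neighbour besides the second vertex.\<close>

lemma acyclic_graph_leaf:
  assumes V: "finite V" and G: "graph_on V E" and A: "acyclic_graph E" and ne: "E \<noteq> {}"
  obtains u v where "nbrs E u = {v}"
proof -
  define P where "P xs \<longleftrightarrow> distinct xs \<and> set xs \<subseteq> V \<and> 2 \<le> length xs \<and>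
    (\<forall>k. Suc k < length xs \<longrightarrow> {xs ! k, xs ! Suc k} \<in> E)" for xs
  obtain a b where ab: "{a, b} \<in> E" using ne graph_on_edgeE[OF G] by (metis ex_in_conv)
  then have "P [a, b]" using graph_onD[OF G ab] by (auto simp: P_def less_Suc_eq)
  moreover have "\<forall>xs. P xs \<longrightarrow> length xs < Suc (card V)"
    using V by (metis P_def card_mono distinct_card less_Suc_eq_le)
  ultimately obtain xs where xs: "P xs" "\<And>ys. P ys \<Longrightarrow> length ys \<le> length xs"
    using ex_has_greatest_nat[of P "[a, b]" length "Suc (card V)"] by blast
  then obtain u v ys where uv: "xs = u # v # ys"
    by (cases xs rule: list.exhaust; cases "tl xs") (auto simp: P_def)
  have "{u, v} \<in> E" using xs(1) uv by (auto simp: P_def)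
  moreover have "w = v" if w: "{u, w} \<in> E" for w
  proof (rule ccontr)
    assume "w \<noteq> v"
    show False
    proof (cases "w \<in> set xs")
      case False
      have "P (w # xs)"
        using xs(1) False graph_onD[OF G w] w unfolding P_def
        by (auto simp: uv nth_Cons insert_commute split: nat.splits)
      from xs(2)[OF this] show False by simp
    next
      case True
      then obtain k where k: "k < length xs" "w = xs ! k" by (metis in_set_conv_nth)
      \<comment> \<open>\<open>w\<close> is neither \<open>u\<close> nor \<open>v\<close>, so the
        part of the path up to \<open>w\<close> has at least three vertices, and the edge from
        \<open>w\<close> back to \<open>u\<close> closes it.\<close>
      have k2: "2 \<le> k"
        using k \<open>w \<noteq> v\<close> graph_onD[OF G w] uv by (cases k; cases "k - 1") auto
      let ?c = "take (Suc k) xs"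
      have "is_cycle E ?c"
        unfolding is_cycle_def
      proof (intro conjI)
        show "\<forall>j. Suc j < length ?c \<longrightarrow> {?c ! j, ?c ! Suc j} \<in> E"
          using xs(1) by (auto simp: P_def)
        have "last ?c = w" using k by (simp add: take_Suc_conv_app_nth)
        moreover have "hd ?c = u" using uv by simp
        ultimately show "{last ?c, hd ?c} \<in> E" using w by (simp add: insert_commute)
      qed (use k k2 xs(1) in \<open>auto simp: P_def\<close>)
      then show False using A by (auto simp: acyclic_graph_def)
    qed
  qed
  ultimately have "nbrs E u = {v}" unfolding nbrs_def by blast
  then show ?thesis by (rule that)
qed

lemma acyclic_graph_induct [consumes 3, case_names empty leaf]:
  assumes "finite V" "graph_on V E" "acyclic_graph E"
    and "P {}"
    and leaf: "\<And>E u v. graph_on V E \<Longrightarrow> nbrs E u = {v} \<Longrightarrow> P (E - {{u, v}}) \<Longrightarrow> P E"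
  shows "P E"
proof -
  have "finite E" using assms(1,2) by (rule graph_on_finite)
  then show ?thesis using assms(2,3)
  proof (induction E rule: finite_psubset_induct)
    case (psubset E)
    show ?case
    proof (cases "E = {}")
      case False
      then obtain u v where uv: "nbrs E u = {v}"
        using acyclic_graph_leaf[OF assms(1) psubset.prems] by blast
      then have "{u, v} \<in> E" by (auto simp: nbrs_def)
      then have "P (E - {{u, v}})"
        by (intro psubset.IH graph_on_subset[OF psubset.prems(1)] acyclic_graph_subset[OF psubset.prems(2)]) auto
      then show ?thesis using leaf psubset.prems uv by blast
    qed (use assms(4) in simp)
  qed
qed

lemma leaf_edge_iff:
  assumes "graph_on V E" "nbrs E u = {v}" "e \<in> E"
  shows "u \<in> e \<longleftrightarrow> e = {u, v}"
proof
  assume "u \<in> e"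
  obtain x y where "e = {x, y}" using graph_on_edgeE[OF assms(1,3)] by metis
  then obtain w where w: "e = {u, w}" using \<open>u \<in> e\<close> by auto
  then have "w \<in> nbrs E u" using assms(3) by (simp add: nbrs_def)
  then show "e = {u, v}" using w assms(2) by simp
qed simp

text \<open>Orients the forest: a leaf points to its neighbour when its edge is deleted. As it lies
  on no remaining edge, every vertex indexes at most one edge.\<close>

lemma acyclic_graph_parent:
  assumes "finite V" "graph_on V E" "acyclic_graph E"
  shows "\<exists>X par. E = (\<lambda>x. {x, par x}) ` X"
  using assms
proof (induction rule: acyclic_graph_induct)
  case (leaf E u v)
  then obtain X par where X: "E - {{u, v}} = (\<lambda>x. {x, par x}) ` X" by blast
  have uv: "{u, v} \<in> E" using leaf by (auto simp: nbrs_def)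
  have "u \<notin> X"
  proof
    assume "u \<in> X"
    then have "{u, par u} \<in> E - {{u, v}}" using X by auto
    then show False using leaf_edge_iff[OF leaf(1,2)] by blast
  qed
  then have "(\<lambda>x. {x, (par(u := v)) x}) ` insert u X = insert {u, v} ((\<lambda>x. {x, par x}) ` X)"
    by (auto simp: image_iff)
  also have "\<dots> = E" using X uv by blast
  finally show ?case by metis
qed auto

lemma acyclic_graph_2_colouring:
  assumes "finite V" "graph_on V E" "acyclic_graph E"
  shows "\<exists>col :: nat \<Rightarrow> bool. \<forall>a b. {a, b} \<in> E \<longrightarrow> col a \<noteq> col b"
  using assms
proof (induction rule: acyclic_graph_induct)
  case (leaf E u v)
  then obtain col :: "nat \<Rightarrow> bool" where col: "\<And>a b. {a, b} \<in> E - {{u, v}} \<Longrightarrow> col a \<noteq> col b" by blast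
  have uv: "u \<noteq> v" using leaf graph_onD[OF leaf(1), of u v] by (auto simp: nbrs_def)
  have "(col(u := \<not> col v)) a \<noteq> (col(u := \<not> col v)) b" if ab: "{a, b} \<in> E" for a b
  proof (cases "u \<in> {a, b}")
    case True
    then have "{a, b} = {u, v}" using leaf_edge_iff[OF leaf(1,2) ab] by blast
    then show ?thesis using uv by (auto simp: doubleton_eq_iff)
  next
    case False
    then have "{a, b} \<in> E - {{u, v}}" using ab by auto
    then show ?thesis using col False by auto
  qed
  then show ?case by blast
qed auto

text \<open>Each matching edge \<open>{x, par x}\<close> is charged to a vertex of \<open>A\<close> that equals or is adjacent to \<open>x\<close>;
  that vertex is \<open>par x\<close>, \<open>x\<close> or a child of \<open>x\<close>, which makes the charging injective.\<close>

lemma induced_matching_le_dominating: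
  assumes V: "finite V" and G: "graph_on V E" and Ac: "acyclic_graph E"
    and M: "induced_matching E M" and A: "max_indep V E A"
  shows "card M \<le> card A"
proof -
  obtain X par where X: "E = (\<lambda>x. {x, par x}) ` X" using acyclic_graph_parent[OF V G Ac] by blast
  have ME: "M \<subseteq> E" using M by (simp add: induced_matching_def)
  have ind: "e = f" if "e \<in> M" "f \<in> M" "g \<in> E" "g \<inter> e \<noteq> {}" "g \<inter> f \<noteq> {}" for e f g
    using M that unfolding induced_matching_def by blast
  have "\<exists>x w. x \<in> X \<and> e = {x, par x} \<and> w \<in> A \<and> (w \<in> e \<or> w \<in> X \<and> par w = x)" if e: "e \<in> M" for e
  proof -
    obtain x where x: "x \<in> X" "e = {x, par x}" using e ME X by blast
    have "x \<in> V" using graph_onD[OF G, of x "par x"] x X by auto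
    show ?thesis
    proof (cases "x \<in> A")
      case False
      then obtain w where w: "w \<in> A" "{x, w} \<in> E" using A \<open>x \<in> V\<close> unfolding max_indep_def by blast
      then obtain y where "y \<in> X" "{x, w} = {y, par y}" using X by blast
      then have "w = par x \<or> w \<in> X \<and> par w = x" by (auto simp: doubleton_eq_iff)
      then show ?thesis using x w by blast
    qed (use x in blast)
  qed
  then obtain x w where xw: "\<And>e. e \<in> M \<Longrightarrow> e = {x e, par (x e)}" "\<And>e. e \<in> M \<Longrightarrow> w e \<in> A"
    "\<And>e. e \<in> M \<Longrightarrow> w e \<in> e \<or> w e \<in> X \<and> par (w e) = x e" by metis
  have "inj_on w M"
  proof (rule inj_onI)
    fix e f assume e: "e \<in> M" and f: "f \<in> M" and eq: "w e = w f"
    have xe: "x e \<in> e" "x f \<in> f" using xw(1) e f by blast+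
    \<comment> \<open>In each case some edge meets both \<open>e\<close> and \<open>f\<close>:
      either \<open>e\<close> itself or the edge from a child to its parent.\<close>
    consider "w e \<in> e" "w e \<in> f" | "w e \<in> X" "{w e, x e} \<in> E" "w e \<in> f \<or> x f = x e"
      | "w f \<in> X" "{w f, x f} \<in> E" "w f \<in> e"
      using xw(3)[OF e] xw(3)[OF f] eq X by fastforce
    then show "e = f"
    proof cases
      case 1
      then show ?thesis using ind[OF e f, of e] e ME by blast
    next
      case 2
      then have "{w e, x e} \<inter> f \<noteq> {}" using xe by auto
      moreover have "{w e, x e} \<inter> e \<noteq> {}" using xe by auto
      ultimately show ?thesis using ind[OF e f 2(2)] by blast
    next
      case 3
      then have "{w f, x f} \<inter> e \<noteq> {}" by auto
      moreover have "{w f, x f} \<inter> f \<noteq> {}" using xe by auto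
      ultimately show ?thesis using ind[OF e f 3(2)] by blast
    qed
  qed
  moreover have "finite A" using A V finite_subset by (auto simp: max_indep_def)
  ultimately show ?thesis using xw(2) by (intro card_inj_on_le[of w]) auto
qed

section \<open>Deleting a leaf edge, and deleting the closed neighbourhood of its inner
  vertex\<close>

locale leaf_edge =
  fixes V E u v N E1 E2
  assumes V: "finite V" and G: "graph_on V E" and leaf: "nbrs E u = {v}"
  defines "N \<equiv> nbrs E v" and "E1 \<equiv> E - {{u, v}}" and "E2 \<equiv> {e \<in> E. e \<inter> insert v (nbrs E v) = {}}"
begin

lemma uv: "{u, v} \<in> E" "{v, u} \<in> E" "u \<noteq> v" "u \<in> V" "v \<in> V" "u \<in> N" "v \<notin> N" "N \<subseteq> V"
proof -
  show uv: "{u, v} \<in> E" using leaf by (auto simp: nbrs_def)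
  then show "{v, u} \<in> E" by (simp add: insert_commute)
  then show "u \<noteq> v" "u \<in> V" "v \<in> V" "u \<in> N" "v \<notin> N" "N \<subseteq> V"
    using graph_onD[OF G] graph_onD[OF G, of v v] by (auto simp: N_def nbrs_def)
qed

lemma N_iff: "w \<in> N \<longleftrightarrow> {v, w} \<in> E" "w \<in> N \<longleftrightarrow> {w, v} \<in> E"
  using insert_commute[of v w "{}"] by (simp_all add: N_def nbrs_def)

lemma u_iff: "{u, w} \<in> E \<longleftrightarrow> w = v" "{w, u} \<in> E \<longleftrightarrow> w = v"
proof -
  show "{u, w} \<in> E \<longleftrightarrow> w = v" using leaf by (auto simp: nbrs_def)
  then show "{w, u} \<in> E \<longleftrightarrow> w = v" by (simp add: insert_commute[of w u])
qed

lemma mem_u: "e \<in> E \<Longrightarrow> u \<in> e \<longleftrightarrow> e = {u, v}"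
  using leaf_edge_iff[OF G leaf] .

lemma mem_v: "e \<in> E \<Longrightarrow> v \<in> e \<Longrightarrow> e \<subseteq> insert v N"
proof -
  assume e: "e \<in> E" "v \<in> e"
  obtain x y where "e = {x, y}" using graph_on_edgeE[OF G e(1)] by metis
  then obtain w where "e = {v, w}" using e(2) by auto
  then show ?thesis using e(1) N_iff by auto
qed

lemma E2_iff: "e \<in> E2 \<longleftrightarrow> e \<in> E \<and> e \<inter> insert v N = {}"
  by (simp add: E2_def N_def)

lemma E1_iff: "e \<in> E1 \<longleftrightarrow> e \<in> E \<and> e \<noteq> {u, v}"
  by (simp add: E1_def)

lemma card_V2: "card (V - insert v N) + card N + 1 = card V"
proof -
  have "finite N" using uv(8) V finite_subset by blast
  moreover have "insert v N \<subseteq> V" using uv by auto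
  ultimately show ?thesis using V uv(7) card_Diff_subset[of "insert v N" V] card_mono[of V "insert v N"]
    by simp
qed

lemma max_indep_link: "v \<in> A \<Longrightarrow> max_indep V E A \<Longrightarrow> max_indep (V - insert v N) E2 (A - {v})"
proof -
  assume v: "v \<in> A" and A: "max_indep V E A"
  have AN: "A \<inter> N = {}" using max_indepD(2)[OF A v] N_iff(1) by auto
  have "\<exists>a\<in>A - {v}. {w, a} \<in> E2" if w: "w \<in> V - insert v N - (A - {v})" for w
  proof -
    obtain a where a: "a \<in> A" "{w, a} \<in> E" using max_indepD(3)[OF A, of w] w by auto
    then have "a \<noteq> v" using w N_iff(2)[of w] by auto
    moreover have "w \<noteq> v" "w \<notin> N" "a \<notin> N" using w a AN by auto
    ultimately have "{w, a} \<in> E2" using a unfolding E2_iff by simp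
    then show ?thesis using a \<open>a \<noteq> v\<close> by blast
  qed
  then show ?thesis using A AN unfolding max_indep_def by (auto simp: E2_iff)
qed

lemma max_indep_extend_link:
  assumes "max_indep (V - insert v N) E2 A" shows "max_indep V E (insert v A)"
proof -
  have "\<not> e \<subseteq> insert v A" if e: "e \<in> E" for e
  proof
    assume s: "e \<subseteq> insert v A"
    have AN: "A \<inter> insert v N = {}" using assms by (auto simp: max_indep_def)
    show False
    proof (cases "v \<in> e")
      case True
      then have "e \<subseteq> {v}" using mem_v[OF e] s AN by blast
      then show False using e G graph_on_edgeE[OF G e] by (metis insert_subset singletonD)
    next
      case False
      then have "e \<in> E2" using e s AN by (auto simp: E2_iff)
      then show False using assms s False unfolding max_indep_def by blast
    qed
  qed
  moreover have "\<exists>a\<in>insert v A. {w, a} \<in> E" if w: "w \<in> V - insert v A" for w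
  proof (cases "w \<in> N")
    case False
    then show ?thesis using assms w unfolding max_indep_def E2_iff by blast
  qed (use N_iff in blast)
  ultimately show ?thesis using assms uv(5) unfolding max_indep_def by blast
qed

text \<open>If \<open>v\<close> is in \<open>A\<close>, removing it leaves a maximal independent set
  of G - N[v]. Otherwise the leaf \<open>u\<close> is in \<open>A\<close>. When \<open>v\<close> has
  another neighbour in \<open>A\<close>, domination survives in G - uv; when not, exchanging
  \<open>u\<close> for \<open>v\<close> keeps the size and leads back to the first case.\<close>

lemma max_indep_lower:
  assumes h1: "\<And>A. max_indep V E1 A \<Longrightarrow> card V \<le> p1 + card A"
    and h2: "\<And>A. max_indep (V - insert v N) E2 A \<Longrightarrow> card (V - insert v N) \<le> p2 + card A"
    and A: "max_indep V E A"
  shows "card V \<le> max p1 (p2 + card N) + card A"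
proof -
  have fin: "finite A" if "max_indep V E A" for A
    using that V finite_subset by (auto simp: max_indep_def)
  have in_v: "card V \<le> p2 + card N + card A" if A: "max_indep V E A" "v \<in> A" for A
    using h2[OF max_indep_link[OF A(2,1)]] card_V2 card_Suc_Diff1[OF fin[OF A(1)] A(2)] by simp
  show ?thesis
  proof (cases "v \<in> A")
    case True
    then show ?thesis using in_v[OF A] by simp
  next
    case False
    then have u: "u \<in> A" using max_indepD(3)[OF A uv(4)] u_iff(1) by auto
    show ?thesis
    proof (cases "\<exists>a\<in>A - {u}. {v, a} \<in> E")
      case True
      then obtain a where a: "a \<in> A" "a \<noteq> u" "{v, a} \<in> E" by blast
      have "\<exists>b\<in>A. {w, b} \<in> E1" if w: "w \<in> V - A" for w
      proof (cases "w = v")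
        case True
        then have "{w, a} \<in> E1" using a uv(3) unfolding E1_iff by (simp add: doubleton_eq_iff)
        then show ?thesis using a by blast
      next
        case False
        moreover obtain b where b: "b \<in> A" "{w, b} \<in> E" using max_indepD(3)[OF A, of w] w by auto
        moreover have "w \<noteq> u" using w u by blast
        ultimately have "{w, b} \<in> E1" unfolding E1_iff by (simp add: doubleton_eq_iff)
        then show ?thesis using b by blast
      qed
      then have "max_indep V E1 A" using A by (auto simp: max_indep_def E1_iff)
      then show ?thesis using h1 by fastforce
    next
      case F: False
      have "max_indep V E (insert v (A - {u}))"
        unfolding max_indep_def
      proof (intro conjI ballI)
        show "insert v (A - {u}) \<subseteq> V" using A uv by (auto simp: max_indep_def)
        show "\<not> e \<subseteq> insert v (A - {u})" if e: "e \<in> E" for e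
        proof
          assume s: "e \<subseteq> insert v (A - {u})"
          obtain x y where xy: "e = {x, y}" "x \<noteq> y" using graph_on_edgeE[OF G e] by metis
          show False
          proof (cases "v \<in> e")
            case True
            then obtain z where "e = {v, z}" "z \<noteq> v" using xy by auto
            then show False using F s e by auto
          next
            case False
            then show False using A e s unfolding max_indep_def by blast
          qed
        qed
        show "\<exists>a\<in>insert v (A - {u}). {w, a} \<in> E" if w: "w \<in> V - insert v (A - {u})" for w
        proof (cases "w = u")
          case False
          then obtain a where a: "a \<in> A" "{w, a} \<in> E" using max_indepD(3)[OF A, of w] w by auto
          then have "a \<noteq> u" using u_iff(2)[of w] w by auto
          then show ?thesis using a by blast
        qed (use uv in auto)
      qed
      from in_v[OF this] show ?thesis
        using False u fin[OF A] card_Suc_Diff1[OF fin[OF A] u] by simp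
    qed
  qed
qed

text \<open>In G - uv the vertex \<open>u\<close> is isolated, hence in \<open>A1\<close>. If
  \<open>v\<close> is in \<open>A1\<close> too, dropping \<open>u\<close> restores independence and
  \<open>v\<close> dominates \<open>u\<close>; if not, \<open>A1\<close> serves unchanged. When the
  other term of the maximum is larger, \<open>v\<close> is added to \<open>A2\<close>.\<close>

lemma max_indep_attained:
  assumes h1: "max_indep V E1 A1" "p1 + card A1 \<le> card V"
    and h2: "max_indep (V - insert v N) E2 A2" "p2 + card A2 \<le> card (V - insert v N)"
  shows "\<exists>A. max_indep V E A \<and> max p1 (p2 + card N) + card A \<le> card V"
proof (cases "p1 \<ge> p2 + card N")
  case True
  have u: "u \<in> A1"
  proof (rule ccontr)
    assume "u \<notin> A1"
    then obtain a where "{u, a} \<in> E1" using max_indepD(3)[OF h1(1) uv(4)] by auto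
    then show False using u_iff(1)[of a] by (auto simp: E1_iff)
  qed
  show ?thesis
  proof (cases "v \<in> A1")
    case v: True
    have "\<exists>b\<in>A1 - {u}. {w, b} \<in> E" if w: "w \<in> V - (A1 - {u})" for w
    proof (cases "w = u")
      case False
      then obtain b where b: "b \<in> A1" "{w, b} \<in> E1" using max_indepD(3)[OF h1(1), of w] w by auto
      then have "{w, b} \<in> E" "{w, b} \<noteq> {u, v}" by (simp_all add: E1_iff)
      then have "b \<noteq> u" using u_iff(2) by (metis insert_commute)
      then show ?thesis using b by (auto simp: E1_iff)
    qed (use v uv in auto)
    moreover have "\<not> e \<subseteq> A1 - {u}" if "e \<in> E" for e
    proof (cases "e = {u, v}")
      case False
      then have "e \<in> E1" using that by (simp add: E1_iff)
      then show ?thesis using h1(1) unfolding max_indep_def by blast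
    qed simp
    ultimately have "max_indep V E (A1 - {u})" using h1(1) by (auto simp: max_indep_def)
    moreover have "card (A1 - {u}) \<le> card A1" by (simp add: card_Diff1_le)
    ultimately show ?thesis using h1(2) True by (intro exI[of _ "A1 - {u}"]) auto
  next
    case False
    have "max_indep V E A1"
      unfolding max_indep_def
    proof (intro conjI ballI)
      show "\<not> e \<subseteq> A1" if "e \<in> E" for e
      proof (cases "e = {u, v}")
        case False
        then have "e \<in> E1" using that by (simp add: E1_iff)
        then show ?thesis using h1(1) unfolding max_indep_def by blast
      qed (use False in simp)
      show "\<exists>a\<in>A1. {w, a} \<in> E" if "w \<in> V - A1" for w
        using max_indepD(3)[OF h1(1), of w] that by (auto simp: E1_iff)
    qed (rule max_indepD(1)[OF h1(1)])
    then show ?thesis using h1(2) True by (intro exI[of _ A1]) auto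
  qed
next
  case False
  have "finite A2" "v \<notin> A2" using h2(1) V finite_subset[of A2 V] by (auto simp: max_indep_def)
  then show ?thesis
    using max_indep_extend_link[OF h2(1)] h2(2) card_V2 False by (intro exI[of _ "insert v A2"]) auto
qed

text \<open>A matching edge at \<open>v\<close> keeps all other matching edges out of N[v], through
  the edges {v, w}; removing it leaves a matching of G - N[v]. If \<open>v\<close> is uncovered, the
  leaf edge is not in \<open>M\<close>.\<close>

lemma induced_matching_upper:
  assumes h1: "\<And>M. induced_matching E1 M \<Longrightarrow> card M \<le> r1"
    and h2: "\<And>M. induced_matching E2 M \<Longrightarrow> card M \<le> r2"
    and M: "induced_matching E M"
  shows "card M \<le> max r1 (r2 + 1)"
proof -
  have ME: "M \<subseteq> E" using M by (simp add: induced_matching_def)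
  have ind: "e = f" if "e \<in> M" "f \<in> M" "g \<in> E" "g \<inter> e \<noteq> {}" "g \<inter> f \<noteq> {}" for e f g
    using M that unfolding induced_matching_def by blast
  show ?thesis
  proof (cases "\<exists>e\<in>M. v \<in> e")
    case True
    then obtain e where e: "e \<in> M" "v \<in> e" by blast
    have "f \<in> E2" if f: "f \<in> M" "f \<noteq> e" for f
    proof -
      have "w \<notin> f" if "w \<in> insert v N" for w
      proof
        assume wf: "w \<in> f"
        have "e = f"
        proof (cases "w = v")
          case True
          then show ?thesis using ind[OF e(1) f(1), of e] e ME wf by blast
        next
          case False
          then show ?thesis using ind[OF e(1) f(1), of "{v, w}"] e that wf N_iff by blast
        qed
        then show False using f by simp
      qed
      then show ?thesis using f ME by (auto simp: E2_iff)
    qed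
    then have "M - {e} \<subseteq> E2" by blast
    then have "induced_matching E2 (M - {e})"
    proof (rule induced_matchingI)
      fix e' f g assume "e' \<in> M - {e}" "f \<in> M - {e}" "g \<in> E2" "g \<inter> e' \<noteq> {}" "g \<inter> f \<noteq> {}"
      then show "e' = f" using ind[of e' f g] by (simp add: E2_iff)
    qed
    moreover have "finite M" using graph_on_finite[OF V G] ME finite_subset by blast
    ultimately show ?thesis using h2 card_Suc_Diff1[OF _ e(1)] by fastforce
  next
    case False
    then have "M \<subseteq> E1" using ME by (auto simp: E1_iff)
    then have "induced_matching E1 M"
    proof (rule induced_matchingI)
      fix e f g assume "e \<in> M" "f \<in> M" "g \<in> E1" "g \<inter> e \<noteq> {}" "g \<inter> f \<noteq> {}"
      then show "e = f" using ind[of e f g] by (simp add: E1_iff)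
    qed
    then show ?thesis using h1 by fastforce
  qed
qed

text \<open>No edge of \<open>M1\<close> contains \<open>u\<close>, so those meeting uv meet it in
  \<open>v\<close> and coincide; hence \<open>M1\<close> stays induced in G. Edges touching
  \<open>u\<close> or \<open>v\<close> stay inside N[v], which \<open>M2\<close> avoids, so uv can
  be added to \<open>M2\<close>.\<close>

lemma induced_matching_attained:
  assumes h1: "induced_matching E1 M1" and h2: "induced_matching E2 M2"
  shows "\<exists>M. induced_matching E M \<and> max (card M1) (card M2 + 1) \<le> card M"
proof (cases "card M1 \<ge> card M2 + 1")
  case True
  have "e = f" if e: "e \<in> M1" and f: "f \<in> M1" and g: "g \<in> E" "g \<inter> e \<noteq> {}" "g \<inter> f \<noteq> {}" for e f g
  proof (cases "g = {u, v}")
    case True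
    have "e \<in> E1" "f \<in> E1" using h1 e f by (auto simp: induced_matching_def)
    then have "u \<notin> e" "u \<notin> f" using mem_u by (auto simp: E1_iff)
    then have "v \<in> e" "v \<in> f" using True g by auto
    then show ?thesis using induced_matchingD(2)[OF h1 e f \<open>e \<in> E1\<close>] by auto
  next
    case False
    then have "g \<in> E1" using g by (simp add: E1_iff)
    then show ?thesis using induced_matchingD(2)[OF h1 e f] g by simp
  qed
  moreover have "M1 \<subseteq> E" using induced_matchingD(1)[OF h1] by (auto simp: E1_iff)
  ultimately have "induced_matching E M1" by (intro induced_matchingI) auto
  then show ?thesis using True by auto
next
  case False
  have M2: "M2 \<subseteq> E2" using h2 by (simp add: induced_matching_def)
  have uvM: "g \<inter> f = {}" if "f \<in> M2" "g \<in> E" "g \<inter> {u, v} \<noteq> {}" for f g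
  proof -
    have "f \<inter> insert v N = {}" using that(1) M2 E2_iff by blast
    moreover have "g \<subseteq> insert v N"
      using that(2,3) mem_u[OF that(2)] mem_v[OF that(2)] by auto
    ultimately show ?thesis by blast
  qed
  have M2M2: "e = f" if e: "e \<in> M2" and f: "f \<in> M2" and g: "g \<in> E" "g \<inter> e \<noteq> {}" "g \<inter> f \<noteq> {}" for e f g
  proof -
    have d: "e \<inter> insert v N = {}" "f \<inter> insert v N = {}" "e \<in> E2" using e f M2 E2_iff by blast+
    show ?thesis
    proof (cases "e \<inter> f = {}")
      case True
      obtain x y where xy: "g = {x, y}" using graph_on_edgeE[OF G g(1)] by metis
      \<comment> \<open>A connecting edge has one endpoint in each, so it avoids N[v] as they do and
        already belongs to \<open>E2\<close>.\<close>
      have "g \<subseteq> e \<union> f" using g(2,3) True xy by auto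
      then have "g \<in> E2" using g(1) d by (auto simp: E2_iff)
      then show ?thesis using induced_matchingD(2)[OF h2 e f] g by simp
    next
      case False
      then show ?thesis using induced_matchingD(2)[OF h2 e f d(3)] by auto
    qed
  qed
  have "induced_matching E (insert {u, v} M2)"
  proof (rule induced_matchingI)
    show "insert {u, v} M2 \<subseteq> E" using M2 uv E2_iff by blast
    fix e f g assume "e \<in> insert {u, v} M2" "f \<in> insert {u, v} M2" "g \<in> E" "g \<inter> e \<noteq> {}" "g \<inter> f \<noteq> {}"
    then show "e = f" using uvM M2M2 by blast
  qed
  moreover have "{u, v} \<notin> M2" using M2 by (auto simp: E2_iff)
  moreover have "finite M2"
    using M2 graph_on_finite[OF V G] finite_subset[of M2 E] by (auto simp: E2_def)
  ultimately show ?thesis using False by (intro exI[of _ "insert {u, v} M2"]) auto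
qed

text \<open>An edge of G - uv dividing v times a monomial either avoids N[v] or contains a neighbour
  of \<open>v\<close> other than \<open>u\<close>; that neighbour then divides the monomial
  itself.\<close>

lemma colon_link: "k \<in> up (E2 \<union> (\<lambda>w. {w}) ` (N - {u})) \<longleftrightarrow> Poly_Mapping.single v 1 + k \<in> up E1"
proof
  assume "k \<in> up (E2 \<union> (\<lambda>w. {w}) ` (N - {u}))"
  then consider h where "h \<in> E2" "h \<subseteq> supp k" | w where "w \<in> N" "w \<noteq> u" "w \<in> supp k"
    by (auto simp: up_def)
  then show "Poly_Mapping.single v 1 + k \<in> up E1"
  proof cases
    case 1
    then show ?thesis by (auto simp: up_def supp_add_nat E2_iff E1_iff)
  next
    case 2
    then have "{v, w} \<in> E1" using uv by (auto simp: E1_iff N_iff doubleton_eq_iff)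
    moreover have "{v, w} \<subseteq> supp (Poly_Mapping.single v 1 + k)" using 2 by (simp add: supp_add_nat)
    ultimately show ?thesis unfolding up_def by blast
  qed
next
  assume "Poly_Mapping.single v 1 + k \<in> up E1"
  then obtain h where h: "h \<in> E1" "h \<subseteq> insert v (supp k)" by (auto simp: up_def supp_add_nat)
  have hE: "h \<in> E" and hu: "u \<notin> h" using h(1) mem_u by (auto simp: E1_iff)
  show "k \<in> up (E2 \<union> (\<lambda>w. {w}) ` (N - {u}))"
  proof (cases "h \<inter> insert v N = {}")
    case True
    then have "h \<in> E2" "h \<subseteq> supp k" using h(2) hE by (auto simp: E2_iff)
    then show ?thesis unfolding up_def by blast
  next
    case False
    have "\<exists>w\<in>h. w \<in> N"
    proof (cases "v \<in> h")
      case True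
      obtain x y where "h = {x, y}" "x \<noteq> y" using graph_on_edgeE[OF G hE] by metis
      then show ?thesis using mem_v[OF hE True] True by auto
    qed (use False in blast)
    then obtain w where w: "w \<in> h" "w \<in> N" by blast
    then have "w \<in> supp k" "w \<noteq> u" using h hu uv(7) by auto
    then show ?thesis using w by (auto simp: up_def)
  qed
qed

end

text \<open>Resolution and graph invariants share one induction because their recursions agree term
  by term. \<open>V\<close> varies with \<open>E\<close>: G - uv keeps all vertices, while G - N[v]
  loses N[v].\<close>

lemma forest_resolves:
  assumes "finite V" "graph_on V E" "acyclic_graph E" "V \<subseteq> {1..n}"
  shows "\<exists>p r. resolves (K :: 'k::field itself) n E p (int r) \<and>
    (\<forall>A. max_indep V E A \<longrightarrow> card V \<le> p + card A) \<and> (\<exists>A. max_indep V E A \<and> p + card A \<le> card V) \<and>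
    (\<forall>M. induced_matching E M \<longrightarrow> card M \<le> r) \<and> (\<exists>M. induced_matching E M \<and> r \<le> card M)"
  using assms
proof (induction "card E" arbitrary: V E rule: less_induct)
  case less
  note V = less.prems(1) and G = less.prems(2) and Ac = less.prems(3) and Vn = less.prems(4)
  show ?case
  proof (cases "E = {}")
    case True
    have "max_indep V {} A \<longleftrightarrow> A = V" for A by (auto simp: max_indep_def)
    moreover have "induced_matching {} M \<longleftrightarrow> M = {}" for M by (auto simp: induced_matching_def)
    ultimately show ?thesis using resolves_empty[of K n] unfolding True
      by (intro exI[of _ 0]) simp
  next
    case False
    then obtain u v where uv: "nbrs E u = {v}" using acyclic_graph_leaf[OF V G Ac] by blast
    define W where "W = nbrs E v"
    define F1 where "F1 = E - {{u, v}}"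
    define F2 where "F2 = {e \<in> E. e \<inter> insert v W = {}}"
    interpret leaf_edge V E u v "nbrs E v" "E - {{u, v}}" "{e \<in> E. e \<inter> insert v (nbrs E v) = {}}"
      by unfold_locales (fact V G uv refl)+
    have finE: "finite E" by (rule graph_on_finite[OF V G])
    have sub: "F1 \<subseteq> E" "F2 \<subseteq> E" by (auto simp: F1_def F2_def)
    have F1: "card F1 < card E" unfolding F1_def using uv(1) finE by (intro psubset_card_mono) auto
    have "{u, v} \<notin> F2" by (auto simp: F2_def)
    then have F2: "card F2 < card E" using sub(2) uv(1) finE by (intro psubset_card_mono) auto
    have "graph_on V F1" "acyclic_graph F1"
      using graph_on_subset[OF G sub(1)] acyclic_graph_subset[OF Ac sub(1)] by auto
    from less.hyps[OF F1 V this Vn]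
    obtain p1 r1 A1 M1 where IH1: "resolves K n F1 p1 (int r1)"
      "\<And>A. max_indep V F1 A \<Longrightarrow> card V \<le> p1 + card A" "max_indep V F1 A1" "p1 + card A1 \<le> card V"
      "\<And>M. induced_matching F1 M \<Longrightarrow> card M \<le> r1" "induced_matching F1 M1" "r1 \<le> card M1" by blast
    let ?V2 = "V - insert v W"
    have "finite ?V2" "graph_on ?V2 F2" "?V2 \<subseteq> {1..n}"
      using V G Vn unfolding graph_on_def F2_def by auto
    from less.hyps[OF F2 this(1,2) acyclic_graph_subset[OF Ac sub(2)] this(3)]
    obtain p2 r2 A2 M2 where IH2: "resolves K n F2 p2 (int r2)"
      "\<And>A. max_indep ?V2 F2 A \<Longrightarrow> card ?V2 \<le> p2 + card A" "max_indep ?V2 F2 A2" "p2 + card A2 \<le> card ?V2"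
      "\<And>M. induced_matching F2 M \<Longrightarrow> card M \<le> r2" "induced_matching F2 M2" "r2 \<le> card M2" by blast
    have finN: "finite W" using uv(8) V finite_subset unfolding W_def by blast
    have "resolves K n (F2 \<union> (\<lambda>w. {w}) ` (W - {u})) (p2 + card (W - {u})) (int r2)"
      using finN uv(8) Vn IH2(1) by (intro resolves_union_singletons) (auto simp: W_def F2_def)
    moreover have "k \<in> up (F2 \<union> (\<lambda>w. {w}) ` (W - {u})) \<longleftrightarrow> Poly_Mapping.single v 1 + k \<in> up F1" for k
      unfolding W_def F1_def F2_def by (rule colon_link)
    moreover have "u \<notin> h" if "h \<in> F1" for h using that mem_u by (auto simp: F1_def)
    ultimately have "resolves K n (insert {u, v} F1) (max p1 (p2 + card (W - {u}) + 1)) (max (int r1) (int r2 + 1))"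
      using uv Vn by (intro resolves_insert_edge[OF IH1(1)]) auto
    moreover have "insert {u, v} F1 = E" using uv(1) by (auto simp: F1_def)
    \<comment> \<open>\<open>u\<close> is not among the adjoined variables; the cone supplies the
      missing 1.\<close>
    moreover have "p2 + card (W - {u}) + 1 = p2 + card W"
      using card_Suc_Diff1[OF finN, of u] uv(6) by (simp add: W_def)
    ultimately have R: "resolves K n E (max p1 (p2 + card W)) (int (max r1 (r2 + 1)))"
      by (simp only: of_nat_max of_nat_add of_nat_1)
    have "\<exists>M. induced_matching E M \<and> max r1 (r2 + 1) \<le> card M"
      using induced_matching_attained[OF IH1(6)[unfolded F1_def] IH2(6)[unfolded F2_def W_def]] IH1(7) IH2(7)
      by (metis (no_types, lifting) add_le_mono1 max.mono order_trans)
    moreover have "card M \<le> max r1 (r2 + 1)" if "induced_matching E M" for M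
      using induced_matching_upper[OF IH1(5)[unfolded F1_def] IH2(5)[unfolded F2_def W_def] that] .
    moreover have "\<exists>A. max_indep V E A \<and> max p1 (p2 + card W) + card A \<le> card V"
      using max_indep_attained[OF IH1(3)[unfolded F1_def] IH1(4) IH2(3)[unfolded F2_def W_def]
          IH2(4)[unfolded W_def]] unfolding W_def .
    moreover have "card V \<le> max p1 (p2 + card W) + card A" if "max_indep V E A" for A
      using max_indep_lower[OF IH1(2)[unfolded F1_def] IH2(2)[unfolded F2_def W_def] that] unfolding W_def .
    ultimately show ?thesis using R by blast
  qed
qed

lemma tree_resolves:
  assumes "E \<in> TREE n"
  obtains p r A M where "resolves (K :: 'k::field itself) n E p (int r)"
    "\<And>A. max_indep {1..n} E A \<Longrightarrow> n \<le> p + card A" "max_indep {1..n} E A" "p + card A \<le> n"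
    "\<And>M. induced_matching E M \<Longrightarrow> card M \<le> r" "induced_matching E M" "r = card M"
    "proj_dim n (quotient_module n (edge_ideal n E :: 'k mpoly set)) = int p"
    "regularity n (quotient_module n (edge_ideal n E :: 'k mpoly set)) = int r"
proof -
  have sg: "simple_graph n E" and G: "graph_on {1..n} E" and Ac: "acyclic_graph E"
    using assms by (auto simp: TREE_def simple_graph_def graph_on_def acyclic_graph_def)
  obtain p r A M where *: "resolves K n E p (int r)"
    "\<And>A. max_indep {1..n} E A \<Longrightarrow> n \<le> p + card A" "max_indep {1..n} E A" "p + card A \<le> n"
    "\<And>M. induced_matching E M \<Longrightarrow> card M \<le> r" "induced_matching E M" "r \<le> card M"
    using forest_resolves[OF _ G Ac subset_refl, of K] by auto
  note pr = proj_dim_regularity_of_resolves[OF *(1), folded edge_ideal_eq_mon_ideal[OF sg]]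
  show ?thesis using that[OF *(1-6) _ pr] *(5)[OF *(6)] *(7) by simp
qed

section \<open>Trees\<close>

lemma tree_neighbour:
  assumes "E \<in> TREE n" "n \<ge> 2" "v \<in> {1..n}"
  shows "\<exists>w\<in>{1..n}. {v, w} \<in> E"
proof -
  have G: "graph_on {1..n} E" using assms by (auto simp: TREE_def simple_graph_def graph_on_def)
  obtain w where w: "w \<in> {1..n}" "w \<noteq> v"
    using assms(2) by (cases "v = 1") (auto intro: that[of 1] that[of 2])
  then have "(v, w) \<in> {(a, b). {a, b} \<in> E}\<^sup>*"
    using assms by (auto simp: TREE_def graph_connected_def)
  then obtain x where "{v, x} \<in> E" using w(2) by (auto elim: converse_rtranclE)
  then show ?thesis using graph_onD[OF G] by blast
qed

lemma tree_bounds: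
  assumes T: "E \<in> TREE n" and n: "n \<ge> 3"
    and A: "max_indep {1..n} E A" "p + card A \<le> n"
    and pl: "\<And>A. max_indep {1..n} E A \<Longrightarrow> n \<le> p + card A"
    and rl: "\<And>M. induced_matching E M \<Longrightarrow> card M \<le> r" and M: "induced_matching E M" "r = card M"
  shows "1 \<le> r" "2 * r < n" "n \<le> 2 * p" "p + r \<le> n"
proof -
  have G: "graph_on {1..n} E" and Ac: "acyclic_graph E"
    using T by (auto simp: TREE_def simple_graph_def graph_on_def acyclic_graph_def)
  obtain w where w: "{1, w} \<in> E" using tree_neighbour[OF T, of 1] n by auto
  then have "induced_matching E {{1, w}}" by (intro induced_matchingI) auto
  from rl[OF this] show "1 \<le> r" by simp
  show "p + r \<le> n"
    using induced_matching_le_dominating[OF _ G Ac M(1) A(1)] A(2) M(2) by simp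
  show "n \<le> 2 * p"
  proof -
    obtain col :: "nat \<Rightarrow> bool" where col: "\<And>a b. {a, b} \<in> E \<Longrightarrow> col a \<noteq> col b"
      using acyclic_graph_2_colouring[OF _ G Ac] by auto
    \<comment> \<open>Every vertex has a neighbour, necessarily of the other colour, so each colour
      class dominates its complement.\<close>
    have mi: "max_indep {1..n} E {v \<in> {1..n}. col v = c}" for c
      unfolding max_indep_def
    proof (intro conjI ballI)
      show "\<not> e \<subseteq> {v \<in> {1..n}. col v = c}" if e: "e \<in> E" for e
      proof -
        obtain x y where "e = {x, y}" using graph_on_edgeE[OF G e] by metis
        then show ?thesis using col[of x y] e by auto
      qed
      fix v assume v: "v \<in> {1..n} - {v \<in> {1..n}. col v = c}"
      then obtain x where "x \<in> {1..n}" "{v, x} \<in> E" using tree_neighbour[OF T _, of v] n by fastforce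
      then show "\<exists>a\<in>{v \<in> {1..n}. col v = c}. {v, a} \<in> E" using col[of v x] v by auto
    qed auto
    have "card {v \<in> {1..n}. col v = True} + card {v \<in> {1..n}. col v = False} = card {1..n}"
      by (subst card_Un_disjoint[symmetric]) (auto intro!: arg_cong[where f = card] simp del: card_atLeastAtMost)
    then show ?thesis using pl[OF mi[of True]] pl[OF mi[of False]] by simp
  qed
  show "2 * r < n"
  proof (rule ccontr)
    assume "\<not> 2 * r < n"
    have ME: "M \<subseteq> E" by (rule induced_matchingD(1)[OF M(1)])
    have c2: "card e = 2" "e \<subseteq> {1..n}" if "e \<in> M" for e using that ME G by (auto simp: graph_on_def)
    have dis: "e \<inter> f = {}" if "e \<in> M" "f \<in> M" "e \<noteq> f" for e f
      using induced_matchingD(2)[OF M(1) that(1,2), of e] that ME c2[OF that(1)] by auto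
    have "card (\<Union>M) = (\<Sum>e\<in>M. card e)"
      using dis finite_subset[OF c2(2)]
      by (intro card_Union_disjoint) (auto simp: pairwise_def disjnt_def)
    also have "\<dots> = 2 * r" using c2 M(2) by simp
    finally have "\<Union>M = {1..n}"
      using c2 \<open>\<not> 2 * r < n\<close> by (intro card_seteq) auto
    moreover have "1 \<in> {1..n}" using n by simp
    ultimately obtain e where e: "e \<in> M" "1 \<in> e" by blast
    \<comment> \<open>A neighbour of a vertex of \<open>e\<close> is covered by some matching edge,
      and the connecting edge meets both, so they coincide. Thus \<open>e\<close> would be a whole
      component with only two vertices.\<close>
    have closed: "y \<in> e" if "x \<in> e" "{x, y} \<in> E" for x y
    proof -
      have "y \<in> \<Union>M" using graph_onD[OF G that(2)] \<open>\<Union>M = {1..n}\<close> by blast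
      then obtain f where f: "f \<in> M" "y \<in> f" by blast
      then show ?thesis using induced_matchingD(2)[OF M(1) e(1) f(1) that(2)] that(1) by auto
    qed
    have "y \<in> e" if "(1, y) \<in> {(a, b). {a, b} \<in> E}\<^sup>*" for y
      using that by (induction rule: rtrancl_induct) (use e closed in auto)
    then have "{1..n} \<subseteq> e"
      using T n by (auto simp: TREE_def graph_connected_def)
    then have "n \<le> card e" using card_mono[of e "{1..n}"] c2[OF e(1)] by (metis card_atLeastAtMost diff_Suc_1 finite_atLeastAtMost finite_subset)
    then show False using c2[OF e(1)] n by simp
  qed
qed

section \<open>Trees given by parent functions, and the realizing family\<close>

lemma parent_tree:
  assumes n: "n \<ge> 1" and par: "\<And>x. x \<in> {2..n} \<Longrightarrow> par x \<in> {1..<x}"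
  shows "(\<lambda>x. {x, par x}) ` {2..n} \<in> TREE n"
proof -
  let ?E = "(\<lambda>x. {x, par x}) ` {2..n}"
  have "simple_graph n ?E"
    unfolding simple_graph_def
  proof clarify
    fix x assume x: "x \<in> {2..n}"
    then show "{x, par x} \<subseteq> {1..n} \<and> card {x, par x} = 2" using par[OF x] by auto
  qed
  moreover have "graph_connected n ?E"
  proof -
    let ?R = "{(a, b). {a, b} \<in> ?E}"
    have s: "sym (?R\<^sup>*)" by (intro sym_rtrancl) (auto simp: sym_def insert_commute)
    have root: "(u, 1) \<in> ?R\<^sup>*" if "u \<in> {1..n}" for u
      using that
    proof (induction u rule: less_induct)
      case (less u)
      show ?case
      proof (cases "u = 1")
        case False
        then have "u \<in> {2..n}" using less.prems by auto
        then have "(u, par u) \<in> ?R" "(par u, 1) \<in> ?R\<^sup>*" using par[of u] less.IH[of "par u"] by auto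
        then show ?thesis by (rule converse_rtrancl_into_rtrancl)
      qed simp
    qed
    show ?thesis unfolding graph_connected_def
      using root s by (meson rtrancl_trans symD)
  qed
  moreover have "\<not> is_cycle ?E xs" for xs
  proof
    assume "is_cycle ?E xs"
    then have L: "3 \<le> length xs" and d: "distinct xs"
      and step: "\<And>k. Suc k < length xs \<Longrightarrow> {xs ! k, xs ! Suc k} \<in> ?E" and close: "{last xs, hd xs} \<in> ?E"
      by (auto simp: is_cycle_def)
    \<comment> \<open>Parents have smaller labels, so both cycle neighbours of the vertex with the
      largest label would be its parent, against distinctness.\<close>
    define m where "m = Max (set xs)"
    have "m \<in> set xs" unfolding m_def using L by (intro Max_in) auto
    then obtain k where k: "k < length xs" "xs ! k = m" by (auto simp: in_set_conv_nth)
    have le: "xs ! j \<le> m" if "j < length xs" for j using that unfolding m_def by auto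
    have par_m: "xs ! j = par m" if j: "j < length xs" and e: "{xs ! k, xs ! j} \<in> ?E" for j
    proof -
      obtain x where x: "x \<in> {2..n}" "{m, xs ! j} = {x, par x}" using e k(2) by auto
      then show ?thesis using par[OF x(1)] le[OF j] by (auto simp: doubleton_eq_iff)
    qed
    have ends: "hd xs = xs ! 0" "last xs = xs ! (length xs - 1)"
      using L hd_conv_nth[of xs] last_conv_nth[of xs] by fastforce+
    have sw: "{a, b} \<in> ?E \<Longrightarrow> {b, a} \<in> ?E" for a b by (simp only: insert_commute[of b a])
    obtain i j where ij: "i < length xs" "j < length xs" "i \<noteq> j" "{xs ! k, xs ! i} \<in> ?E" "{xs ! k, xs ! j} \<in> ?E"
    proof -
      consider "k = 0" | "k = length xs - 1" "k \<noteq> 0" | "k \<noteq> 0" "Suc k < length xs" using k by linarith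
      then show ?thesis
      proof cases
        case 1
        then show ?thesis using that[of 1 "length xs - 1"] L step[of 0] sw[OF close] ends by auto
      next
        case 2
        then have "Suc (k - 1) = k" by simp
        then have "{xs ! k, xs ! (k - 1)} \<in> ?E" using sw[OF step[of "k - 1"]] k(1) by simp
        moreover have "{xs ! k, xs ! 0} \<in> ?E" using close 2 ends by simp
        moreover have "0 < length xs" "0 \<noteq> k - 1" "k - 1 < length xs" using L 2 by auto
        ultimately show ?thesis using that by blast
      next
        case 3
        then show ?thesis using that[of "Suc k" "k - 1"] sw[OF step[of "k - 1"]] step[of k] by auto
      qed
    qed
    then have "xs ! i = xs ! j" using par_m by metis
    then show False using ij d by (simp add: nth_eq_iff_index_eq)
  qed
  ultimately show ?thesis by (simp add: TREE_def)
qed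

text \<open>The tree realizing a pair \<open>(p, r)\<close>, with \<open>k = n - p - r\<close>: the root 1 has the children
  \<open>2, \<dots>, r + 1 + k\<close>; each of \<open>3, \<dots>, r + 1\<close> has one leaf, and all remaining vertices are leaves at 2.\<close>

definition broom_parent :: "nat \<Rightarrow> nat \<Rightarrow> nat \<Rightarrow> nat" where
  "broom_parent r k x = (if x \<le> r + 1 + k then 1 else if x \<le> 2 * r + k then x - (r - 1 + k) else 2)"

text \<open>With k = n - p - r, \<open>nk\<close> says n \<le> 2 p and \<open>nr\<close> says r < p;
  the latter provides at least one leaf at vertex 2.\<close>

locale broom =
  fixes n r k :: nat
  assumes r: "1 \<le> r" and nr: "2 * r + k + 1 \<le> n" and nk: "2 * (r + k) \<le> n"
begin

abbreviation par where "par \<equiv> broom_parent r k"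

definition E where "E = (\<lambda>x. {x, par x}) ` {2..n}"

lemma par_less: "x \<in> {2..n} \<Longrightarrow> par x \<in> {1..<x}"
  using r by (auto simp: broom_parent_def)

lemma tree: "E \<in> TREE n"
  unfolding E_def using nr by (intro parent_tree par_less) auto

lemma edge_iff: "{x, y} \<in> E \<longleftrightarrow> x \<in> {2..n} \<and> y = par x \<or> y \<in> {2..n} \<and> x = par y"
  unfolding E_def by (auto simp: doubleton_eq_iff)

lemma par_le: "par x \<le> r + 1"
  using r by (auto simp: broom_parent_def)

lemma par_eq_1: "x \<in> {2..n} \<Longrightarrow> par x = 1 \<longleftrightarrow> x \<le> r + 1 + k"
  using r by (auto simp: broom_parent_def)

text \<open>Every edge has an endpoint that is 1 or adjacent to 1, so a matching edge at 1 excludes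
  all others. Without one, each matching edge contains one of the r inner vertices 2, ..., r +
  1.\<close>

lemma induced_matching_le:
  assumes M: "induced_matching E M" shows "card M \<le> r"
proof (cases "\<exists>e\<in>M. 1 \<in> e")
  case True
  then obtain e where e: "e \<in> M" "1 \<in> e" by blast
  have "f = e" if f: "f \<in> M" for f
  proof -
    have fE: "f \<in> E" using f induced_matchingD(1)[OF M] by blast
    then obtain z where z: "z \<in> {2..n}" "f = {z, par z}" by (auto simp: E_def)
    show ?thesis
    proof (cases "par z = 1")
      case True
      then show ?thesis using induced_matchingD(2)[OF M e(1) f fE] e z by auto
    next
      case False
      then have "par z \<in> {2..n}" "par (par z) = 1"
        using par_less[OF z(1)] par_le[of z] z(1) by (auto simp: broom_parent_def[of r k "par z"])
      then have "{par z, 1} \<in> E" by (simp add: edge_iff)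
      then show ?thesis using induced_matchingD(2)[OF M e(1) f, of "{par z, 1}"] e z by auto
    qed
  qed
  then have "M \<subseteq> {e}" by blast
  then have "card M \<le> 1" using card_mono[of "{e}" M] by simp
  then show ?thesis using r by simp
next
  case False
  have "\<exists>x\<in>e. x \<in> {2..r + 1}" if e: "e \<in> M" for e
  proof -
    obtain z where z: "z \<in> {2..n}" "e = {z, par z}"
      using e induced_matchingD(1)[OF M] by (auto simp: E_def)
    then have "par z \<noteq> 1" using False e by auto
    then show ?thesis using z par_less[OF z(1)] par_le[of z] by auto
  qed
  then obtain x where x: "\<And>e. e \<in> M \<Longrightarrow> x e \<in> e" "\<And>e. e \<in> M \<Longrightarrow> x e \<in> {2..r + 1}" by metis
  have "inj_on x M"
  proof (rule inj_onI)
    fix e f assume "e \<in> M" "f \<in> M" "x e = x f"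
    then show "e = f"
      using induced_matchingD(2)[OF M, of e f e] x(1)[of e] x(1)[of f] induced_matchingD(1)[OF M] by auto
  qed
  then have "card M \<le> card {2..r + 1}" using x(2) by (intro card_inj_on_le[of x]) auto
  then show ?thesis by simp
qed

lemma induced_matching_ex: "\<exists>M. induced_matching E M \<and> card M = r"
proof -
  \<comment> \<open>One leaf below each of 2, ..., r + 1; below 2 the leaf \<open>n\<close> is
    picked.\<close>
  define Y where "Y = insert n {r + 2 + k..2 * r + k}"
  have Y: "Y \<subseteq> {2..n}" using nr r by (auto simp: Y_def)
  \<comment> \<open>Sends a covered vertex to the leaf of its matching edge. As 1 is uncovered, an
    edge between covered vertices is itself a matching edge, and \<open>own\<close> is constant on
    it.\<close>
  define own where "own w = (if w = 2 then n else if w \<le> r + 1 then w + (r - 1 + k) else w)" for w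
  have own: "own w = x" if "x \<in> Y" "w \<in> {x, par x}" for x w
    using that nr r by (auto simp: Y_def own_def broom_parent_def split: if_splits)
  let ?M = "(\<lambda>x. {x, par x}) ` Y"
  have "induced_matching E ?M"
  proof (rule induced_matchingI)
    show "?M \<subseteq> E" using Y by (auto simp: E_def)
    fix e f g assume ef: "e \<in> ?M" "f \<in> ?M" and g: "g \<in> E" "g \<inter> e \<noteq> {}" "g \<inter> f \<noteq> {}"
    obtain x y where x: "x \<in> Y" "e = {x, par x}" and y: "y \<in> Y" "f = {y, par y}" using ef by blast
    obtain a b where a: "a \<in> g" "a \<in> e" and b: "b \<in> g" "b \<in> f" using g by blast
    obtain z where z: "z \<in> {2..n}" "g = {z, par z}" using g(1) by (auto simp: E_def)
    have not1: "1 \<notin> {w, par w}" if "w \<in> Y" for w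
      using that nr r by (auto simp: Y_def broom_parent_def)
    have own_par: "own (par z) = own z" if "par z \<noteq> 1" "w \<in> Y" "z \<in> {w, par w}" for w
    proof -
      have "z \<in> Y"
        using that z(1) nr r par_le[of w] by (auto simp: Y_def broom_parent_def split: if_splits)
      then show ?thesis using own[of z "par z"] own[of z z] by simp
    qed
    have "own a = own b"
    proof (cases "a = b")
      case False
      then consider "a = z" "b = par z" | "a = par z" "b = z" using a b z by auto
      then show ?thesis
      proof cases
        case 1
        then have "par z \<noteq> 1" using not1[OF y(1)] b y by auto
        then show ?thesis using own_par[of x] x a 1 by simp
      next
        case 2
        then have "par z \<noteq> 1" using not1[OF x(1)] a x by auto
        then show ?thesis using own_par[of y] y b 2 by simp
      qed
    qed simp
    then show "e = f" using own[OF x(1), of a] own[OF y(1), of b] a b x y by simp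
  qed
  moreover have "inj_on (\<lambda>x. {x, par x}) Y"
    by (rule inj_onI) (metis insertI1 own)
  then have "card ?M = r" using nr r by (simp add: card_image Y_def)
  ultimately show ?thesis by blast
qed

text \<open>The children of the root form such a set: every other vertex is the root or hangs below
  one of them.\<close>

lemma max_indep_ex: "\<exists>A. max_indep {1..n} E A \<and> card A = r + k"
proof (intro exI[of _ "{2..r + 1 + k}"] conjI)
  show "max_indep {1..n} E {2..r + 1 + k}"
    unfolding max_indep_def
  proof (intro conjI ballI)
    show "{2..r + 1 + k} \<subseteq> {1..n}" using nr by auto
    show "\<not> e \<subseteq> {2..r + 1 + k}" if "e \<in> E" for e
      using that by (auto simp: E_def broom_parent_def)
    fix w assume w: "w \<in> {1..n} - {2..r + 1 + k}"
    show "\<exists>a\<in>{2..r + 1 + k}. {w, a} \<in> E"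
    proof (cases "w = 1")
      case True
      then show ?thesis using r nr by (intro bexI[of _ 2]) (auto simp: edge_iff broom_parent_def)
    next
      case False
      then have "w \<in> {2..n}" "par w \<noteq> 1" using w par_eq_1[of w] by auto
      then show ?thesis
        using par_less[of w] par_le[of w] by (intro bexI[of _ "par w"]) (auto simp: edge_iff)
    qed
  qed
qed simp

text \<open>If the root is in \<open>A\<close>, all n - (r + 1 + k) vertices at distance two are
  forced in, and \<open>nk\<close> makes these and the root at least r + k. If not, each of the r +
  k branches contributes its own vertex.\<close>

lemma max_indep_ge:
  assumes A: "max_indep {1..n} E A" shows "r + k \<le> card A"
proof (cases "1 \<in> A")
  case True
  have "x \<in> A" if x: "x \<in> {r + 2 + k..n}" for x
  proof (rule ccontr)
    assume "x \<notin> A"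
    then obtain a where a: "a \<in> A" "{x, a} \<in> E" using max_indepD(3)[OF A, of x] x by auto
    have xn: "x \<in> {2..n}" "par x \<noteq> 1" using x par_eq_1[of x] by auto
    have "a = par x" using a(2) x par_le[of a] by (auto simp: edge_iff)
    moreover have "{par x, 1} \<in> E"
      using xn par_less[OF xn(1)] par_le[of x] by (auto simp: edge_iff broom_parent_def[of r k "par x"])
    ultimately show False using max_indepD(2)[OF A a(1) True] by simp
  qed
  then have "insert 1 {r + 2 + k..n} \<subseteq> A" using True by blast
  moreover have "finite A" using max_indepD(1)[OF A] finite_subset by blast
  ultimately have "card (insert 1 {r + 2 + k..n}) \<le> card A" by (intro card_mono)
  then show ?thesis using nk by simp
next
  case False
  \<comment> \<open>A child of the root outside \<open>A\<close> has a leaf below it, which is then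
    forced into \<open>A\<close>. The offset \<open>r - 1 + k\<close> inverts that in
    \<open>broom_parent\<close>, and \<open>n\<close> is a leaf at 2.\<close>
  define \<phi> where "\<phi> x = (if x \<in> A then x else if x = 2 then n else x + (r - 1 + k))" for x
  have leaf: "y \<in> A" if y: "y \<in> {2..n}" "\<And>z. z \<in> {2..n} \<Longrightarrow> par z \<noteq> y" "par y \<notin> A" for y
  proof (rule ccontr)
    assume "y \<notin> A"
    then obtain a where "a \<in> A" "{y, a} \<in> E" using max_indepD(3)[OF A, of y] y by auto
    then show False using y by (auto simp: edge_iff)
  qed
  have "\<phi> x \<in> A" if x: "x \<in> {2..r + 1 + k}" for x
  proof (cases "x \<in> A")
    case xA: False
    have xle: "x \<le> r + 1"
    proof (rule ccontr)
      assume "\<not> x \<le> r + 1"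
      then have "par z \<noteq> x" for z using par_le[of z] by auto
      moreover have "par x = 1" using x by (simp add: broom_parent_def)
      ultimately show False using leaf[of x] xA False x nr by auto
    qed
    let ?y = "\<phi> x"
    have y: "?y \<in> {2..n}" "par ?y = x" "?y > r + 1"
      using xA x xle nr r by (auto simp: \<phi>_def broom_parent_def)
    have "par z \<noteq> ?y" for z using par_le[of z] y(3) by auto
    then show ?thesis using leaf[OF y(1)] y(2) xA by simp
  qed (simp add: \<phi>_def)
  moreover have "inj_on \<phi> {2..r + 1 + k}"
  proof (rule inj_onI)
    fix x y assume xy: "x \<in> {2..r + 1 + k}" "y \<in> {2..r + 1 + k}" "\<phi> x = \<phi> y"
    have le: "z \<le> r + 1" if "z \<notin> A" "z \<in> {2..r + 1 + k}" for z
    proof (rule ccontr)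
      assume "\<not> z \<le> r + 1"
      then have "par w \<noteq> z" for w using par_le[of w] by auto
      moreover have "par z = 1" using that by (simp add: broom_parent_def)
      ultimately show False using leaf[of z] that False nr by auto
    qed
    show "x = y" using xy le[of x] le[of y] nr r by (auto simp: \<phi>_def split: if_splits)
  qed
  moreover have "finite A" using max_indepD(1)[OF A] finite_subset by blast
  ultimately have "card {2..r + 1 + k} \<le> card A" by (intro card_inj_on_le[of \<phi>]) auto
  then show ?thesis by simp
qed

end

theorem theorem3p13:
  fixes n :: nat
  assumes "n \<ge> 4"
  shows "TREE_pd_reg TYPE('k::field) n =
    {(p, r). 1 \<le> r \<and> real_of_int r < real n / 2 \<and> \<lceil>real n / 2\<rceil> \<le> p \<and> p \<le> int n - r}"
proof (intro equalityI subsetI)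
  fix q assume "q \<in> TREE_pd_reg TYPE('k) n"
  then obtain E where T: "E \<in> TREE n" and q:
    "q = (proj_dim n (quotient_module n (edge_ideal n E :: 'k mpoly set)),
      regularity n (quotient_module n (edge_ideal n E :: 'k mpoly set)))"
    by (auto simp: TREE_pd_reg_def)
  obtain p r A M where *: "\<And>A. max_indep {1..n} E A \<Longrightarrow> n \<le> p + card A" "max_indep {1..n} E A" "p + card A \<le> n"
    "\<And>M. induced_matching E M \<Longrightarrow> card M \<le> r" "induced_matching E M" "r = card M" and pr:
    "proj_dim n (quotient_module n (edge_ideal n E :: 'k mpoly set)) = int p"
    "regularity n (quotient_module n (edge_ideal n E :: 'k mpoly set)) = int r"
    using tree_resolves[OF T, of "TYPE('k)"] by metis
  have "1 \<le> r" "2 * r < n" "n \<le> 2 * p" "p + r \<le> n"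
    using tree_bounds[OF T _ *(2,3,1,4,5,6)] assms by auto
  then show "q \<in> {(p, r). 1 \<le> r \<and> real_of_int r < real n / 2 \<and> \<lceil>real n / 2\<rceil> \<le> p \<and> p \<le> int n - r}"
    unfolding q pr by (auto simp: ceiling_le_iff)
next
  fix q :: "int \<times> int"
  assume "q \<in> {(p, r). 1 \<le> r \<and> real_of_int r < real n / 2 \<and> \<lceil>real n / 2\<rceil> \<le> p \<and> p \<le> int n - r}"
  then obtain p r where q: "q = (p, r)" "1 \<le> r" "2 * r < int n" "int n \<le> 2 * p" "p \<le> int n - r"
    by (auto simp: ceiling_le_iff)
  \<comment> \<open>The bound \<open>p \<le> int n - r\<close> makes the difference nonnegative, and
    2 r < n \<le> 2 p yields r < p, the condition \<open>nr\<close> of the locale.\<close>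
  define k where "k = nat (int n - p - r)"
  interpret broom n "nat r" k
    using q by unfold_locales (auto simp: k_def)
  obtain p' r' A M where *: "\<And>A. max_indep {1..n} E A \<Longrightarrow> n \<le> p' + card A" "max_indep {1..n} E A" "p' + card A \<le> n"
    "\<And>M. induced_matching E M \<Longrightarrow> card M \<le> r'" "induced_matching E M" "r' = card M" and pr:
    "proj_dim n (quotient_module n (edge_ideal n E :: 'k mpoly set)) = int p'"
    "regularity n (quotient_module n (edge_ideal n E :: 'k mpoly set)) = int r'"
    using tree_resolves[OF tree, of "TYPE('k)"] by metis
  obtain M0 where "induced_matching E M0" "card M0 = nat r" using induced_matching_ex by blast
  then have "r' = nat r" using *(4)[of M0] induced_matching_le[OF *(5)] *(6) by simp
  moreover obtain A0 where "max_indep {1..n} E A0" "card A0 = nat r + k" using max_indep_ex by blast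
  then have "p' + (nat r + k) = n" using *(1)[of A0] max_indep_ge[OF *(2)] *(3) by simp
  ultimately have "int p' = p" "int r' = r" using q by (auto simp: k_def)
  then show "q \<in> TREE_pd_reg TYPE('k) n"
    unfolding TREE_pd_reg_def q(1) using tree pr by (intro CollectI exI[of _ E]) simp
qed

end
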